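(* Let $q=e^{2\pi i\tau}$, $\tau$ in the upper half-plane. For $\beta\in\{0,1\}$ let $\mathrm{C}\Psi_{2,1}(q)=\frac{(q^2;q^2)_{\infty}^5}{(q;q)_{\infty}^4(q^4;q^4)_{\infty}^2}=\sum_{n\ge0}c\psi_{2,1}(n)q^n$ and $\mathrm{C}\Psi_{2,0}(q)=\frac{(q^4;q^4)_{\infty}^2}{(q;q)_{\infty}^2(q^2;q^2)_{\infty}}=\sum_{n\ge0}c\psi_{2,0}(n)q^n$. For $\alpha\ge 1$ let $a\in\{0,1\}$ with $a\equiv\alpha\pmod 2$ and define $$L_{\alpha}^{(\beta)} := \frac{1}{\mathrm{C}\Psi_{2,\beta}\left(q^{1+4a}\right)}\sum_{\substack{n\ge0\\ 3\cdot 2^{\beta+1}n\equiv (-1)^{\beta+1}\bmod{5^{\alpha}}}} c\psi_{2,\beta}(n)\, q^{\lfloor n/5^{\alpha}\rfloor + \beta}.$$ Let $$t = q\frac{(q^5;q^5)_{\infty}^6}{(q;q)_{\infty}^6},\quad x = q\frac{(q^2;q^2)_{\infty}(q^{10};q^{10})_{\infty}^3}{(q;q)_{\infty}^3(q^5;q^5)_{\infty}},\quad y = q^2\frac{(q^2;q^2)_{\infty}^2(q^4;q^4)_{\infty}(q^5;q^5)_{\infty}(q^{20};q^{20})_{\infty}^3}{(q;q)_{\infty}^5(q^{10};q^{10})_{\infty}^2},$$ and \begin{align*} p^{(1)}_{0} &= 85 t + 625 t^2 - 24 x - 64 x^2 - 4 y - 1000 t y - 12500 t^2 y + 992 x y +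 12000 t x y + 3520 x^2 y + 40000 t x^2 y,\\ p^{(1)}_{1} &= t + 25 t^2 - 8 t x - 4 y - 8 t y - 500 t^2 y - 32 x y + 480 t x y - 64 x^2 y + 1600 t x^2 y,\\ p^{(0)}_{0} &= 1 + 5 t + 64 x + 600 t x + 208 x^2 + 2000 t x^2 + 4 y + 1000 t y + 12500 t^2 y - 992 x y - 12000 t x y - 3520 x^2 y - 40000 t x^2 y,\\ p^{(0)}_{1} &= 1 + 9 t + 8 x + 64 t x + 16 x^2 + 80 t x^2 + 4 y + 8 t y + 500 t^2 y + 32 x y - 480 t x y + 64 x^2 y - 1600 t x^2 y. \end{align*} For $\beta\in\{0,1\}$ let $\mathcal{R}^{(\beta)}=\mathbb{C}(t)+p^{(\beta)}_{0}\mathbb{C}(t)+p^{(\beta)}_{1}\mathbb{C}(t)$ and let $\sigma^{(\beta)}:\mathcal{R}^{(\beta)}\to\mathcal{R}^{(1-\beta)}$ be the mapping fixing $t$ (and $\mathbb{C}(t)$) and sending $p^{(\beta)}_a\mapsto p^{(1-\beta)}_a$ for $a\in\{0,1\}$, i.e. $A+Bp^{(\beta)}_0+Cp^{(\beta)}_1\mapsto A+Bp^{(1-\beta)}_0+Cp^{(1-\beta)}_1$ for $A,B,C\in\mathbb{C}(t)$. Then for every $\alpha\ge1$ and $\beta\in\{0,1\}$, $$\sigma^{(\beta)}\left(L^{(\beta)}_{\alpha}\right)=L^{(1-\beta)}_{\alpha}.$$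
   Context: $(q^a;q^b)_{\infty} = \prod_{m\ge 0}(1-q^{bm+a})$. All functions are regarded as functions of $\tau$ via $q=e^{2\pi i\tau}$; $t,x,y$ and the $L_\alpha^{(\beta)}$ are modular functions for $\Gamma_0(20)$ ($t$ is a Hauptmodul for $\Gamma_0(5)$). *)

theory Defs
  imports "HOL-Complex_Analysis.Complex_Analysis" "HOL-Number_Theory.Cong"
begin

definition qpoch :: "nat \<Rightarrow> nat \<Rightarrow> complex \<Rightarrow> complex" where
  "qpoch a b q = (\<Prod>m. 1 - q ^ (b * m + a))"

text \<open>
  The parameter \<open>\<beta>\<close> ranges over \<open>{0, 1}\<close>; only these two values occur.
\<close>

definition CPsi2 :: "nat \<Rightarrow> complex \<Rightarrow> complex" where
  "CPsi2 \<beta> q =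
     (if \<beta> = 1 then qpoch 2 2 q ^ 5 / (qpoch 1 1 q ^ 4 * qpoch 4 4 q ^ 2)
      else qpoch 4 4 q ^ 2 / (qpoch 1 1 q ^ 2 * qpoch 2 2 q))"

definition cpsi2 :: "nat \<Rightarrow> nat \<Rightarrow> complex" where
  "cpsi2 \<beta> n = fps_nth (fps_expansion (CPsi2 \<beta>) 0) n"

definition uhp :: "complex set" where
  "uhp = {\<tau>. Im \<tau> > 0}"

definition nome :: "complex \<Rightarrow> complex" where
  "nome \<tau> = exp (2 * of_real pi * \<i> * \<tau>)"

text \<open>
  Meromorphic functions on the upper half-plane, each represented by exactly one HOL function:
  removable singularities are removed, and the value is 0 at the poles and outside the
  upper half-plane.
\<close>

definition mero_uhp :: "(complex \<Rightarrow> complex) set" where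
  "mero_uhp = {f. f nicely_meromorphic_on uhp \<and> (\<forall>\<tau>. \<tau> \<notin> uhp \<longrightarrow> f \<tau> = 0)}"

text \<open>
  Pointwise arithmetic only agrees with arithmetic of meromorphic functions away from the poles,
  so identities between expressions are required to hold outside a set without accumulation
  points in the upper half-plane.
\<close>

definition mero_eq :: "(complex \<Rightarrow> complex) \<Rightarrow> (complex \<Rightarrow> complex) \<Rightarrow> bool" where
  "mero_eq f g \<longleftrightarrow> (\<forall>\<^sub>\<approx>\<tau>\<in>uhp. f \<tau> = g \<tau>)"

definition Lser :: "nat \<Rightarrow> nat \<Rightarrow> complex \<Rightarrow> complex" where
  "Lser \<beta> \<alpha> \<tau> =
     (if \<tau> \<in> uhp then
        1 / CPsi2 \<beta> (nome \<tau> ^ (1 + 4 * (\<alpha> mod 2))) *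
        (\<Sum>\<^sub>\<infinity>n\<in>{n. [3 * 2 ^ (\<beta> + 1) * int n = (- 1) ^ (\<beta> + 1)] (mod 5 ^ \<alpha>)}.
           cpsi2 \<beta> n * nome \<tau> ^ (n div 5 ^ \<alpha> + \<beta>))
      else 0)"

definition fn_t :: "complex \<Rightarrow> complex" where
  "fn_t \<tau> = (let q = nome \<tau> in q * (qpoch 5 5 q ^ 6 / qpoch 1 1 q ^ 6))"

definition fn_x :: "complex \<Rightarrow> complex" where
  "fn_x \<tau> = (let q = nome \<tau> in
     q * ((qpoch 2 2 q * qpoch 10 10 q ^ 3) / (qpoch 1 1 q ^ 3 * qpoch 5 5 q)))"

definition fn_y :: "complex \<Rightarrow> complex" where
  "fn_y \<tau> = (let q = nome \<tau> in
     q ^ 2 * ((qpoch 2 2 q ^ 2 * qpoch 4 4 q * qpoch 5 5 q * qpoch 20 20 q ^ 3)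
              / (qpoch 1 1 q ^ 5 * qpoch 10 10 q ^ 2)))"

definition fn_p0 :: "nat \<Rightarrow> complex \<Rightarrow> complex" where
  "fn_p0 \<beta> \<tau> = (let t = fn_t \<tau>; x = fn_x \<tau>; y = fn_y \<tau> in
     if \<beta> = 1 then
       85*t + 625*t^2 - 24*x - 64*x^2 - 4*y - 1000*t*y - 12500*t^2*y
       + 992*x*y + 12000*t*x*y + 3520*x^2*y + 40000*t*x^2*y
     else
       1 + 5*t + 64*x + 600*t*x + 208*x^2 + 2000*t*x^2 + 4*y + 1000*t*y + 12500*t^2*y
       - 992*x*y - 12000*t*x*y - 3520*x^2*y - 40000*t*x^2*y)"

definition fn_p1 :: "nat \<Rightarrow> complex \<Rightarrow> complex" where
  "fn_p1 \<beta> \<tau> = (let t = fn_t \<tau>; x = fn_x \<tau>; y = fn_y \<tau> in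
     if \<beta> = 1 then
       t + 25*t^2 - 8*t*x - 4*y - 8*t*y - 500*t^2*y
       - 32*x*y + 480*t*x*y - 64*x^2*y + 1600*t*x^2*y
     else
       1 + 9*t + 8*x + 64*t*x + 16*x^2 + 80*t*x^2 + 4*y + 8*t*y + 500*t^2*y
       + 32*x*y - 480*t*x*y + 64*x^2*y - 1600*t*x^2*y)"

text \<open>The field of rational functions in \<open>t\<close>.\<close>

definition Ct :: "(complex \<Rightarrow> complex) set" where
  "Ct = {\<lambda>\<tau>. poly P (fn_t \<tau>) / poly Q (fn_t \<tau>) | P Q. Q \<noteq> 0}"

definition Rspace :: "nat \<Rightarrow> (complex \<Rightarrow> complex) set" where
  "Rspace \<beta> = {f \<in> mero_uhp. \<exists>A\<in>Ct. \<exists>B\<in>Ct. \<exists>C\<in>Ct.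
            mero_eq f (\<lambda>\<tau>. A \<tau> + B \<tau> * fn_p0 \<beta> \<tau> + C \<tau> * fn_p1 \<beta> \<tau>)}"

text \<open>
  The description is unambiguous because \<open>1\<close>, \<open>fn_p0 \<beta>\<close>, \<open>fn_p1 \<beta>\<close> are linearly independent over
  the field of rational functions in \<open>t\<close>.
\<close>

definition sigma_map :: "nat \<Rightarrow> (complex \<Rightarrow> complex) \<Rightarrow> complex \<Rightarrow> complex" where
  "sigma_map \<beta> f = (THE g. g \<in> mero_uhp \<and> (\<exists>A\<in>Ct. \<exists>B\<in>Ct. \<exists>C\<in>Ct.
     mero_eq f (\<lambda>\<tau>. A \<tau> + B \<tau> * fn_p0 \<beta> \<tau> + C \<tau> * fn_p1 \<beta> \<tau>) \<and>
     mero_eq g (\<lambda>\<tau>. A \<tau> + B \<tau> * fn_p0 (1 - \<beta>) \<tau> + C \<tau> * fn_p1 (1 - \<beta>) \<tau>)))"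

end

theory Submission
  imports Defs
begin

text \<open>
  Up to a power of \<open>q\<close> and a constant, \<open>CPsi2 \<beta>\<close> is \<open>theta / eta^2\<close> with \<open>theta\<close> one of the two theta
  functions \<open>\<phi>(q)\<close>, \<open>q^(1/4) \<psi>(q^2)\<close>. Let \<open>r\<close> be the Rogers--Ramanujan continued fraction. Then \<open>eta (\<tau> / 5)\<close> is
  \<open>eta (5 \<tau>) (1 / r - 1 - r)\<close>, the function \<open>1 / t\<close> is \<open>r^-5 - 11 - r^5\<close>, and for both theta functions
  \<open>theta (\<tau> / 5) = theta (5 \<tau>) + r (theta \<tau> + theta (5 \<tau>)) + (theta \<tau> - theta (5 \<tau>)) / r\<close>.
  These relations come from double theta sums over sublattices of index 5, and they are the same for both
  values of \<open>\<beta>\<close>. Hence extracting every fifth coefficient amounts to averaging a rational function of \<open>r\<close> over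
  \<open>r \<mapsto> \<zeta> r\<close>, and with \<open>z = theta (5 \<tau>) / theta \<tau>\<close> and \<open>W = r^5 + r^-5\<close> induction on \<open>\<alpha>\<close> gives
  \<open>L = A(t) + B(t) W z\<close> or \<open>L = A(t) + B(t) W / z\<close> according to the parity of \<open>\<alpha>\<close>, where the Laurent polynomials
  \<open>A\<close>, \<open>B\<close> do not depend on \<open>\<beta>\<close>. Finally \<open>p0 = 1 + 70 t + 625 t^2 - t W z\<close> and \<open>p1 = t^2 W / z\<close> for both \<open>\<beta>\<close>.
  The functions \<open>1\<close>, \<open>p0\<close>, \<open>p1\<close> are independent over \<open>\<complex>(t)\<close>: \<open>y\<close> is not a rational function of \<open>x\<close>, and
  \<open>(1 + 4 x)^2\<close> takes different values at the two points \<open>x = 0\<close>, \<open>x = -1/4\<close> above \<open>t = 0\<close>.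
\<close>

section \<open>The Jacobi triple product\<close>

text \<open>No modular transformation other than a translation of \<tau> is used. Every identity
  comes from q-series in the unit disc, and a relation that fixes a function only up to sign is
  settled by its behaviour along the imaginary axis. The translations are by multiples of 24: they
  fix q^(1/24), hence all eta and theta values, while 24 is prime to 5, so r still runs through its
  five conjugates. One fact makes \<beta> drop out: with v = 1/r - r, each theta function at \<tau>
  / 5 equals theta (5 \<tau>) (1 - v) + theta \<tau> (r + 1/r). The symmetry r -> -1/r fixes v and t
  and negates r + 1/r and W, so averaging the first part gives a function of t and averaging the
  second gives W times one. Independence of 1, p0, p1 is essential because sigma is a definite
  description: its value is determined only if coefficients are unique. For this, everything is
  written in x and a square root Y of a cubic in x; exchanging the two values of \<beta> negates Y
  in p0 and p1.\<close>

lemma summable_gauss_nat: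
  fixes \<rho> R :: real
  assumes "0 \<le> \<rho>" "\<rho> < 1" "0 \<le> R"
  shows "summable (\<lambda>k. \<rho> ^ (k ^ 2) * R ^ k)"
proof -
  have "(\<lambda>k. \<rho> ^ k * R) \<longlonglongrightarrow> 0 * R"
    by (intro tendsto_intros LIMSEQ_power_zero) (use assms in auto)
  hence "\<forall>\<^sub>F k in sequentially. \<rho> ^ k * R < 1/2"
    by (intro order_tendstoD(2)[where y = 0]) auto
  hence "\<forall>\<^sub>F k in sequentially. norm (\<rho> ^ (k ^ 2) * R ^ k) \<le> (1/2) ^ k"
  proof eventually_elim
    case (elim k)
    have "\<rho> ^ (k ^ 2) * R ^ k = (\<rho> ^ k * R) ^ k"
      by (simp add: power_mult_distrib power2_eq_square power_mult)
    also have "\<dots> \<le> (1/2) ^ k"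
      using elim assms by (intro power_mono) auto
    finally show ?case
      using assms by simp
  qed
  thus ?thesis
    by (rule summable_comparison_test_ev) (auto intro!: summable_geometric)
qed

lemma summable_on_gauss_int:
  fixes \<rho> R :: real
  assumes "0 \<le> \<rho>" "\<rho> < 1" "0 \<le> R"
  shows "(\<lambda>k::int. \<rho> ^ nat (k\<^sup>2) * R ^ nat \<bar>k\<bar>) summable_on UNIV"
proof -
  let ?f = "\<lambda>k::int. \<rho> ^ nat (k\<^sup>2) * R ^ nat \<bar>k\<bar>"
  have nat: "(\<lambda>k::nat. \<rho> ^ (k ^ 2) * R ^ k) summable_on UNIV"
    using summable_gauss_nat[OF assms] assms
    by (intro summable_nonneg_imp_summable_on) auto
  have sq: "nat ((int k)\<^sup>2) = k\<^sup>2" for k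
    by (metis nat_int of_nat_power)
  have "?f summable_on range int"
    using nat by (subst summable_on_reindex) (auto simp: o_def sq)
  moreover have "?f summable_on range (\<lambda>k. - int k)"
    using nat by (subst summable_on_reindex) (auto simp: o_def sq inj_on_def)
  moreover have "range int \<union> range (\<lambda>k. - int k) = UNIV"
    by (auto simp: image_iff) (metis int_cases2)
  ultimately show ?thesis
    using summable_on_union by metis
qed

lemma norm_powi_le:
  fixes z :: complex
  assumes "z \<noteq> 0"
  shows "norm (z powi k) \<le> max (norm z) (1 / norm z) ^ nat \<bar>k\<bar>"
proof (cases "k \<ge> 0")
  case True
  hence "norm (z powi k) = norm z ^ nat \<bar>k\<bar>"
    by (simp add: power_int_def norm_power)
  also have "\<dots> \<le> max (norm z) (1 / norm z) ^ nat \<bar>k\<bar>"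
    by (intro power_mono) auto
  finally show ?thesis .
next
  case False
  hence "norm (z powi k) = inverse (norm z) ^ nat \<bar>k\<bar>"
    by (simp add: power_int_def norm_power norm_inverse)
  also have "\<dots> \<le> max (norm z) (1 / norm z) ^ nat \<bar>k\<bar>"
    by (intro power_mono) (auto simp: inverse_eq_divide)
  finally show ?thesis .
qed

lemma convergent_prod_one_plus:
  fixes a :: "nat \<Rightarrow> complex"
  assumes "summable (\<lambda>m. norm (a m))"
  shows "convergent_prod (\<lambda>m. 1 + a m)"
  using summable_imp_abs_convergent_prod[of "\<lambda>m. 1 + a m"] assms
  by (intro abs_convergent_prod_imp_convergent_prod) simp

lemma summable_geometric_progression:
  fixes q :: complex
  assumes "norm q < 1" "b > 0"
  shows "summable (\<lambda>m. norm (c * q ^ (b * m + a)))"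
proof -
  have "norm q ^ b < 1"
    using assms by (simp add: power_less_one_iff)
  hence "summable (\<lambda>m. (norm c * norm q ^ a) * (norm q ^ b) ^ m)"
    by (intro summable_mult summable_geometric) auto
  moreover have "norm (c * q ^ (b * m + a)) = (norm c * norm q ^ a) * (norm q ^ b) ^ m" for m
    unfolding norm_mult norm_power power_add power_mult by simp
  ultimately show ?thesis
    by (simp only:)
qed

lemma convergent_prod_geometric_progression:
  fixes q :: complex
  assumes "norm q < 1" "b > 0"
  shows "convergent_prod (\<lambda>m. 1 + c * q ^ (b * m + a))"
  by (intro convergent_prod_one_plus summable_geometric_progression assms)

context
  fixes p :: complex
  assumes p: "p \<noteq> 0" "norm p < 1"
begin

definition jtp_Q :: "nat \<Rightarrow> complex" where
  "jtp_Q n = (\<Prod>j<n. 1 - p ^ (2 * j + 2))"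

definition jtp_iQ :: "int \<Rightarrow> complex" where
  "jtp_iQ m = (if m < 0 then 0 else 1 / jtp_Q (nat m))"

lemma pow_neq_1: "k > 0 \<Longrightarrow> p ^ k \<noteq> 1"
  using p by (metis norm_one norm_power power_less_one_iff norm_ge_zero less_irrefl)

lemma jtp_Q_nonzero: "jtp_Q n \<noteq> 0"
proof -
  have "1 - p ^ (2 * j + 2) \<noteq> 0" for j
    using pow_neq_1[of "2 * j + 2"] by simp
  thus ?thesis
    unfolding jtp_Q_def by (subst prod_zero_iff) blast+
qed

text \<open>At m = -1 the factor is 1 - p powi 0 = 0, matching the value 0 of \<open>jtp_iQ\<close>
  at negative arguments; so one recurrence serves all integers.\<close>

lemma jtp_iQ_rec: "jtp_iQ m = (1 - p powi (2 * m + 2)) * jtp_iQ (m + 1)"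
proof -
  consider "m < -1" | "m = -1" | n where "m = int n"
  proof (cases "m \<ge> 0")
    case True
    thus ?thesis using that(3)[of "nat m"] by simp
  next
    case False
    thus ?thesis using that(1,2) by force
  qed
  thus ?thesis
  proof cases
    case 3
    have "2 * m + 2 = int (2 * n + 2)" using 3 by simp
    hence "p powi (2 * m + 2) = p ^ (2 * n + 2)"
      by (metis power_int_of_nat)
    moreover have "nat (m + 1) = Suc n" using 3 by simp
    moreover have "p ^ (2 * n + 2) \<noteq> 1" by (rule pow_neq_1) simp
    ultimately show ?thesis
      using jtp_Q_nonzero[of n] 3 by (simp add: jtp_iQ_def jtp_Q_def)
  qed (auto simp: jtp_iQ_def)
qed

text \<open>The Gaussian binomial coefficient \<open>[2 n; n + k]\<close> with base \<open>p^2\<close>. Since \<open>jtp_iQ\<close> vanishes at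
  negative arguments, no case distinction on \<open>\<bar>k\<bar> \<le> n\<close> is needed.\<close>

definition jtp_c :: "nat \<Rightarrow> int \<Rightarrow> complex" where
  "jtp_c n k = jtp_Q (2 * n) * jtp_iQ (int n + k) * jtp_iQ (int n - k)"

text \<open>Two q-Pascal steps in one. All factors are expressed through A, B and the two common
  reciprocals X, Y, which leaves a polynomial identity.\<close>

lemma jtp_c_rec:
  "jtp_c (Suc n) k = (1 + p ^ (4 * n + 2)) * jtp_c n k
     + p powi (2 * (int n + 1 - k)) * jtp_c n (k - 1) + p powi (2 * (int n + 1 + k)) * jtp_c n (k + 1)"
proof -
  define A where "A = p powi (2 * (int n + k))"
  define B where "B = p powi (2 * (int n - k))"
  define X where "X = jtp_iQ (int n + 1 + k)"
  define Y where "Y = jtp_iQ (int n + 1 - k)"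
  have com: "int n + k + 1 = int n + 1 + k" "int n - k + 1 = int n + 1 - k"
    by simp_all
  have sh: "p powi (2 * m + 2) = p powi (2 * m) * p ^ 2" for m
    using p by (simp add: power_int_add)
  have a1: "jtp_iQ (int n + k) = (1 - A * p ^ 2) * X"
    using jtp_iQ_rec[of "int n + k"] unfolding sh com X_def A_def .
  have b1: "jtp_iQ (int n - k) = (1 - B * p ^ 2) * Y"
    using jtp_iQ_rec[of "int n - k"] unfolding sh com Y_def B_def .
  have a2: "jtp_iQ (int n + (k - 1)) = (1 - A) * (1 - A * p ^ 2) * X"
  proof -
    have "2 * (int n + k - 1) + 2 = 2 * (int n + k)" "int n + k - 1 + 1 = int n + k"
      "int n + (k - 1) = int n + k - 1" by simp_all
    thus ?thesis
      using jtp_iQ_rec[of "int n + k - 1"] by (simp only: A_def [symmetric] a1 mult.assoc)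
  qed
  have b2: "jtp_iQ (int n - (k + 1)) = (1 - B) * (1 - B * p ^ 2) * Y"
  proof -
    have "2 * (int n - k - 1) + 2 = 2 * (int n - k)" "int n - k - 1 + 1 = int n - k"
      "int n - (k + 1) = int n - k - 1" by simp_all
    thus ?thesis
      using jtp_iQ_rec[of "int n - k - 1"] by (simp only: B_def [symmetric] b1 mult.assoc)
  qed
  have a3: "jtp_iQ (int n + (k + 1)) = X" "jtp_iQ (int n - (k - 1)) = Y"
    "jtp_iQ (int (Suc n) + k) = X" "jtp_iQ (int (Suc n) - k) = Y"
    by (simp_all add: X_def Y_def algebra_simps)
  have AB: "A * B = p ^ (4 * n)"
  proof -
    have "A * B = p powi (2 * (int n + k) + 2 * (int n - k))"
      unfolding A_def B_def by (rule power_int_add [symmetric]) (use p in auto)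
    also have "2 * (int n + k) + 2 * (int n - k) = int (4 * n)" by simp
    finally show ?thesis by (metis power_int_of_nat)
  qed
  have q: "jtp_Q (2 * Suc n) = jtp_Q (2 * n) * (1 - A * B * p ^ 2) * (1 - A * B * p ^ 4)"
  proof -
    have Suc: "jtp_Q (Suc m) = jtp_Q m * (1 - p ^ (2 * m + 2))" for m
      by (simp add: jtp_Q_def)
    have "2 * Suc n = Suc (Suc (2 * n))" "2 * (2 * n) + 2 = 4 * n + 2" "2 * Suc (2 * n) + 2 = 4 * n + 4"
      by simp_all
    thus ?thesis
      by (simp only: Suc AB power_add [symmetric])
  qed
  have e: "p powi (2 * (int n + 1 - k)) = B * p ^ 2" "p powi (2 * (int n + 1 + k)) = A * p ^ 2"
    using sh[of "int n - k"] sh[of "int n + k"] by (simp_all add: A_def B_def algebra_simps)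
  have P: "p ^ (4 * n + 2) = A * B * p ^ 2"
    by (simp only: AB power_add)
  show ?thesis
    unfolding jtp_c_def a1 b1 a2 b2 a3 q e P by algebra
qed

lemma pow_sq_powi: "p ^ nat (k\<^sup>2) = p powi (k\<^sup>2)"
  by (simp add: power_int_def)

text \<open>A finite form of the triple product. The new factor (1 + z p^(2n+1)) (1 + p^(2n+1) / z)
  expands into 1 + p^(4n+2) and two terms that shift k by one, which is the shape of
  \<open>jtp_c_rec\<close>.\<close>

lemma jtp_finite:
  assumes z: "z \<noteq> 0"
  shows "((\<lambda>k. jtp_c n k * p ^ nat (k\<^sup>2) * z powi k) has_sum
           (\<Prod>j<n. (1 + z * p ^ (2 * j + 1)) * (1 + p ^ (2 * j + 1) / z))) UNIV"
proof (induction n)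
  case 0
  show ?case
    by (rule has_sum_finite_neutralI[where B = "{0}"])
       (auto simp: jtp_c_def jtp_iQ_def jtp_Q_def)
next
  case (Suc n)
  let ?f = "\<lambda>n k. jtp_c n k * p ^ nat (k\<^sup>2) * z powi k"
  let ?P = "\<Prod>j<n. (1 + z * p ^ (2 * j + 1)) * (1 + p ^ (2 * j + 1) / z)"
  have 1: "((\<lambda>k. ?f n (k - 1)) has_sum ?P) UNIV"
    using Suc.IH
    by (subst has_sum_reindex_bij_witness[where i = "\<lambda>k. k + 1" and j = "\<lambda>k. k - 1" and T = UNIV
         and h = "\<lambda>k. ?f n k" and s' = ?P]) auto
  have 2: "((\<lambda>k. ?f n (k + 1)) has_sum ?P) UNIV"
    using Suc.IH
    by (subst has_sum_reindex_bij_witness[where i = "\<lambda>k. k - 1" and j = "\<lambda>k. k + 1" and T = UNIV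
         and h = "\<lambda>k. ?f n k" and s' = ?P]) auto
  have "((\<lambda>k. (1 + p ^ (4 * n + 2)) * ?f n k + (z * p ^ (2 * n + 1)) * ?f n (k - 1)
            + (p ^ (2 * n + 1) / z) * ?f n (k + 1)) has_sum
        ((1 + p ^ (4 * n + 2)) * ?P + (z * p ^ (2 * n + 1)) * ?P + (p ^ (2 * n + 1) / z) * ?P)) UNIV"
    by (intro has_sum_add has_sum_cmult_right Suc.IH 1 2)
  also have "(1 + p ^ (4 * n + 2)) * ?P + (z * p ^ (2 * n + 1)) * ?P + (p ^ (2 * n + 1) / z) * ?P
     = (\<Prod>j<Suc n. (1 + z * p ^ (2 * j + 1)) * (1 + p ^ (2 * j + 1) / z))"
  proof -
    have e: "p ^ (4 * n + 2) = p ^ (2 * n + 1) * p ^ (2 * n + 1)"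
      by (simp add: power_add [symmetric])
    show ?thesis
      unfolding prod.lessThan_Suc e using z by (simp add: field_simps)
  qed
  also have "(\<lambda>k. (1 + p ^ (4 * n + 2)) * ?f n k + (z * p ^ (2 * n + 1)) * ?f n (k - 1)
            + (p ^ (2 * n + 1) / z) * ?f n (k + 1)) = ?f (Suc n)"
  proof
    fix k :: int
    have e0: "p ^ (2 * n + 1) = p powi (2 * int n + 1)"
      using power_int_of_nat[of p "2 * n + 1"] by (simp add: add.commute)
    have e1: "z * p ^ (2 * n + 1) * (p ^ nat ((k - 1)\<^sup>2) * z powi (k - 1)) =
              p powi (2 * (int n + 1 - k)) * (p ^ nat (k\<^sup>2) * z powi k)"
    proof -
      have "p ^ (2 * n + 1) * p ^ nat ((k - 1)\<^sup>2) = p powi (2 * int n + 1 + (k - 1)\<^sup>2)"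
        unfolding e0 pow_sq_powi using p by (simp add: power_int_add)
      also have "2 * int n + 1 + (k - 1)\<^sup>2 = 2 * (int n + 1 - k) + k\<^sup>2"
        by (simp add: power2_eq_square algebra_simps)
      also have "p powi \<dots> = p powi (2 * (int n + 1 - k)) * p ^ nat (k\<^sup>2)"
        unfolding pow_sq_powi using p by (simp add: power_int_add)
      finally have "p ^ (2 * n + 1) * p ^ nat ((k - 1)\<^sup>2) = p powi (2 * (int n + 1 - k)) * p ^ nat (k\<^sup>2)" .
      moreover have "z * z powi (k - 1) = z powi k"
        using z by (simp add: power_int_diff)
      moreover have "z * p ^ (2 * n + 1) * (p ^ nat ((k - 1)\<^sup>2) * z powi (k - 1)) =
          (p ^ (2 * n + 1) * p ^ nat ((k - 1)\<^sup>2)) * (z * z powi (k - 1))"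
        by (simp only: mult_ac)
      ultimately show ?thesis by (simp only: mult.assoc)
    qed
    have e2: "(p ^ (2 * n + 1) / z) * (p ^ nat ((k + 1)\<^sup>2) * z powi (k + 1)) =
              p powi (2 * (int n + 1 + k)) * (p ^ nat (k\<^sup>2) * z powi k)"
    proof -
      have "p ^ (2 * n + 1) * p ^ nat ((k + 1)\<^sup>2) = p powi (2 * int n + 1 + (k + 1)\<^sup>2)"
        unfolding e0 pow_sq_powi using p by (simp add: power_int_add)
      also have "2 * int n + 1 + (k + 1)\<^sup>2 = 2 * (int n + 1 + k) + k\<^sup>2"
        by (simp add: power2_eq_square algebra_simps)
      also have "p powi \<dots> = p powi (2 * (int n + 1 + k)) * p ^ nat (k\<^sup>2)"
        unfolding pow_sq_powi using p by (simp add: power_int_add)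
      finally have *: "p ^ (2 * n + 1) * p ^ nat ((k + 1)\<^sup>2) = p powi (2 * (int n + 1 + k)) * p ^ nat (k\<^sup>2)" .
      have "z powi (k + 1) / z = z powi k"
        using z by (simp add: power_int_add)
      moreover have "(p ^ (2 * n + 1) / z) * (p ^ nat ((k + 1)\<^sup>2) * z powi (k + 1)) =
          (p ^ (2 * n + 1) * p ^ nat ((k + 1)\<^sup>2)) * (z powi (k + 1) / z)"
        by (simp only: mult_ac times_divide_eq_left times_divide_eq_right)
      ultimately show ?thesis using * by (simp only: mult.assoc)
    qed
    have "?f (Suc n) k = (1 + p ^ (4 * n + 2)) * ?f n k
       + jtp_c n (k - 1) * (p powi (2 * (int n + 1 - k)) * (p ^ nat (k\<^sup>2) * z powi k))
       + jtp_c n (k + 1) * (p powi (2 * (int n + 1 + k)) * (p ^ nat (k\<^sup>2) * z powi k))"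
      unfolding jtp_c_rec by (simp only: ring_distribs mult_ac)
    also have "\<dots> = (1 + p ^ (4 * n + 2)) * ?f n k + (z * p ^ (2 * n + 1)) * ?f n (k - 1)
            + (p ^ (2 * n + 1) / z) * ?f n (k + 1)"
      unfolding e1 [symmetric] e2 [symmetric] by (simp only: mult_ac)
    finally show "(1 + p ^ (4 * n + 2)) * ?f n k + (z * p ^ (2 * n + 1)) * ?f n (k - 1)
            + (p ^ (2 * n + 1) / z) * ?f n (k + 1) = ?f (Suc n) k" ..
  qed
  finally show ?case .
qed


lemma jtp_Q_tendsto: "jtp_Q \<longlonglongrightarrow> (\<Prod>m. 1 - p ^ (2 * m + 2))"
  and jtp_Q_limit_nonzero: "(\<Prod>m. 1 - p ^ (2 * m + 2)) \<noteq> 0"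
proof -
  have c: "convergent_prod (\<lambda>m. 1 - p ^ (2 * m + 2))"
    using convergent_prod_geometric_progression[of p 2 "-1" 2] p by simp
  show "jtp_Q \<longlonglongrightarrow> (\<Prod>m. 1 - p ^ (2 * m + 2))"
    unfolding jtp_Q_def by (intro has_prod_imp_tendsto' convergent_prod_has_prod c)
  have "1 - p ^ (2 * j + 2) \<noteq> 0" for j
    using pow_neq_1[of "2 * j + 2"] by simp
  thus "(\<Prod>m. 1 - p ^ (2 * m + 2)) \<noteq> 0"
    by (intro prodinf_nonzero c)
qed

lemma jtp_iQ_tendsto: "(\<lambda>n. jtp_iQ (int n + k)) \<longlonglongrightarrow> 1 / (\<Prod>m. 1 - p ^ (2 * m + 2))"
proof -
  have "filterlim (\<lambda>n. nat (int n + k)) at_top sequentially"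
    unfolding filterlim_at_top
  proof
    fix Z :: nat
    show "\<forall>\<^sub>F n in sequentially. Z \<le> nat (int n + k)"
      using eventually_ge_at_top[of "nat (int Z + \<bar>k\<bar>)"] by eventually_elim linarith
  qed
  from filterlim_compose[OF jtp_Q_tendsto this]
  have "(\<lambda>n. 1 / jtp_Q (nat (int n + k))) \<longlonglongrightarrow> 1 / (\<Prod>m. 1 - p ^ (2 * m + 2))"
    by (intro tendsto_intros jtp_Q_limit_nonzero)
  moreover have "\<forall>\<^sub>F n in sequentially. 1 / jtp_Q (nat (int n + k)) = jtp_iQ (int n + k)"
    using eventually_ge_at_top[of "nat \<bar>k\<bar>"]
    by eventually_elim (auto simp: jtp_iQ_def)
  ultimately show ?thesis
    by (rule Lim_transform_eventually)
qed

lemma jtp_c_tendsto: "(\<lambda>n. jtp_c n k) \<longlonglongrightarrow> 1 / (\<Prod>m. 1 - p ^ (2 * m + 2))"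
proof -
  let ?Q = "\<Prod>m. 1 - p ^ (2 * m + 2)"
  have "filterlim (\<lambda>n::nat. 2 * n) at_top sequentially"
    by (rule filterlim_subseq) (auto simp: strict_mono_def)
  from filterlim_compose[OF jtp_Q_tendsto this]
  have "(\<lambda>n. jtp_Q (2 * n) * jtp_iQ (int n + k) * jtp_iQ (int n + - k)) \<longlonglongrightarrow> ?Q * (1 / ?Q) * (1 / ?Q)"
    by (intro tendsto_mult jtp_iQ_tendsto)
  thus ?thesis
    using jtp_Q_limit_nonzero by (simp add: jtp_c_def [abs_def])
qed

text \<open>Uniformity in both n and k supplies the majorant for letting n tend to infinity.\<close>

lemma jtp_c_bounded: "\<exists>K\<ge>0. \<forall>n k. norm (jtp_c n k) \<le> K"
proof -
  obtain K1 where K1: "K1 > 0" "\<And>n. norm (jtp_Q n) \<le> K1"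
    using convergent_imp_Bseq[OF convergentI[OF jtp_Q_tendsto]] by (auto simp: Bseq_def)
  have "(\<lambda>n. 1 / jtp_Q n) \<longlonglongrightarrow> 1 / (\<Prod>m. 1 - p ^ (2 * m + 2))"
    by (intro tendsto_intros jtp_Q_tendsto jtp_Q_limit_nonzero)
  then obtain K2 where K2: "K2 > 0" "\<And>n. norm (1 / jtp_Q n) \<le> K2"
    by (metis Bseq_def convergentI convergent_imp_Bseq)
  have i: "norm (jtp_iQ m) \<le> K2" for m
    using K2 by (simp add: jtp_iQ_def)
  have "norm (jtp_c n k) \<le> K1 * K2 * K2" for n k
    unfolding jtp_c_def norm_mult using K1 K2 i by (intro mult_mono) auto
  thus ?thesis
    using K1(1) K2(1) by (intro exI[of _ "K1 * K2 * K2"]) auto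
qed

end

text \<open>The limit of \<open>jtp_finite\<close>: each coefficient tends to 1 / Q, and the terms
  are dominated by a Gaussian series.\<close>

theorem jacobi_triple_product:
  fixes p z :: complex
  assumes p: "p \<noteq> 0" "norm p < 1" and z: "z \<noteq> 0"
  shows "((\<lambda>k::int. p ^ nat (k\<^sup>2) * z powi k) has_sum
           ((\<Prod>m. 1 - p ^ (2 * m + 2)) * (\<Prod>m. 1 + z * p ^ (2 * m + 1)) *
            (\<Prod>m. 1 + p ^ (2 * m + 1) / z))) UNIV"
proof -
  define Q where "Q = (\<Prod>m. 1 - p ^ (2 * m + 2))"
  define R where "R = max (norm z) (1 / norm z)"
  define P1 where "P1 = (\<Prod>m. 1 + z * p ^ (2 * m + 1))"
  define P2 where "P2 = (\<Prod>m. 1 + p ^ (2 * m + 1) / z)"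
  \<comment> \<open>The integers are enumerated by \<open>int_decode\<close>, because Tannery's
    theorem concerns series over the naturals.\<close>
  define a where "a = (\<lambda>j n. jtp_c p n (int_decode j) * p ^ nat ((int_decode j)\<^sup>2) * z powi int_decode j)"
  define b where "b = (\<lambda>j. 1 / Q * p ^ nat ((int_decode j)\<^sup>2) * z powi int_decode j)"
  have Q0: "Q \<noteq> 0"
    unfolding Q_def by (rule jtp_Q_limit_nonzero[OF p])
  have R0: "R \<ge> 0" by (simp add: R_def le_max_iff_disj)
  obtain K where K: "K \<ge> 0" "\<And>n k. norm (jtp_c p n k) \<le> K"
    using jtp_c_bounded[OF p] by blast
  define M where "M = (\<lambda>j. K * (norm p ^ nat ((int_decode j)\<^sup>2) * R ^ nat \<bar>int_decode j\<bar>))"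
  have bij: "bij_betw int_decode UNIV UNIV"
    by (rule bij_int_decode)
  have "(\<lambda>k::int. norm p ^ nat (k\<^sup>2) * R ^ nat \<bar>k\<bar>) summable_on UNIV"
    by (rule summable_on_gauss_int) (use p R0 in auto)
  hence "(\<lambda>j. norm p ^ nat ((int_decode j)\<^sup>2) * R ^ nat \<bar>int_decode j\<bar>) summable_on UNIV"
    by (subst summable_on_reindex_bij_betw[OF bij])
  hence sM: "summable M"
    unfolding M_def by (intro summable_mult summable_on_imp_summable)
  have bound: "norm (a j n) \<le> M j" for j n
    unfolding a_def M_def norm_mult mult.assoc norm_power R_def
    by (intro mult_mono K norm_powi_le z) (use K in \<open>auto simp: le_max_iff_disj\<close>)
  have tann: "summable (\<lambda>j. norm (b j)) \<and> ((\<lambda>n. suminf (\<lambda>j. a j n)) \<longlonglongrightarrow> suminf b)"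
  proof -
    have "(\<lambda>n. a j n) \<longlonglongrightarrow> b j" for j
      unfolding a_def b_def Q_def by (intro tendsto_intros jtp_c_tendsto[OF p])
    moreover have "eventually (\<lambda>(j, n). norm (a j n) \<le> M j) (at_top \<times>\<^sub>F sequentially)"
      using bound by (intro always_eventually) auto
    ultimately show ?thesis
      using tannerys_theorem[of a b sequentially M] sM by auto
  qed
  have "suminf (\<lambda>j. a j n) = (\<Prod>j<n. (1 + z * p ^ (2 * j + 1)) * (1 + p ^ (2 * j + 1) / z))" for n
  proof -
    have "((\<lambda>j. a j n) has_sum (\<Prod>j<n. (1 + z * p ^ (2 * j + 1)) * (1 + p ^ (2 * j + 1) / z))) UNIV"
      unfolding a_def by (subst has_sum_reindex_bij_betw[OF bij]) (rule jtp_finite[OF p z])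
    from has_sum_imp_sums[OF this] show ?thesis by (simp add: sums_iff)
  qed
  moreover have "(\<lambda>n. \<Prod>j<n. (1 + z * p ^ (2 * j + 1)) * (1 + p ^ (2 * j + 1) / z)) \<longlonglongrightarrow> P1 * P2"
  proof -
    have 1: "convergent_prod (\<lambda>m. 1 + z * p ^ (2 * m + 1))"
      using convergent_prod_geometric_progression[of p 2 z 1] p by simp
    have 2: "convergent_prod (\<lambda>m. 1 + p ^ (2 * m + 1) / z)"
      using convergent_prod_geometric_progression[of p 2 "1/z" 1] p by simp
    show ?thesis
      unfolding prod.distrib P1_def P2_def
      by (intro tendsto_mult has_prod_imp_tendsto' convergent_prod_has_prod 1 2)
  qed
  ultimately have "suminf b = P1 * P2"
    using tann LIMSEQ_unique by auto
  hence "(b has_sum (P1 * P2)) UNIV"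
    using norm_summable_imp_has_sum[of b "P1 * P2"] tann summable_sums[OF summable_norm_cancel, of b] by auto
  hence "((\<lambda>k. 1 / Q * p ^ nat (k\<^sup>2) * z powi k) has_sum (P1 * P2)) UNIV"
    unfolding b_def by (subst (asm) has_sum_reindex_bij_betw[OF bij])
  from has_sum_cmult_right[OF this, of Q] show ?thesis
    using Q0 by (simp add: Q_def P1_def P2_def mult.assoc)
qed

section \<open>Products over arithmetic progressions\<close>

text \<open>The infinite product (-c q^a; q^b): c = -1 gives \<open>qpoch\<close>, c = 1 the
  products with plus signs that come out of the triple product.\<close>

definition gprod :: "complex \<Rightarrow> nat \<Rightarrow> nat \<Rightarrow> complex \<Rightarrow> complex" where
  "gprod c a b q = (\<Prod>m. 1 + c * q ^ (b * m + a))"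

lemma qpoch_eq_gprod: "qpoch a b q = gprod (-1) a b q"
  by (simp add: qpoch_def gprod_def)

lemma gprod_scale: "gprod c (k * a) (k * b) q = gprod c a b (q ^ k)"
proof -
  have "k * b * m + k * a = k * (b * m + a)" for m
    by (simp add: algebra_simps)
  thus ?thesis
    unfolding gprod_def power_mult [symmetric] by simp
qed

lemma gprod_nonzero:
  assumes "norm q < 1" "b > 0" "\<And>m. c * q ^ (b * m + a) \<noteq> -1"
  shows "gprod c a b q \<noteq> 0"
  unfolding gprod_def
  by (intro prodinf_nonzero convergent_prod_geometric_progression assms)
     (use assms(3) in \<open>metis add.commute add_eq_0_iff\<close>)

lemma gprod_diff_squares:
  assumes "norm q < 1" "b > 0"
  shows "gprod c a b q * gprod (-c) a b q = gprod (- (c ^ 2)) (2 * a) (2 * b) q"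
proof -
  have "(1 + c * q ^ (b * m + a)) * (1 + - c * q ^ (b * m + a)) = 1 + - (c ^ 2) * q ^ (2 * b * m + 2 * a)" for m
  proof -
    have "2 * b * m + 2 * a = (b * m + a) + (b * m + a)" by simp
    hence "q ^ (2 * b * m + 2 * a) = q ^ (b * m + a) * q ^ (b * m + a)"
      by (simp only: power_add)
    moreover define X where "X = q ^ (b * m + a)"
    ultimately have "q ^ (2 * b * m + 2 * a) = X * X" by simp
    thus ?thesis unfolding X_def [symmetric] by (simp add: power2_eq_square algebra_simps)
  qed
  moreover have "gprod c a b q * gprod (-c) a b q =
      (\<Prod>m. (1 + c * q ^ (b * m + a)) * (1 + - c * q ^ (b * m + a)))"
    unfolding gprod_def
    by (intro prodinf_mult convergent_prod_geometric_progression assms)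
  ultimately show ?thesis
    by (simp only: gprod_def)
qed

lemma gprod_dissect:
  assumes "norm q < 1" "b > 0" "k > 0"
  shows "gprod c a b q = (\<Prod>j<k. gprod c (a + b * j) (b * k) q)"
proof -
  define f where "f = (\<lambda>m. 1 + c * q ^ (b * m + a))"
  have lim: "(\<lambda>n. \<Prod>i<n. f i) \<longlonglongrightarrow> gprod c a b q"
    unfolding f_def gprod_def
    by (intro has_prod_imp_tendsto' convergent_prod_has_prod convergent_prod_geometric_progression assms)
  have lim1: "(\<lambda>n. \<Prod>i<n * k. f i) \<longlonglongrightarrow> gprod c a b q"
    using assms by (intro filterlim_compose[OF lim] filterlim_subseq) (auto simp: strict_mono_def)
  have e: "f (m * k + j) = 1 + c * q ^ (b * k * m + (a + b * j))" for m j
    by (simp add: f_def algebra_simps)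
  have "(\<Prod>i<n * k. f i) = (\<Prod>j<k. \<Prod>m<n. 1 + c * q ^ (b * k * m + (a + b * j)))" for n
  proof -
    have "(\<Prod>i<n * k. f i) = (\<Prod>m<n. \<Prod>i\<in>{m * k..<m * k + k}. f i)"
      by (rule prod.nat_group [symmetric])
    also have "\<dots> = (\<Prod>m<n. \<Prod>j<k. f (m * k + j))"
    proof (rule prod.cong [OF refl])
      fix m
      show "(\<Prod>i\<in>{m * k..<m * k + k}. f i) = (\<Prod>j<k. f (m * k + j))"
        by (rule prod.reindex_bij_witness[of _ "\<lambda>j. m * k + j" "\<lambda>i. i - m * k"]) auto
    qed
    also have "\<dots> = (\<Prod>j<k. \<Prod>m<n. f (m * k + j))"
      by (rule prod.swap)
    finally show ?thesis unfolding e .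
  qed
  moreover have "(\<lambda>n. \<Prod>j<k. \<Prod>m<n. 1 + c * q ^ (b * k * m + (a + b * j))) \<longlonglongrightarrow>
      (\<Prod>j<k. gprod c (a + b * j) (b * k) q)"
    unfolding gprod_def using assms
    by (intro tendsto_prod has_prod_imp_tendsto' convergent_prod_has_prod convergent_prod_geometric_progression) auto
  ultimately show ?thesis
    using lim1 LIMSEQ_unique by auto
qed

lemma gprod_shift_head:
  assumes "norm q < 1" "b > 0" "1 + c * q ^ a \<noteq> 0"
  shows "gprod c a b q = (1 + c * q ^ a) * gprod c (a + b) b q"
proof -
  have "gprod c a b q = (1 + c * q ^ a) * (\<Prod>m. 1 + c * q ^ (b * Suc m + a))"
    unfolding gprod_def
    by (subst prodinf_split_head) (use assms in \<open>auto intro!: convergent_prod_geometric_progression\<close>)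
  thus ?thesis
    by (simp add: gprod_def algebra_simps)
qed

lemma gprod_holomorphic: 
  assumes "b > 0"
  shows "gprod c a b holomorphic_on ball 0 1"
proof (rule holomorphic_uniform_sequence)
  show "(\<lambda>q. \<Prod>m<n. 1 + c * q ^ (b * m + a)) holomorphic_on ball 0 1" for n
    by (intro holomorphic_intros)
  fix x :: complex
  assume x: "x \<in> ball 0 1"
  define d where "d = (1 - norm x) / 2"
  define \<rho> where "\<rho> = (1 + norm x) / 2"
  have d: "d > 0" using x by (simp add: d_def)
  have \<rho>: "\<rho> < 1" "\<rho> \<ge> 0" using x by (simp_all add: \<rho>_def)
  have le: "norm q \<le> \<rho>" if "q \<in> cball x d" for q
    using that norm_triangle_ineq2[of q x] by (auto simp: dist_norm d_def \<rho>_def norm_minus_commute field_simps)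
  have sub: "cball x d \<subseteq> ball 0 1"
    using le \<rho> by force
  have "uniformly_convergent_on (cball x d) (\<lambda>N q. \<Sum>n<N. norm (c * q ^ (b * n + a)))"
  proof (rule Weierstrass_m_test'_ev)
    show "\<forall>\<^sub>F n in sequentially. \<forall>q\<in>cball x d. norm (norm (c * q ^ (b * n + a))) \<le> norm c * \<rho> ^ (b * n + a)"
      using le by (intro always_eventually) (auto simp: norm_mult norm_power intro!: mult_left_mono power_mono)
    show "summable (\<lambda>n. norm c * \<rho> ^ (b * n + a))"
      using summable_geometric_progression[of "of_real \<rho>" b c a] \<rho> assms by (simp add: norm_mult norm_power)
  qed
  hence "uniformly_convergent_on (cball x d) (\<lambda>N q. \<Prod>n<N. 1 + c * q ^ (b * n + a))"
    by (intro uniformly_convergent_on_prod) (auto intro!: continuous_intros)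
  hence "uniform_limit (cball x d) (\<lambda>N q. \<Prod>n<N. 1 + c * q ^ (b * n + a))
           (\<lambda>q. lim (\<lambda>N. \<Prod>n<N. 1 + c * q ^ (b * n + a))) sequentially"
    by (simp add: uniformly_convergent_uniform_limit_iff)
  also have "?this \<longleftrightarrow> uniform_limit (cball x d) (\<lambda>N q. \<Prod>n<N. 1 + c * q ^ (b * n + a)) (gprod c a b) sequentially"
  proof (rule uniform_limit_cong')
    fix q assume "q \<in> cball x d"
    hence "norm q < 1" using le[of q] \<rho> by simp
    hence "(\<lambda>N. \<Prod>n<N. 1 + c * q ^ (b * n + a)) \<longlonglongrightarrow> gprod c a b q"
      unfolding gprod_def
      by (intro has_prod_imp_tendsto' convergent_prod_has_prod convergent_prod_geometric_progression assms)
    thus "lim (\<lambda>N. \<Prod>n<N. 1 + c * q ^ (b * n + a)) = gprod c a b q"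
      by (rule limI)
  qed auto
  finally show "\<exists>d>0. cball x d \<subseteq> ball 0 1 \<and>
      uniform_limit (cball x d) (\<lambda>N q. \<Prod>n<N. 1 + c * q ^ (b * n + a)) (gprod c a b) sequentially"
    using d sub by blast
qed auto

text \<open>Euler's product at q^n, that is, the eta function at n \<tau> without its fractional
  power of q.\<close>

definition eul :: "nat \<Rightarrow> complex \<Rightarrow> complex" where
  "eul n q = qpoch n n q"

lemma eul_eq: "eul n q = gprod (-1) n n q"
  by (simp add: eul_def qpoch_eq_gprod)

lemma eul_power: "eul (k * n) q = eul n (q ^ k)"
  unfolding eul_eq by (rule gprod_scale)

lemma eul_nonzero:
  assumes "norm q < 1" "n > 0"
  shows "eul n q \<noteq> 0"
proof -
  have "q ^ k \<noteq> 1" if "k > 0" for k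
    using assms that by (metis norm_one norm_power power_less_one_iff norm_ge_zero less_irrefl)
  thus ?thesis
    unfolding eul_eq using assms by (intro gprod_nonzero) auto
qed

lemma eul_holomorphic: "n > 0 \<Longrightarrow> eul n holomorphic_on ball 0 1"
  unfolding eul_eq [abs_def] by (rule gprod_holomorphic)

lemma eul_at_0 [simp]: "n > 0 \<Longrightarrow> eul n 0 = 1"
  by (simp add: eul_def qpoch_def power_0_left)

lemma gprod_plus_same:
  assumes "norm q < 1" "n > 0"
  shows "gprod 1 n n q = eul (2 * n) q / eul n q"
  using gprod_diff_squares[OF assms, of 1 n] eul_nonzero[OF assms] by (simp add: eul_eq field_simps)

lemma gprod_odd:
  assumes "norm q < 1" "n > 0"
  shows "gprod c n n q = gprod c n (2 * n) q * gprod c (2 * n) (2 * n) q"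
  using gprod_dissect[OF assms(1,2), of 2 c n]
  by (simp add: numeral_2_eq_2 mult.commute)

lemma gprod_plus_odd:
  assumes "norm q < 1" "n > 0"
  shows "gprod 1 n (2 * n) q = eul (2 * n) q ^ 2 / (eul n q * eul (4 * n) q)"
proof -
  have nz: "eul n q \<noteq> 0" "eul (2 * n) q \<noteq> 0" "eul (4 * n) q \<noteq> 0"
    using eul_nonzero assms by simp_all
  have "eul (2 * n) q / eul n q = gprod 1 n (2 * n) q * (eul (4 * n) q / eul (2 * n) q)"
    using gprod_odd[OF assms, of 1] gprod_plus_same[OF assms] gprod_plus_same[of q "2 * n"] assms by simp
  thus ?thesis
    using nz by (simp add: field_simps power2_eq_square)
qed

section \<open>Theta sums\<close>

lemma
  fixes f :: "'a \<Rightarrow> complex" and g :: "'b \<Rightarrow> complex"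
  assumes "(\<lambda>x. norm (f x)) summable_on A" "(\<lambda>x. norm (g x)) summable_on B"
  shows abs_summable_on_times: "(\<lambda>z. norm (case z of (x, y) \<Rightarrow> f x * g y)) summable_on A \<times> B"
    and infsum_times: "infsum f A * infsum g B = (\<Sum>\<^sub>\<infinity>(x, y)\<in>A \<times> B. f x * g y)"
proof -
  have "(\<lambda>x. norm (infsum (\<lambda>y. norm (f x * g y)) B)) summable_on A"
    using assms(1) by (simp add: norm_mult infsum_cmult_right' abs_mult infsum_nonneg summable_on_cmult_left)
  moreover have "(\<lambda>y. norm (f x * g y)) summable_on B" for x
    using assms(2) by (simp add: norm_mult summable_on_cmult_right)
  ultimately show abs: "(\<lambda>z. norm (case z of (x, y) \<Rightarrow> f x * g y)) summable_on A \<times> B"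
    using Infinite_Sum.abs_summable_on_Sigma_iff[where f = "\<lambda>(x, y). f x * g y" and A = A and B = "\<lambda>_. B"] by simp
  have "infsum f A * infsum g B = (\<Sum>\<^sub>\<infinity>x\<in>A. \<Sum>\<^sub>\<infinity>y\<in>B. f x * g y)"
    by (simp add: infsum_cmult_right' infsum_cmult_left')
  also have "\<dots> = (\<Sum>\<^sub>\<infinity>(x, y)\<in>A \<times> B. f x * g y)"
    by (rule infsum_Sigma'_banach) (use abs in \<open>simp add: abs_summable_summable\<close>)
  finally show "infsum f A * infsum g B = (\<Sum>\<^sub>\<infinity>(x, y)\<in>A \<times> B. f x * g y)" .
qed

definition gsum :: "(int \<Rightarrow> complex) \<Rightarrow> (int \<Rightarrow> nat) \<Rightarrow> complex \<Rightarrow> complex" where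
  "gsum f e z = (\<Sum>\<^sub>\<infinity>x. f x * z ^ e x)"

text \<open>Exponents growing at least linearly, so that \<open>gsum f e\<close> converges in the unit disc.\<close>

definition lin_exp :: "(int \<Rightarrow> nat) \<Rightarrow> bool" where
  "lin_exp e \<longleftrightarrow> (\<exists>c. \<forall>x. nat \<bar>x\<bar> \<le> e x + c)"

definition unit_bounded :: "(int \<Rightarrow> complex) \<Rightarrow> bool" where
  "unit_bounded f \<longleftrightarrow> (\<forall>x. norm (f x) \<le> 1)"

lemma summable_on_geometric_int:
  fixes \<rho> :: real
  assumes "0 \<le> \<rho>" "\<rho> < 1"
  shows "(\<lambda>x::int. \<rho> ^ nat \<bar>x\<bar>) summable_on UNIV"
proof -
  let ?f = "\<lambda>k::int. \<rho> ^ nat \<bar>k\<bar>"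
  have nat: "(\<lambda>k::nat. \<rho> ^ k) summable_on UNIV"
    using assms by (intro summable_nonneg_imp_summable_on summable_geometric) auto
  have "?f summable_on range int"
    using nat by (subst summable_on_reindex) (auto simp: o_def)
  moreover have "?f summable_on range (\<lambda>k. - int k)"
    using nat by (subst summable_on_reindex) (auto simp: o_def inj_on_def)
  moreover have "range int \<union> range (\<lambda>k. - int k) = UNIV"
    by (auto simp: image_iff) (metis int_cases2)
  ultimately show ?thesis
    using summable_on_union by metis
qed

lemma gsum_bound:
  assumes f: "unit_bounded f" and c: "\<And>x. nat \<bar>x\<bar> \<le> e x + c"
    and z: "norm z \<le> \<rho>" "0 < \<rho>" "\<rho> < 1"
  shows "norm (f x * z ^ e x) \<le> (1 / \<rho> ^ c) * \<rho> ^ nat \<bar>x\<bar>"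
proof -
  have "norm (f x * z ^ e x) \<le> 1 * \<rho> ^ e x"
    unfolding norm_mult norm_power using f z
    by (intro mult_mono power_mono) (auto simp: unit_bounded_def)
  also have "\<dots> = (1 / \<rho> ^ c) * \<rho> ^ (e x + c)"
    using z by (simp add: power_add)
  also have "\<dots> \<le> (1 / \<rho> ^ c) * \<rho> ^ nat \<bar>x\<bar>"
    using z c[of x] by (intro mult_left_mono power_decreasing) auto
  finally show ?thesis .
qed

lemma gsum_abs_summable:
  assumes f: "unit_bounded f" and e: "lin_exp e" and z: "norm z < 1"
  shows "(\<lambda>x. norm (f x * z ^ e x)) summable_on A"
proof -
  obtain c where c: "\<And>x. nat \<bar>x\<bar> \<le> e x + c"
    using e by (auto simp: lin_exp_def)
  define \<rho> where "\<rho> = (1 + norm z) / 2"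
  have \<rho>: "norm z \<le> \<rho>" "0 < \<rho>" "\<rho> < 1"
    using z by (auto simp: \<rho>_def add_pos_nonneg)
  have "(\<lambda>x. (1 / \<rho> ^ c) * \<rho> ^ nat \<bar>x\<bar>) summable_on A"
    using \<rho> by (intro summable_on_cmult_right summable_on_subset_banach[OF summable_on_geometric_int]) auto
  thus ?thesis
    by (rule summable_on_comparison_test) (use gsum_bound[OF f c \<rho>] in auto)
qed

lemma gsum_summable:
  assumes "unit_bounded f" "lin_exp e" "norm z < 1"
  shows "(\<lambda>x. f x * z ^ e x) summable_on A"
  using gsum_abs_summable[OF assms] by (rule abs_summable_summable)

text \<open>Continuity is all that is needed of the sums; where holomorphy matters it is taken from
  product formulas.\<close>

lemma gsum_continuous:
  assumes f: "unit_bounded f" and e: "lin_exp e"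
  shows "continuous_on (ball 0 1) (gsum f e)"
proof -
  obtain c where c: "\<And>x. nat \<bar>x\<bar> \<le> e x + c"
    using e by (auto simp: lin_exp_def)
  have "isCont (gsum f e) z" if z: "norm z < 1" for z
  proof -
    define \<rho> where "\<rho> = (1 + norm z) / 2"
    have \<rho>: "norm z < \<rho>" "0 < \<rho>" "\<rho> < 1"
      using z by (auto simp: \<rho>_def add_pos_nonneg)
    define a where "a = (\<lambda>j w. f (int_decode j) * w ^ e (int_decode j))"
    define M where "M = (\<lambda>j. (1 / \<rho> ^ c) * \<rho> ^ nat \<bar>int_decode j\<bar>)"
    have bij: "bij_betw int_decode UNIV UNIV"
      by (rule bij_int_decode)
    have eq: "gsum f e w = suminf (\<lambda>j. a j w)" if "norm w < 1" for w
    proof -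
      have "((\<lambda>x. f x * w ^ e x) has_sum gsum f e w) UNIV"
        using gsum_summable[OF f e that] unfolding gsum_def by (rule has_sum_infsum)
      hence "((\<lambda>j. a j w) has_sum gsum f e w) UNIV"
        unfolding a_def by (subst has_sum_reindex_bij_betw[OF bij])
      from has_sum_imp_sums[OF this] show ?thesis by (simp add: sums_iff)
    qed
    have ev: "\<forall>\<^sub>F w in at z. norm w < \<rho>"
      using \<rho>(1) by (intro order_tendstoD(2)[OF tendsto_norm[OF tendsto_ident_at]])
    have lim: "((\<lambda>w. suminf (\<lambda>j. a j w)) \<longlongrightarrow> suminf (\<lambda>j. a j z)) (at z)"
    proof -
      have "((\<lambda>w. a j w) \<longlongrightarrow> a j z) (at z)" for j
        unfolding a_def by (intro tendsto_intros)
      moreover have "eventually (\<lambda>(j, w). norm (a j w) \<le> M j) (at_top \<times>\<^sub>F at z)"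
        unfolding eventually_prod_filter
      proof (intro exI conjI allI impI)
        show "eventually (\<lambda>_. True) (at_top :: nat filter)" by simp
        show "\<forall>\<^sub>F w in at z. norm w < \<rho>" by (rule ev)
        show "case (j, w) of (j, w) \<Rightarrow> norm (a j w) \<le> M j" if "norm w < \<rho>" for j w
          using gsum_bound[OF f c, of w \<rho> "int_decode j"] that \<rho> by (simp add: a_def M_def)
      qed
      moreover have "summable M"
        unfolding M_def using \<rho> summable_on_geometric_int[of \<rho>]
        by (intro summable_mult summable_on_imp_summable)
           (subst summable_on_reindex_bij_betw[OF bij], auto)
      ultimately show ?thesis
        using tannerys_theorem[of a "\<lambda>j. a j z" "at z" M] by auto
    qed
    have "\<forall>\<^sub>F w in at z. suminf (\<lambda>j. a j w) = gsum f e w"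
      using ev by eventually_elim (use \<rho> eq in auto)
    hence "(gsum f e \<longlongrightarrow> gsum f e z) (at z)"
      using lim unfolding eq[OF z] by (rule Lim_transform_eventually[rotated])
    thus ?thesis by (simp add: isCont_def)
  qed
  thus ?thesis
    by (intro continuous_at_imp_continuous_on) auto
qed

lemma gsum_at_0:
  assumes "finite {x. e x = 0}"
  shows "gsum f e 0 = (\<Sum>x | e x = 0. f x)"
proof -
  have "((\<lambda>x. f x * 0 ^ e x) has_sum (\<Sum>x | e x = 0. f x)) UNIV"
    by (rule has_sum_finite_neutralI[OF assms]) (auto simp: power_0_left)
  thus ?thesis unfolding gsum_def by (rule infsumI)
qed

abbreviation sqe :: "int \<Rightarrow> nat" where "sqe x \<equiv> nat (x\<^sup>2)"

abbreviation thsum :: "(int \<Rightarrow> complex) \<Rightarrow> complex \<Rightarrow> complex" where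
  "thsum f \<equiv> gsum f sqe"

lemma abs_le_sq: "\<bar>x\<bar> \<le> (x::int)\<^sup>2"
  using self_le_power[of "\<bar>x\<bar>" 2] by (cases "x = 0") auto

lemma lin_exp_sqe_diff: "lin_exp (\<lambda>x. sqe x - k)"
proof -
  have "nat \<bar>x\<bar> \<le> sqe x" for x
    by (intro nat_mono abs_le_sq)
  hence "nat \<bar>x\<bar> \<le> sqe x - k + k" for x
    by (meson le_diff_conv le_refl order_trans)
  thus ?thesis by (auto simp: lin_exp_def)
qed

lemma lin_exp_sqe: "lin_exp sqe"
  using lin_exp_sqe_diff[of 0] by simp

lemma lin_exp_mult:
  assumes "lin_exp e" "c > 0"
  shows "lin_exp (\<lambda>x. c * e x)"
proof -
  obtain d where d: "\<And>x. nat \<bar>x\<bar> \<le> e x + d"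
    using assms(1) by (auto simp: lin_exp_def)
  have "nat \<bar>x\<bar> \<le> c * e x + d" for x
  proof -
    have "e x \<le> c * e x" using assms(2) by simp
    thus ?thesis using d[of x] by linarith
  qed
  thus ?thesis by (auto simp: lin_exp_def)
qed

text \<open>The truncated subtraction in \<open>sqe x - k\<close> is harmless, since f vanishes
  wherever it truncates.\<close>

lemma thsum_factor:
  assumes "\<And>x. sqe x < k \<Longrightarrow> f x = 0"
  shows "thsum f z = z ^ k * gsum f (\<lambda>x. sqe x - k) z"
proof -
  have "f x * z ^ sqe x = z ^ k * (f x * z ^ (sqe x - k))" for x
    using assms[of x] by (cases "sqe x < k") (auto simp: power_add [symmetric])
  thus ?thesis
    unfolding gsum_def by (simp only: infsum_cmult_right')
qed

lemma thsum_power: "thsum f (z ^ k) = gsum f (\<lambda>x. k * sqe x) z"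
  by (simp add: gsum_def power_mult)

section \<open>Components modulo 5 of theta sums\<close>

text \<open>The quadratic Dirichlet character (12 / x). By Euler's pentagonal number theorem its
  theta sum in z = q^(1/24) is twice the eta function.\<close>

definition chi12 :: "int \<Rightarrow> int" where
  "chi12 x = (if x mod 12 \<in> {1, 11} then 1 else if x mod 12 \<in> {5, 7} then -1 else 0)"

abbreviation chi :: "int \<Rightarrow> complex" where "chi \<equiv> \<lambda>x. of_int (chi12 x)"

definition par :: "nat \<Rightarrow> int \<Rightarrow> complex" where
  "par c x = (if x mod 2 = int c then 1 else 0)"

text \<open>In a theta sum the exponent is x^2, so this dissects by the exponent mod 5; only j = 0,
  1, 4 give something nonzero.\<close>

definition comp5 :: "int \<Rightarrow> (int \<Rightarrow> complex) \<Rightarrow> int \<Rightarrow> complex" where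
  "comp5 j f x = (if x\<^sup>2 mod 5 = j then f x else 0)"

lemma unit_bounded_chi: "unit_bounded chi"
  by (auto simp: unit_bounded_def chi12_def)

lemma unit_bounded_par: "unit_bounded (par c)"
  by (auto simp: unit_bounded_def par_def)

lemma unit_bounded_comp5: "unit_bounded f \<Longrightarrow> unit_bounded (comp5 j f)"
  by (auto simp: unit_bounded_def comp5_def)

lemma square_mod_5: "(x::int)\<^sup>2 mod 5 = 0 \<or> x\<^sup>2 mod 5 = 1 \<or> x\<^sup>2 mod 5 = 4"
proof -
  have "x mod 5 \<in> {0..<5}" by simp
  also have "{0..<5::int} = {0, 1, 2, 3, 4}" by auto
  finally have "x mod 5 \<in> {0, 1, 2, 3, 4}" .
  hence "(x mod 5)\<^sup>2 mod 5 \<in> {0, 1, 4}" by auto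
  thus ?thesis by (simp add: power_mod)
qed

text \<open>The listed residues say that 5 divides x^2 + y^2, and x^2 + y^2 = (x - 2 y) (x + 2 y)
  mod 5.\<close>

lemma sq_pairs_mod_5:
  fixes x y :: int
  shows "x\<^sup>2 mod 5 = 0 \<and> y\<^sup>2 mod 5 = 0 \<or> x\<^sup>2 mod 5 = 1 \<and> y\<^sup>2 mod 5 = 4 \<or> x\<^sup>2 mod 5 = 4 \<and> y\<^sup>2 mod 5 = 1
         \<longleftrightarrow> 5 dvd x - 2 * y \<or> 5 dvd x + 2 * y" (is ?th1)
    and "5 dvd x - 2 * y \<and> 5 dvd x + 2 * y \<longleftrightarrow> x\<^sup>2 mod 5 = 0 \<and> y\<^sup>2 mod 5 = 0" (is ?th2)
proof -
  have r: "{0..<5::int} = {0, 1, 2, 3, 4}" by auto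
  have m: "x mod 5 \<in> {0, 1, 2, 3, 4}" "y mod 5 \<in> {0, 1, 2, 3, 4}"
    unfolding r [symmetric] by simp_all
  have e: "x\<^sup>2 mod 5 = (x mod 5)\<^sup>2 mod 5" "y\<^sup>2 mod 5 = (y mod 5)\<^sup>2 mod 5"
    by (simp_all add: power_mod)
  have d: "5 dvd x - 2 * y \<longleftrightarrow> (x mod 5 - 2 * (y mod 5)) mod 5 = 0"
    "5 dvd x + 2 * y \<longleftrightarrow> (x mod 5 + 2 * (y mod 5)) mod 5 = 0"
    by presburger+
  show ?th1 using m unfolding e d by (elim insertE emptyE; simp)
  show ?th2 using m unfolding e d by (elim insertE emptyE; simp)
qed

lemma int_sqe: "int (sqe x) = x\<^sup>2"
  by simp

lemma thsum_split:
  assumes "unit_bounded f" "norm z < 1"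
  shows "thsum f z = thsum (comp5 0 f) z + thsum (comp5 1 f) z + thsum (comp5 4 f) z"
proof -
  have s: "(\<lambda>x. comp5 j f x * z ^ sqe x) summable_on UNIV" for j
    by (intro gsum_summable unit_bounded_comp5 lin_exp_sqe assms)
  have "f x * z ^ sqe x = comp5 0 f x * z ^ sqe x + comp5 1 f x * z ^ sqe x + comp5 4 f x * z ^ sqe x" for x
    using square_mod_5[of x] by (auto simp: comp5_def)
  thus ?thesis
    unfolding gsum_def by (simp add: infsum_add s summable_on_add)
qed

lemma thsum_comp5_0:
  assumes "\<And>x. f (5 * x) = \<epsilon> * f x"
  shows "thsum (comp5 0 f) z = \<epsilon> * thsum f (z ^ 25)"
proof -
  have "thsum (comp5 0 f) z = (\<Sum>\<^sub>\<infinity>x\<in>range (\<lambda>x. 5 * x). f x * z ^ sqe x)"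
    unfolding gsum_def
  proof (rule infsum_cong_neutral)
    fix x :: int
    assume "x \<in> UNIV - range (\<lambda>x. 5 * x)"
    hence "\<not> 5 dvd x" by (auto simp: dvd_def)
    hence "\<not> 5 dvd x\<^sup>2" using prime_dvd_power[of "5::int" x 2] by auto
    thus "comp5 0 f x * z ^ sqe x = 0"
      by (auto simp: comp5_def dvd_eq_mod_eq_0)
  next
    fix x :: int
    assume "x \<in> UNIV \<inter> range (\<lambda>x. 5 * x)"
    hence "5 dvd x\<^sup>2" by (auto simp: power2_eq_square)
    thus "comp5 0 f x * z ^ sqe x = f x * z ^ sqe x"
      by (auto simp: comp5_def dvd_eq_mod_eq_0)
  qed auto
  also have "\<dots> = (\<Sum>\<^sub>\<infinity>x. f (5 * x) * z ^ sqe (5 * x))"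
    by (subst infsum_reindex) (auto simp: inj_on_def o_def)
  also have "\<dots> = (\<Sum>\<^sub>\<infinity>x. \<epsilon> * (f x * (z ^ 25) ^ sqe x))"
  proof -
    have "sqe (5 * x) = 25 * sqe x" for x :: int
      by (simp add: power_mult_distrib nat_mult_distrib)
    thus ?thesis by (simp add: assms power_mult mult.assoc)
  qed
  also have "\<dots> = \<epsilon> * thsum f (z ^ 25)"
    unfolding gsum_def by (rule infsum_cmult_right')
  finally show ?thesis .
qed

text \<open>The weight c is 1, or 6 when an eta sum in z meets a theta sum in z^6. Both are 1 mod 5,
  so x^2 + c y^2 is divisible by 5 on this sublattice.\<close>

definition pair_sum :: "nat \<Rightarrow> (int \<Rightarrow> complex) \<Rightarrow> (int \<Rightarrow> complex) \<Rightarrow> complex \<Rightarrow> complex" where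
  "pair_sum c f g z = (\<Sum>\<^sub>\<infinity>(x, y)\<in>{(x, y). 5 dvd x - 2 * y}. f x * g y * z ^ (sqe x + c * sqe y))"

lemma pair_product:
  assumes "unit_bounded f" "unit_bounded g" "norm z < 1" "c > 0"
  shows pair_summable: "(\<lambda>(x, y). f x * g y * z ^ (sqe x + c * sqe y)) summable_on A"
    and thsum_times: "thsum f z * thsum g (z ^ c) = (\<Sum>\<^sub>\<infinity>(x, y). f x * g y * z ^ (sqe x + c * sqe y))"
proof -
  have 1: "(\<lambda>x. norm (f x * z ^ sqe x)) summable_on UNIV"
    by (intro gsum_abs_summable lin_exp_sqe assms)
  have 2: "(\<lambda>x. norm (g x * z ^ (c * sqe x))) summable_on UNIV"
    by (intro gsum_abs_summable lin_exp_mult lin_exp_sqe assms)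
  have e: "(\<lambda>(x, y). f x * z ^ sqe x * (g y * z ^ (c * sqe y))) = (\<lambda>(x, y). f x * g y * z ^ (sqe x + c * sqe y))"
    by (auto simp: fun_eq_iff power_add)
  have "(\<lambda>(x, y). f x * g y * z ^ (sqe x + c * sqe y)) summable_on UNIV"
    using abs_summable_summable[OF abs_summable_on_times[OF 1 2]] unfolding e by simp
  thus "(\<lambda>(x, y). f x * g y * z ^ (sqe x + c * sqe y)) summable_on A"
    by (rule summable_on_subset_banach) auto
  show "thsum f z * thsum g (z ^ c) = (\<Sum>\<^sub>\<infinity>(x, y). f x * g y * z ^ (sqe x + c * sqe y))"
    unfolding thsum_power unfolding gsum_def infsum_times[OF 1 2] e by simp
qed

text \<open>Inclusion and exclusion: the pairs with 5 dividing x^2 + y^2 form two sublattices x = 2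
  y and x = -2 y mod 5, exchanged by y -> -y and meeting in the pairs with both entries divisible by
  5.\<close>

lemma comp5_product_sum:
  assumes f: "unit_bounded f" and g: "unit_bounded g" and even: "\<And>y. g (-y) = g y"
    and z: "norm z < 1" and c: "c > 0"
  shows "thsum (comp5 1 f) z * thsum (comp5 4 g) (z ^ c) + thsum (comp5 4 f) z * thsum (comp5 1 g) (z ^ c) =
         2 * pair_sum c f g z - 2 * (thsum (comp5 0 f) z * thsum (comp5 0 g) (z ^ c))"
proof -
  define H where "H = (\<lambda>(x, y). f x * g y * z ^ (sqe x + c * sqe y))"
  define A where "A = (\<lambda>i j. {(x::int, y::int). x\<^sup>2 mod 5 = i \<and> y\<^sup>2 mod 5 = j})"
  define D where "D = {(x::int, y). 5 dvd x - 2 * y}"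
  define D' where "D' = {(x::int, y). 5 dvd x + 2 * y}"
  have sH: "H summable_on X" for X
    unfolding H_def by (rule pair_summable[OF f g z c])
  have prod: "thsum (comp5 i f) z * thsum (comp5 j g) (z ^ c) = infsum H (A i j)" for i j
    unfolding thsum_times[OF unit_bounded_comp5[OF f] unit_bounded_comp5[OF g] z c]
    by (rule infsum_cong_neutral) (auto simp: H_def A_def comp5_def split: if_splits)
  have U: "A 0 0 \<union> A 1 4 \<union> A 4 1 = D \<union> D'"
  proof -
    have "p \<in> A 0 0 \<union> A 1 4 \<union> A 4 1 \<longleftrightarrow> p \<in> D \<union> D'" for p
      using sq_pairs_mod_5(1)[of "fst p" "snd p"]
      unfolding A_def D_def D'_def Un_iff mem_Collect_eq case_prod_unfold by argo
    thus ?thesis by blast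
  qed
  have I: "D \<inter> D' = A 0 0"
  proof -
    have "p \<in> D \<inter> D' \<longleftrightarrow> p \<in> A 0 0" for p
      using sq_pairs_mod_5(2)[of "fst p" "snd p"]
      unfolding A_def D_def D'_def Int_iff mem_Collect_eq case_prod_unfold by argo
    thus ?thesis by blast
  qed
  have "infsum H (A 0 0 \<union> A 1 4 \<union> A 4 1) = infsum H (A 0 0) + infsum H (A 1 4) + infsum H (A 4 1)"
    by (subst infsum_Un_disjoint infsum_Un_disjoint; (intro sH)?; (force simp: A_def)?)+
  moreover have "infsum H (D \<union> D') = infsum H D + infsum H D' - infsum H (D \<inter> D')"
    by (rule infsum_Un_Int) (rule sH)+
  moreover have "infsum H D' = infsum H D"
    by (rule infsum_reindex_bij_witness[of _ "\<lambda>(x, y). (x, -y)" "\<lambda>(x, y). (x, -y)"])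
       (auto simp: D_def D'_def H_def even)
  moreover have "infsum H D = pair_sum c f g z"
    by (simp add: pair_sum_def D_def H_def)
  ultimately show ?thesis
    unfolding prod U I by (simp add: algebra_simps)
qed

text \<open>The sublattice \<open>x \<equiv> 2 y (mod 5)\<close> is the ideal generated by \<open>2 + \<i>\<close> in the Gaussian integers.\<close>

lemma pair_sum_1:
  "pair_sum 1 f g z = (\<Sum>\<^sub>\<infinity>(k, l). f (2 * k - l) * g (k + 2 * l) * z ^ (5 * (sqe k + sqe l)))"
  unfolding pair_sum_def
proof (rule infsum_reindex_bij_witness[of _ "\<lambda>(k, l). (2 * k - l, k + 2 * l)"
         "\<lambda>(x, y). ((2 * x + y) div 5, (2 * y - x) div 5)"])
  fix a :: "int \<times> int"
  assume "a \<in> {(x, y). 5 dvd x - 2 * y}"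
  then obtain x y where a: "a = (x, y)" "5 dvd x - 2 * y" by auto
  then obtain m where m: "x = 2 * y + 5 * m" by (auto simp: dvd_def algebra_simps)
  have "2 * x + y = 5 * (y + 2 * m)" "2 * y - x = 5 * (- m)" using m by auto
  hence d: "(2 * x + y) div 5 = y + 2 * m" "(2 * y - x) div 5 = - m"
    by (metis nonzero_mult_div_cancel_left zero_neq_numeral)+
  have e: "2 * (y + 2 * m) - - m = x" "y + 2 * m + 2 * - m = y" using m by simp_all
  show "(case case a of (x, y) \<Rightarrow> ((2 * x + y) div 5, (2 * y - x) div 5) of (k, l) \<Rightarrow> (2 * k - l, k + 2 * l)) = a"
    by (simp only: a d prod.case e)
  have "5 * (sqe (y + 2 * m) + sqe (- m)) = sqe x + 1 * sqe y"
  proof -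
    have "int (5 * (sqe (y + 2 * m) + sqe (- m))) = int (sqe x + 1 * sqe y)"
      unfolding of_nat_add of_nat_mult int_sqe of_nat_numeral of_nat_1 m
      by (simp add: power2_eq_square algebra_simps)
    thus ?thesis by (simp only: of_nat_eq_iff)
  qed
  note s = this
  show "(case case a of (x, y) \<Rightarrow> ((2 * x + y) div 5, (2 * y - x) div 5) of
      (k, l) \<Rightarrow> f (2 * k - l) * g (k + 2 * l) * z ^ (5 * (sqe k + sqe l))) =
      (case a of (x, y) \<Rightarrow> f x * g y * z ^ (sqe x + 1 * sqe y))"
    by (simp only: a d prod.case e s)
next
  fix b :: "int \<times> int"
  obtain k l where b: "b = (k, l)" by force
  have "2 * (2 * k - l) + (k + 2 * l) = 5 * k" "2 * (k + 2 * l) - (2 * k - l) = 5 * l" by auto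
  hence d: "(2 * (2 * k - l) + (k + 2 * l)) div 5 = k" "(2 * (k + 2 * l) - (2 * k - l)) div 5 = l"
    by (metis nonzero_mult_div_cancel_left zero_neq_numeral)+
  show "(case case b of (k, l) \<Rightarrow> (2 * k - l, k + 2 * l) of (x, y) \<Rightarrow> ((2 * x + y) div 5, (2 * y - x) div 5)) = b"
    by (simp only: b prod.case d)
  have "2 * k - l - 2 * (k + 2 * l) = 5 * (- l)" by simp
  hence "5 dvd 2 * k - l - 2 * (k + 2 * l)" by (metis dvd_triv_left)
  thus "(case b of (k, l) \<Rightarrow> (2 * k - l, k + 2 * l)) \<in> {(x, y). 5 dvd x - 2 * y}"
    by (simp add: b)
qed auto

text \<open>Here \<open>x^2 + 6 y^2 = 5 (2 u^2 + 3 v^2)\<close>.\<close>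

lemma pair_sum_6:
  "pair_sum 6 f g z = (\<Sum>\<^sub>\<infinity>(u, v). f (2 * u - 3 * v) * g (u + v) * z ^ (10 * sqe u + 15 * sqe v))"
  unfolding pair_sum_def
proof (rule infsum_reindex_bij_witness[of _ "\<lambda>(u, v). (2 * u - 3 * v, u + v)"
         "\<lambda>(x, y). ((x + 3 * y) div 5, (2 * y - x) div 5)"])
  fix a :: "int \<times> int"
  assume "a \<in> {(x, y). 5 dvd x - 2 * y}"
  then obtain x y where a: "a = (x, y)" "5 dvd x - 2 * y" by auto
  then obtain m where m: "x = 2 * y + 5 * m" by (auto simp: dvd_def algebra_simps)
  have "x + 3 * y = 5 * (y + m)" "2 * y - x = 5 * (- m)" using m by auto
  hence d: "(x + 3 * y) div 5 = y + m" "(2 * y - x) div 5 = - m"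
    by (metis nonzero_mult_div_cancel_left zero_neq_numeral)+
  have e: "2 * (y + m) - 3 * - m = x" "y + m + - m = y" using m by simp_all
  show "(case case a of (x, y) \<Rightarrow> ((x + 3 * y) div 5, (2 * y - x) div 5) of (u, v) \<Rightarrow> (2 * u - 3 * v, u + v)) = a"
    by (simp only: a d prod.case e)
  have "10 * sqe (y + m) + 15 * sqe (- m) = sqe x + 6 * sqe y"
  proof -
    have "int (10 * sqe (y + m) + 15 * sqe (- m)) = int (sqe x + 6 * sqe y)"
      unfolding of_nat_add of_nat_mult int_sqe of_nat_numeral of_nat_1 m
      by (simp add: power2_eq_square algebra_simps)
    thus ?thesis by (simp only: of_nat_eq_iff)
  qed
  note s = this
  show "(case case a of (x, y) \<Rightarrow> ((x + 3 * y) div 5, (2 * y - x) div 5) of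
      (u, v) \<Rightarrow> f (2 * u - 3 * v) * g (u + v) * z ^ (10 * sqe u + 15 * sqe v)) =
      (case a of (x, y) \<Rightarrow> f x * g y * z ^ (sqe x + 6 * sqe y))"
    by (simp only: a d prod.case e s)
next
  fix b :: "int \<times> int"
  obtain u v where b: "b = (u, v)" by force
  have "2 * u - 3 * v + 3 * (u + v) = 5 * u" "2 * (u + v) - (2 * u - 3 * v) = 5 * v" by auto
  hence d: "(2 * u - 3 * v + 3 * (u + v)) div 5 = u" "(2 * (u + v) - (2 * u - 3 * v)) div 5 = v"
    by (metis nonzero_mult_div_cancel_left zero_neq_numeral)+
  show "(case case b of (u, v) \<Rightarrow> (2 * u - 3 * v, u + v) of (x, y) \<Rightarrow> ((x + 3 * y) div 5, (2 * y - x) div 5)) = b"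
    by (simp only: b prod.case d)
  have "2 * u - 3 * v - 2 * (u + v) = 5 * (- v)" by simp
  hence "5 dvd 2 * u - 3 * v - 2 * (u + v)" by (metis dvd_triv_left)
  thus "(case b of (u, v) \<Rightarrow> (2 * u - 3 * v, u + v)) \<in> {(x, y). 5 dvd x - 2 * y}"
    by (simp add: b)
qed auto

lemma infsum_antisymmetric:
  fixes h :: "int \<times> int \<Rightarrow> complex"
  assumes "\<And>k l. h (k, -l) = - h (k, l)"
  shows "infsum h UNIV = 0"
proof -
  have "infsum h UNIV = (\<Sum>\<^sub>\<infinity>x. - h x)"
    by (rule infsum_reindex_bij_witness[of _ "\<lambda>(k, l). (k, -l)" "\<lambda>(k, l). (k, -l)"])
       (auto simp: assms)
  thus ?thesis by (simp add: infsum_uminus)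
qed

lemma chi12_cong: "x mod 12 = y mod 12 \<Longrightarrow> chi12 x = chi12 y"
  by (simp add: chi12_def)

lemma mod_12_cases: "(x::int) mod 12 \<in> {0, 1, 2, 3, 4, 5, 6, 7, 8, 9, 10, 11}"
proof -
  have "x mod 12 = 0 \<or> x mod 12 = 1 \<or> x mod 12 = 2 \<or> x mod 12 = 3 \<or> x mod 12 = 4 \<or> x mod 12 = 5 \<or> x mod 12 = 6 \<or> x mod 12 = 7 \<or> x mod 12 = 8 \<or> x mod 12 = 9 \<or> x mod 12 = 10 \<or> x mod 12 = 11"
    by presburger
  thus ?thesis by blast
qed

lemma chi12_minus [simp]: "chi12 (-x) = chi12 x"
proof -
  have "(-x) mod 12 = (- (x mod 12)) mod 12" by (simp add: mod_simps)
  thus ?thesis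
    using mod_12_cases[of x] unfolding chi12_def by (elim insertE emptyE; simp)
qed

lemma chi12_times_5: "chi12 (5 * x) = - chi12 x"
proof -
  have "(5 * x) mod 12 = (5 * (x mod 12)) mod 12" by (simp add: mod_simps)
  thus ?thesis
    using mod_12_cases[of x] unfolding chi12_def by (elim insertE emptyE; simp)
qed

lemma chi12_even:
  assumes "even x"
  shows "chi12 x = 0"
proof -
  have "even (x mod 12)" using assms by presburger
  thus ?thesis
    using mod_12_cases[of x] unfolding chi12_def by (elim insertE emptyE; simp)
qed

lemma chi12_plus_6:
  assumes "odd x"
  shows "chi12 (x + 6) = - chi12 x"
proof -
  have "odd (x mod 12)" using assms by presburger
  moreover have "(x + 6) mod 12 = (x mod 12 + 6) mod 12" by (simp add: mod_simps)
  ultimately show ?thesis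
    using mod_12_cases[of x] unfolding chi12_def by (elim insertE emptyE; simp)
qed

text \<open>A check of residues mod 12. It makes the Gaussian double sum antisymmetric under l ->
  -l.\<close>

lemma chi12_gauss: "chi12 (2 * k + l) * chi12 (k - 2 * l) = - (chi12 (2 * k - l) * chi12 (k + 2 * l))"
proof -
  note m = mod_12_cases[of k] mod_12_cases[of l]
  have e: "chi12 (2 * k + l) = chi12 (2 * (k mod 12) + l mod 12)"
    "chi12 (k - 2 * l) = chi12 (k mod 12 - 2 * (l mod 12))"
    "chi12 (2 * k - l) = chi12 (2 * (k mod 12) - l mod 12)"
    "chi12 (k + 2 * l) = chi12 (k mod 12 + 2 * (l mod 12))"
    by (intro chi12_cong mod_add_cong mod_diff_cong mod_mult_cong; simp)+
  show ?thesis
    unfolding e using m by (elim insertE emptyE; simp add: chi12_def)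
qed

text \<open>The arguments differ by 6 v. For odd v this is 6 mod 12, which negates
  \<open>chi12\<close> at odd arguments; for even v both arguments are even and both values
  vanish.\<close>

lemma chi12_eisenstein: "chi12 (2 * u + 3 * v) = - chi12 (2 * u - 3 * v)"
proof (cases "even v")
  case True
  thus ?thesis by (simp add: chi12_even)
next
  case False
  then obtain w where w: "v = 2 * w + 1" by (elim oddE)
  have "chi12 (2 * u + 3 * v) = chi12 (2 * u - 3 * v + 6)"
  proof -
    have "(2 * u + 3 * v) mod 12 = (2 * u - 3 * v + 6) mod 12"
      unfolding w by (simp add: mod_eq_dvd_iff)
    thus ?thesis by (rule chi12_cong)
  qed
  also have "\<dots> = - chi12 (2 * u - 3 * v)"
    using False by (intro chi12_plus_6) auto
  finally show ?thesis .
qed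

lemma par_uminus [simp]: "par c (-x) = par c x"
proof -
  have "(-x) mod 2 = x mod 2" by presburger
  thus ?thesis by (simp add: par_def)
qed

lemma par_cong: "even (x - y) \<Longrightarrow> par c x = par c y"
proof -
  assume "even (x - y)"
  hence "x mod 2 = y mod 2" by presburger
  thus ?thesis by (simp add: par_def)
qed

lemma pair_sum_chi_chi: "pair_sum 1 chi chi z = 0"
  unfolding pair_sum_1
proof (rule infsum_antisymmetric, unfold prod.case)
  fix k l :: int
  have "chi (2 * k - - l) * chi (k + 2 * - l) = - (chi (2 * k - l) * chi (k + 2 * l))"
    using chi12_gauss[of k l] by (simp flip: of_int_mult of_int_minus)
  thus "chi (2 * k - - l) * chi (k + 2 * - l) * z ^ (5 * (sqe k + sqe (- l))) =
      - (chi (2 * k - l) * chi (k + 2 * l) * z ^ (5 * (sqe k + sqe l)))"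
    by simp
qed

lemma pair_sum_chi_par: "pair_sum 6 chi (par c) z = 0"
  unfolding pair_sum_6
proof (rule infsum_antisymmetric, unfold prod.case)
  fix u v :: int
  have "par c (u - v) = par c (u + v)" by (rule par_cong) simp
  thus "chi (2 * u - 3 * - v) * par c (u + - v) * z ^ (10 * sqe u + 15 * sqe (- v)) =
      - (chi (2 * u - 3 * v) * par c (u + v) * z ^ (10 * sqe u + 15 * sqe v))"
    using chi12_eisenstein[of u v] by simp
qed

text \<open>Multiplication by 2 + \<i> only swaps the parities of k and l, so the sublattice sum is
  again the square of the same theta sum.\<close>

lemma pair_sum_par_par:
  assumes "norm z < 1"
  shows "pair_sum 1 (par c) (par c) z = thsum (par c) (z ^ 5) ^ 2"
proof -
  have "norm (z ^ 5) < 1" using assms by (simp add: norm_power power_less_one_iff)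
  from thsum_times[OF unit_bounded_par[of c] unit_bounded_par[of c] this zero_less_one]
  have "thsum (par c) (z ^ 5) ^ 2 = (\<Sum>\<^sub>\<infinity>(x, y). par c x * par c y * (z ^ 5) ^ (sqe x + sqe y))"
    by (simp add: power2_eq_square)
  also have "\<dots> = pair_sum 1 (par c) (par c) z"
    unfolding pair_sum_1
  proof (rule infsum_cong, clarify)
    fix k l :: int
    have "par c (2 * k - l) = par c l" "par c (k + 2 * l) = par c k"
      by (intro par_cong; simp)+
    thus "par c k * par c l * (z ^ 5) ^ (sqe k + sqe l) =
        par c (2 * k - l) * par c (k + 2 * l) * z ^ (5 * (sqe k + sqe l))"
      by (simp only: power_mult mult.commute[of "par c k"])
  qed
  finally show ?thesis ..
qed

lemma thsum_chi_0: "thsum (comp5 0 chi) z = - thsum chi (z ^ 25)"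
  using thsum_comp5_0[of chi "-1" z] by (simp add: chi12_times_5)

lemma thsum_par_0: "thsum (comp5 0 (par c)) z = thsum (par c) (z ^ 25)"
proof -
  have "par c (5 * x) = 1 * par c x" for x
    using par_cong[of "5 * x" x c] by simp
  from thsum_comp5_0[of "par c" 1, OF this] show ?thesis by simp
qed

lemma chi_uminus: "chi (-y) = chi y"
  by simp

lemma chi_components:
  assumes "norm z < 1"
  shows "thsum (comp5 1 chi) z * thsum (comp5 4 chi) z = - (thsum chi (z ^ 25) ^ 2)"
proof -
  define A B C where "A = thsum (comp5 1 chi) z" and "B = thsum (comp5 4 chi) z" and "C = thsum chi (z ^ 25)"
  have "A * B + B * A = 2 * 0 - 2 * (- C * - C)"
    using comp5_product_sum[OF unit_bounded_chi unit_bounded_chi chi_uminus assms zero_less_one]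
    unfolding A_def B_def C_def pair_sum_chi_chi thsum_chi_0 power_one_right .
  hence "A * B = - (C ^ 2)" by algebra
  thus ?thesis unfolding A_def B_def C_def .
qed

lemma par_components:
  assumes "norm z < 1"
  shows "thsum (comp5 1 (par c)) z * thsum (comp5 4 (par c)) z = thsum (par c) (z ^ 5) ^ 2 - thsum (par c) (z ^ 25) ^ 2"
proof -
  define A B C D where "A = thsum (comp5 1 (par c)) z" and "B = thsum (comp5 4 (par c)) z"
    and "C = thsum (par c) (z ^ 25)" and "D = thsum (par c) (z ^ 5)"
  have "A * B + B * A = 2 * D ^ 2 - 2 * (C * C)"
    using comp5_product_sum[OF unit_bounded_par unit_bounded_par par_uminus assms zero_less_one, of c c]
    unfolding A_def B_def C_def D_def pair_sum_par_par[OF assms] thsum_par_0 power_one_right .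
  hence "A * B = D ^ 2 - C ^ 2" by algebra
  thus ?thesis unfolding A_def B_def C_def D_def .
qed

text \<open>This bilinear relation ties the eta components to the theta components; through it the
  single function r governs the dissection of eta and of both theta functions.\<close>

lemma mixed_components:
  assumes "norm z < 1"
  shows "thsum (comp5 1 chi) z * thsum (comp5 4 (par c)) (z ^ 6) + thsum (comp5 4 chi) z * thsum (comp5 1 (par c)) (z ^ 6) =
         2 * thsum chi (z ^ 25) * thsum (par c) (z ^ 150)"
proof -
  have "(z ^ 6) ^ 25 = z ^ 150" by (simp flip: power_mult)
  thus ?thesis
    using comp5_product_sum[OF unit_bounded_chi unit_bounded_par par_uminus assms, of 6 c]
    unfolding pair_sum_chi_par thsum_par_0 thsum_chi_0 by simp
qed

section \<open>Product formulas for the theta sums\<close>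

lemma thsum_two_classes:
  fixes a s :: int
  assumes "a > 0" "\<not> a dvd 2 * s" and even: "\<And>x. f (-x) = f x"
    and supp: "\<And>x. f x \<noteq> 0 \<Longrightarrow> a dvd x - s \<or> a dvd x + s"
    and f: "unit_bounded f" and z: "norm z < 1"
  shows "thsum f z = 2 * (\<Sum>\<^sub>\<infinity>m. f (a * m + s) * z ^ sqe (a * m + s))"
proof -
  define A where "A = range (\<lambda>m. a * m + s)"
  define B where "B = range (\<lambda>m. - (a * m + s))"
  let ?h = "\<lambda>x. f x * z ^ sqe x"
  have sm: "?h summable_on X" for X
    by (intro gsum_summable f lin_exp_sqe z)
  have disj: "A \<inter> B = {}"
  proof -
    have False if "a * m + s = - (a * n + s)" for m n
    proof -
      have "2 * s = a * (- m - n)" using that by (simp add: algebra_simps)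
      thus False using assms(2) by simp
    qed
    thus ?thesis by (auto simp: A_def B_def)
  qed
  have "thsum f z = infsum ?h (A \<union> B)"
    unfolding gsum_def
  proof (rule infsum_cong_neutral)
    fix x assume "x \<in> UNIV - (A \<union> B)"
    hence n: "x \<notin> A" "x \<notin> B" by auto
    have "\<not> a dvd x - s"
      using n(1) unfolding A_def by (auto simp: dvd_def algebra_simps)
    moreover have "\<not> a dvd x + s"
    proof
      assume "a dvd x + s"
      then obtain k where "x + s = a * k" by (auto simp: dvd_def)
      hence "x = - (a * (- k) + s)" by simp
      thus False using n(2) unfolding B_def by blast
    qed
    ultimately show "?h x = 0" using supp[of x] by auto
  qed auto
  also have "\<dots> = infsum ?h A + infsum ?h B"
    by (intro infsum_Un_disjoint sm disj)
  also have "infsum ?h A = (\<Sum>\<^sub>\<infinity>m. f (a * m + s) * z ^ sqe (a * m + s))"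
    unfolding A_def using assms(1) by (subst infsum_reindex) (auto simp: inj_on_def o_def)
  also have "infsum ?h B = (\<Sum>\<^sub>\<infinity>m. f (- (a * m + s)) * z ^ sqe (- (a * m + s)))"
    unfolding B_def using assms(1) by (subst infsum_reindex) (auto simp: inj_on_def o_def)
  also have "\<dots> = (\<Sum>\<^sub>\<infinity>m. f (a * m + s) * z ^ sqe (a * m + s))"
    by (simp only: even power2_minus)
  finally show ?thesis by simp
qed

text \<open>Expanding (a m + s)^2 gives the triple product with base p = z^(a^2) and variable Z =
  \<delta> z^(2 a s). As \<delta> is its own inverse, both side products carry the same \<delta>; 2
  s <= a keeps the exponent a^2 - 2 a s natural.\<close>

lemma arithmetic_progression_theta:
  fixes a s :: nat and \<delta> z :: complex
  assumes s: "2 * s \<le> a" "a > 0" and z: "z \<noteq> 0" "norm z < 1" and \<delta>: "\<delta> * \<delta> = 1"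
  shows "(\<Sum>\<^sub>\<infinity>m::int. \<delta> powi m * z ^ sqe (int a * m + int s)) =
    z ^ (s\<^sup>2) * gprod (-1) (2 * a\<^sup>2) (2 * a\<^sup>2) z * gprod \<delta> (a\<^sup>2 + 2 * a * s) (2 * a\<^sup>2) z *
      gprod \<delta> (a\<^sup>2 - 2 * a * s) (2 * a\<^sup>2) z"
proof -
  define p where "p = z ^ (a\<^sup>2)"
  define Z where "Z = \<delta> * z ^ (2 * a * s)"
  have p: "p \<noteq> 0" "norm p < 1"
    using z s by (auto simp: p_def norm_power power_less_one_iff)
  have \<delta>0: "\<delta> \<noteq> 0" using \<delta> by auto
  have \<delta>i: "1 / \<delta> = \<delta>" using \<delta> \<delta>0 by (metis nonzero_mult_div_cancel_left)
  have Z: "Z \<noteq> 0" using z \<delta>0 by (simp add: Z_def)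
  have tm: "\<delta> powi m * z ^ sqe (int a * m + int s) = z ^ (s\<^sup>2) * (p ^ sqe m * Z powi m)" for m
  proof -
    have "z ^ sqe (int a * m + int s) = z powi ((int a * m + int s)\<^sup>2)"
      by (rule power_int_nonneg_exp [symmetric]) simp
    also have "\<dots> = z powi (int (s\<^sup>2) + (int (a\<^sup>2) * m\<^sup>2 + int (2 * a * s) * m))"
      by (simp add: power2_eq_square algebra_simps)
    also have "\<dots> = z ^ (s\<^sup>2) * (p powi (m\<^sup>2) * (z ^ (2 * a * s)) powi m)"
      unfolding p_def by (simp only: power_int_add[OF disjI1[OF z(1)]] power_int_mult power_int_of_nat)
    also have "p powi (m\<^sup>2) = p ^ sqe m"
      by (rule power_int_nonneg_exp) simp
    finally have E: "z ^ sqe (int a * m + int s) = z ^ (s\<^sup>2) * (p ^ sqe m * (z ^ (2 * a * s)) powi m)" .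
    show ?thesis
      unfolding Z_def power_int_mult_distrib E by (simp only: mult_ac)
  qed
  have le: "2 * a * s \<le> a\<^sup>2"
    using s(1) by (simp add: power2_eq_square mult.assoc [symmetric] mult.commute[of 2 a]) 
  have "(\<Prod>m. 1 - p ^ (2 * m + 2)) = gprod (-1) (2 * a\<^sup>2) (2 * a\<^sup>2) z"
  proof -
    have "p ^ (2 * m + 2) = z ^ (2 * a\<^sup>2 * m + 2 * a\<^sup>2)" for m
      unfolding p_def power_mult [symmetric] by (simp add: algebra_simps)
    thus ?thesis by (simp add: gprod_def)
  qed
  moreover have "(\<Prod>m. 1 + Z * p ^ (2 * m + 1)) = gprod \<delta> (a\<^sup>2 + 2 * a * s) (2 * a\<^sup>2) z"
  proof -
    have "Z * p ^ (2 * m + 1) = \<delta> * z ^ (2 * a\<^sup>2 * m + (a\<^sup>2 + 2 * a * s))" for m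
      unfolding p_def Z_def power_mult [symmetric] mult.assoc power_add [symmetric] by (simp add: algebra_simps)
    thus ?thesis by (simp add: gprod_def)
  qed
  moreover have "(\<Prod>m. 1 + p ^ (2 * m + 1) / Z) = gprod \<delta> (a\<^sup>2 - 2 * a * s) (2 * a\<^sup>2) z"
  proof -
    have "p ^ (2 * m + 1) / Z = \<delta> * z ^ (2 * a\<^sup>2 * m + (a\<^sup>2 - 2 * a * s))" for m
    proof -
      have "2 * a\<^sup>2 * m + (a\<^sup>2 - 2 * a * s) + 2 * a * s = a\<^sup>2 * (2 * m + 1)"
        using le by (simp add: algebra_simps)
      hence "p ^ (2 * m + 1) = z ^ (2 * a\<^sup>2 * m + (a\<^sup>2 - 2 * a * s)) * z ^ (2 * a * s)"
        unfolding p_def power_mult [symmetric] power_add [symmetric] by (simp only:)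
      hence "p ^ (2 * m + 1) / Z = (1 / \<delta>) * z ^ (2 * a\<^sup>2 * m + (a\<^sup>2 - 2 * a * s))"
        using z by (simp add: Z_def)
      thus ?thesis by (simp only: \<delta>i)
    qed
    thus ?thesis by (simp only: gprod_def)
  qed
  moreover have "((\<lambda>m. z ^ (s\<^sup>2) * (p ^ sqe m * Z powi m)) has_sum
      z ^ (s\<^sup>2) * ((\<Prod>m. 1 - p ^ (2 * m + 2)) * (\<Prod>m. 1 + Z * p ^ (2 * m + 1)) *
            (\<Prod>m. 1 + p ^ (2 * m + 1) / Z))) UNIV"
    by (intro has_sum_cmult_right jacobi_triple_product p Z)
  ultimately show ?thesis
    unfolding tm by (simp add: infsumI mult.assoc)
qed

text \<open>Euler's pentagonal number theorem: with q = z^24 the three products are the factors of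
  (q; q) in the residue classes 0, 2, 1 mod 3.\<close>

lemma thsum_chi_product:
  assumes z: "z \<noteq> 0" "norm z < 1"
  shows "thsum chi z = 2 * z * eul 1 (z ^ 24)"
proof -
  have chi6: "chi (6 * m + 1) = (-1) powi m" for m
  proof (cases "even m")
    case True
    then obtain k where "m = 2 * k" by (elim evenE)
    hence "(6 * m + 1) mod 12 = 1" by simp
    thus ?thesis using True by (simp add: chi12_def power_int_minus_left)
  next
    case False
    then obtain k where "m = 2 * k + 1" by (elim oddE)
    hence "(6 * m + 1) mod 12 = 7" by presburger
    thus ?thesis using False by (simp add: chi12_def power_int_minus_left)
  qed
  have supp: "6 dvd x - 1 \<or> 6 dvd x + 1" if "chi x \<noteq> 0" for x
  proof -
    have "x mod 12 = 1 \<or> x mod 12 = 11 \<or> x mod 12 = 5 \<or> x mod 12 = 7"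
      using that by (auto simp: chi12_def split: if_splits)
    thus ?thesis by presburger
  qed
  have "thsum chi z = 2 * (\<Sum>\<^sub>\<infinity>m. chi (6 * m + 1) * z ^ sqe (6 * m + 1))"
    by (rule thsum_two_classes) (use supp unit_bounded_chi z in auto)
  also have "\<dots> = 2 * (\<Sum>\<^sub>\<infinity>m. (-1) powi m * z ^ sqe (int 6 * m + int 1))"
    unfolding chi6 by simp
  also have "\<dots> = 2 * (z * gprod (-1) 72 72 z * gprod (-1) 48 72 z * gprod (-1) 24 72 z)"
    by (subst arithmetic_progression_theta) (use z in simp_all)
  also have "gprod (-1) 72 72 z = gprod (-1) 3 3 (z ^ 24)"
    using gprod_scale[of "-1" 24 3 3 z] by simp
  also have "gprod (-1) 48 72 z = gprod (-1) 2 3 (z ^ 24)"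
    using gprod_scale[of "-1" 24 2 3 z] by simp
  also have "gprod (-1) 24 72 z = gprod (-1) 1 3 (z ^ 24)"
    using gprod_scale[of "-1" 24 1 3 z] by simp
  also have "2 * (z * gprod (-1) 3 3 (z ^ 24) * gprod (-1) 2 3 (z ^ 24) * gprod (-1) 1 3 (z ^ 24)) =
      2 * z * gprod (-1) 1 1 (z ^ 24)"
  proof -
    have "norm (z ^ 24) < 1" using z by (simp add: norm_power power_less_one_iff)
    from gprod_dissect[OF this, of 1 3 "-1" 1] show ?thesis
      by (simp add: numeral_3_eq_3 numeral_2_eq_2)
  qed
  finally show ?thesis by (simp add: eul_eq)
qed

lemma thsum_par_progression:
  assumes z: "z \<noteq> 0" "norm z < 1" and c: "c < 2"
  shows "thsum (par c) z = z ^ (c\<^sup>2) * eul 2 (z ^ 4) * gprod 1 (1 + c) 2 (z ^ 4) * gprod 1 (1 - c) 2 (z ^ 4)"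
proof -
  have "thsum (par c) z = (\<Sum>\<^sub>\<infinity>x\<in>range (\<lambda>m. 2 * m + int c). z ^ sqe x)"
    unfolding gsum_def
  proof (rule infsum_cong_neutral)
    fix x :: int assume x: "x \<in> UNIV - range (\<lambda>m. 2 * m + int c)"
    have "x mod 2 \<noteq> int c"
    proof
      assume "x mod 2 = int c"
      hence "x = 2 * (x div 2) + int c" by presburger
      thus False using x by auto
    qed
    thus "par c x * z ^ sqe x = 0" by (simp add: par_def)
  next
    have p: "par c (2 * m + int c) = 1" for m
    proof -
      have "(2 * m + int c) mod 2 = int c" using c by presburger
      thus ?thesis by (simp add: par_def)
    qed
    show "par c x * z ^ sqe x = z ^ sqe x" if "x \<in> UNIV \<inter> range (\<lambda>m. 2 * m + int c)" for x
    proof -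
      obtain m where "x = 2 * m + int c" using \<open>x \<in> _\<close> by blast
      thus ?thesis by (simp only: p mult_1)
    qed
  qed auto
  also have "\<dots> = (\<Sum>\<^sub>\<infinity>m. 1 powi m * z ^ sqe (int 2 * m + int c))"
    by (subst infsum_reindex) (auto simp: inj_on_def o_def)
  also have "\<dots> = z ^ (c\<^sup>2) * gprod (-1) 8 8 z * gprod 1 (4 + 4 * c) 8 z * gprod 1 (4 - 4 * c) 8 z"
    by (subst arithmetic_progression_theta) (use z c in simp_all)
  also have "gprod (-1) 8 8 z = eul 2 (z ^ 4)"
    using gprod_scale[of "-1" 4 2 2 z] by (simp add: eul_eq)
  also have "gprod 1 (4 + 4 * c) 8 z = gprod 1 (1 + c) 2 (z ^ 4)"
    using gprod_scale[of 1 4 "1 + c" 2 z] by simp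
  also have "gprod 1 (4 - 4 * c) 8 z = gprod 1 (1 - c) 2 (z ^ 4)"
    using gprod_scale[of 1 4 "1 - c" 2 z] c by (simp add: diff_mult_distrib2)
  finally show ?thesis .
qed

lemma thsum_par_0_product:
  assumes z: "z \<noteq> 0" "norm z < 1"
  shows "thsum (par 0) z = eul 2 (z ^ 4) ^ 5 / (eul 1 (z ^ 4) ^ 2 * eul 4 (z ^ 4) ^ 2)"
proof -
  have q: "norm (z ^ 4) < 1" using z by (simp add: norm_power power_less_one_iff)
  have alg: "a * (a ^ 2 / (b * d)) * (a ^ 2 / (b * d)) = a ^ 5 / (b ^ 2 * d ^ 2)" for a b d :: complex
    by (simp add: eval_nat_numeral mult_ac)
  have "gprod 1 1 2 (z ^ 4) = eul 2 (z ^ 4) ^ 2 / (eul 1 (z ^ 4) * eul 4 (z ^ 4))"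
    using gprod_plus_odd[OF q, of 1] by simp
  thus ?thesis
    using thsum_par_progression[OF z, of 0] alg by simp
qed

lemma thsum_par_1_product:
  assumes z: "z \<noteq> 0" "norm z < 1"
  shows "thsum (par 1) z = 2 * z * (eul 4 (z ^ 4) ^ 2 / eul 2 (z ^ 4))"
proof -
  have q: "norm (z ^ 4) < 1" using z by (simp add: norm_power power_less_one_iff)
  have nz: "eul 2 (z ^ 4) \<noteq> 0" using q by (intro eul_nonzero) auto
  \<comment> \<open>The factor m = 0 is 1 + 1; this is the source of the 2 in
    \<open>theta 1\<close>.\<close>
  have "gprod 1 0 2 (z ^ 4) = 2 * gprod 1 2 2 (z ^ 4)"
    using gprod_shift_head[OF q, of 2 1 0] unfolding add_0 by simp
  moreover have "gprod 1 2 2 (z ^ 4) = eul 4 (z ^ 4) / eul 2 (z ^ 4)"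
    using gprod_plus_same[OF q, of 2] by simp
  ultimately show ?thesis
    using thsum_par_progression[OF z, of 1] nz
    by (simp add: power2_eq_square numeral_2_eq_2 [symmetric])
qed

text \<open>For each listed pair (j, c) the integers of parity c with square j mod 5 are exactly the
  classes s and -s mod 10.\<close>

lemma comp5_par_class:
  assumes w: "w \<noteq> 0" "norm w < 1" and s: "(j, c, s) \<in> {(4, 0, 2), (1, 0, 4), (1, 1, 1), (4, 1, 3)}"
  shows "thsum (comp5 j (par c)) w =
      2 * w ^ (s\<^sup>2) * eul 10 (w ^ 20) * gprod 1 (5 + s) 10 (w ^ 20) * gprod 1 (5 - s) 10 (w ^ 20)"
proof -
  have s5: "s < 5" "s > 0" using s by auto
  have on: "comp5 j (par c) (10 * m + int s) = 1" for m
  proof -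
    have "(10 * m + int s)\<^sup>2 mod 5 = (int s)\<^sup>2 mod 5"
      by (simp add: power2_eq_square algebra_simps mod_simps) (simp add: mod_eq_dvd_iff)
    moreover have "(10 * m + int s) mod 2 = int s mod 2" by presburger
    ultimately show ?thesis using s by (auto simp: comp5_def par_def)
  qed
  have supp: "10 dvd x - int s \<or> 10 dvd x + int s" if "comp5 j (par c) x \<noteq> 0" for x
  proof -
    have x: "x\<^sup>2 mod 5 = j" "x mod 2 = int c"
      using that by (auto simp: comp5_def par_def split: if_splits)
    have "x mod 5 = 0 \<or> x mod 5 = 1 \<or> x mod 5 = 2 \<or> x mod 5 = 3 \<or> x mod 5 = 4" by presburger
    moreover have "(x mod 5)\<^sup>2 mod 5 = j" using x(1) by (simp add: power_mod)
    ultimately have "(j = 0 \<and> x mod 5 = 0) \<or> (j = 1 \<and> (x mod 5 = 1 \<or> x mod 5 = 4)) \<or> (j = 4 \<and> (x mod 5 = 2 \<or> x mod 5 = 3))"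
      by auto
    moreover have "(j = 4 \<and> c = 0 \<and> s = 2) \<or> (j = 1 \<and> c = 0 \<and> s = 4) \<or> (j = 1 \<and> c = 1 \<and> s = 1) \<or> (j = 4 \<and> c = 1 \<and> s = 3)"
      using s by auto
    ultimately show ?thesis using x(2) by (elim disjE conjE; simp; presburger)
  qed
  have "thsum (comp5 j (par c)) w = 2 * (\<Sum>\<^sub>\<infinity>m. comp5 j (par c) (10 * m + int s) * w ^ sqe (10 * m + int s))"
  proof (rule thsum_two_classes)
    show "\<not> 10 dvd 2 * int s" using s by auto
    show "comp5 j (par c) (- x) = comp5 j (par c) x" for x by (simp add: comp5_def)
  qed (use supp unit_bounded_comp5[OF unit_bounded_par] w in auto)
  also have "\<dots> = 2 * (\<Sum>\<^sub>\<infinity>m. 1 powi m * w ^ sqe (int 10 * m + int s))"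
    unfolding on by simp
  also have "\<dots> = 2 * (w ^ (s\<^sup>2) * gprod (-1) 200 200 w * gprod 1 (100 + 20 * s) 200 w * gprod 1 (100 - 20 * s) 200 w)"
    by (subst arithmetic_progression_theta) (use w s5 in simp_all)
  also have "gprod (-1) 200 200 w = eul 10 (w ^ 20)"
    using gprod_scale[of "-1" 20 10 10 w] by (simp add: eul_eq)
  also have "gprod 1 (100 + 20 * s) 200 w = gprod 1 (5 + s) 10 (w ^ 20)"
    using gprod_scale[of 1 20 "5 + s" 10 w] by simp
  also have "gprod 1 (100 - 20 * s) 200 w = gprod 1 (5 - s) 10 (w ^ 20)"
    using gprod_scale[of 1 20 "5 - s" 10 w] by (simp add: diff_mult_distrib2)
  finally show ?thesis by (simp add: mult.assoc)
qed

text \<open>The residues 1, 3, 7, 9 mod 10 are all odd ones except 5, so the product is a quotient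
  of two products over odd multiples.\<close>

lemma gprod_residues_odd:
  assumes q: "norm q < 1"
  shows "gprod 1 7 10 q * gprod 1 3 10 q * gprod 1 9 10 q * gprod 1 1 10 q =
    eul 2 q ^ 2 / (eul 1 q * eul 4 q) * (eul 5 q * eul 20 q / eul 10 q ^ 2)"
proof -
  have "gprod 1 1 2 q = gprod 1 1 10 q * gprod 1 3 10 q * gprod 1 5 10 q * gprod 1 7 10 q * gprod 1 9 10 q"
    using gprod_dissect[OF q, of 2 5 1 1] by (simp add: eval_nat_numeral)
  moreover have "gprod 1 5 10 q = eul 10 q ^ 2 / (eul 5 q * eul 20 q)"
    using gprod_plus_odd[OF q, of 5] by simp
  moreover have "gprod 1 1 2 q = eul 2 q ^ 2 / (eul 1 q * eul 4 q)"
    using gprod_plus_odd[OF q, of 1] by simp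
  ultimately have "(gprod 1 7 10 q * gprod 1 3 10 q * gprod 1 9 10 q * gprod 1 1 10 q) * (eul 10 q ^ 2 / (eul 5 q * eul 20 q)) =
      eul 2 q ^ 2 / (eul 1 q * eul 4 q)"
    by (simp only: mult_ac)
  moreover have "eul n q \<noteq> 0" if "n > 0" for n
    using eul_nonzero[OF q that] .
  ultimately show ?thesis
    by (simp add: field_simps)
qed

lemma gprod_residues_even:
  assumes q: "norm q < 1"
  shows "gprod 1 6 10 q * gprod 1 4 10 q * gprod 1 8 10 q * gprod 1 2 10 q =
    eul 4 q / eul 2 q * (eul 10 q / eul 20 q)"
proof -
  have "gprod 1 2 2 q = gprod 1 2 10 q * gprod 1 4 10 q * gprod 1 6 10 q * gprod 1 8 10 q * gprod 1 10 10 q"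
    using gprod_dissect[OF q, of 2 5 1 2] by (simp add: eval_nat_numeral)
  moreover have "gprod 1 10 10 q = eul 20 q / eul 10 q"
    using gprod_plus_same[OF q, of 10] by simp
  moreover have "gprod 1 2 2 q = eul 4 q / eul 2 q"
    using gprod_plus_same[OF q, of 2] by simp
  ultimately have "(gprod 1 6 10 q * gprod 1 4 10 q * gprod 1 8 10 q * gprod 1 2 10 q) * (eul 20 q / eul 10 q) =
      eul 4 q / eul 2 q"
    by (simp only: mult_ac)
  moreover have "eul n q \<noteq> 0" if "n > 0" for n
    using eul_nonzero[OF q that] .
  ultimately show ?thesis
    by (simp add: field_simps)
qed

section \<open>Eta and theta functions on the upper half-plane\<close>

text \<open>The same function as \<open>nome\<close>, used at fractional multiples of \<tau> to have
  compatible fractional powers of q.\<close>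

definition ee :: "complex \<Rightarrow> complex" where
  "ee s = exp (2 * of_real pi * \<i> * s)"

lemma nome_eq_ee: "nome = ee"
  by (simp add: fun_eq_iff nome_def ee_def)

lemma ee_add: "ee (a + b) = ee a * ee b"
  by (simp add: ee_def exp_add distrib_left)

lemma ee_power: "ee s ^ n = ee (of_nat n * s)"
  by (simp add: ee_def mult_ac flip: exp_of_nat_mult)

lemma ee_nonzero [simp]: "ee s \<noteq> 0"
  by (simp add: ee_def)

lemma norm_ee: "norm (ee s) = exp (- 2 * pi * Im s)"
  by (simp add: ee_def)

lemma norm_ee_less_1: "norm (ee s) < 1 \<longleftrightarrow> Im s > 0"
  by (simp add: norm_ee zero_less_mult_iff)

lemma ee_of_nat [simp]: "ee (of_nat n) = 1"
  using exp_integer_2pi[of "of_nat n"] by (simp add: ee_def mult_ac)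

lemma ee_holomorphic: "ee holomorphic_on A"
  unfolding ee_def [abs_def] by (intro holomorphic_intros)

lemma uhp_iff: "\<tau> \<in> uhp \<longleftrightarrow> Im \<tau> > 0"
  by (simp add: uhp_def)

lemma uhp_mult: "\<tau> \<in> uhp \<Longrightarrow> k > 0 \<Longrightarrow> of_nat k * \<tau> \<in> uhp"
  by (simp add: uhp_iff)

lemma uhp_div: "\<tau> \<in> uhp \<Longrightarrow> k > 0 \<Longrightarrow> \<tau> / of_nat k \<in> uhp"
  by (simp add: uhp_iff Im_divide_of_nat)

lemma uhp_numeral [simp]:
  "\<tau> \<in> uhp \<Longrightarrow> numeral k * \<tau> \<in> uhp" "\<tau> \<in> uhp \<Longrightarrow> \<tau> / numeral k \<in> uhp"
  "\<tau> \<in> uhp \<Longrightarrow> \<tau> + of_nat n \<in> uhp"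
  by (simp_all add: uhp_iff)

lemma open_uhp: "open uhp"
  by (simp add: uhp_def open_halfspace_Im_gt)

lemma connected_uhp: "connected uhp"
  by (simp add: uhp_def convex_connected convex_halfspace_Im_gt)

text \<open>Defined by its theta sum, so that the dissection mod 5 applies directly; the usual
  product is \<open>eta_product\<close>.\<close>

definition eta :: "complex \<Rightarrow> complex" where
  "eta \<tau> = thsum chi (ee (\<tau> / 24)) / 2"

text \<open>\<open>theta 0\<close> is Ramanujan's \<open>\<phi>(q)\<close> and \<open>theta 1\<close> is \<open>2 q^(1/4) \<psi>(q^2)\<close>; they belong to \<open>\<beta> = 1\<close> and
  \<open>\<beta> = 0\<close>, so \<open>\<beta>\<close> always enters as the index \<open>1 - \<beta>\<close>.\<close>

definition theta :: "nat \<Rightarrow> complex \<Rightarrow> complex" where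
  "theta c \<tau> = thsum (par c) (ee (\<tau> / 4))"

lemma ee_disc [simp]: "\<tau> \<in> uhp \<Longrightarrow> norm (ee \<tau>) < 1"
  by (simp add: norm_ee_less_1 uhp_iff)

lemma eta_product: "\<tau> \<in> uhp \<Longrightarrow> eta \<tau> = ee (\<tau> / 24) * eul 1 (ee \<tau>)"
  by (simp add: eta_def thsum_chi_product ee_power)

lemma theta_0_product:
  "\<tau> \<in> uhp \<Longrightarrow> theta 0 \<tau> = eul 2 (ee \<tau>) ^ 5 / (eul 1 (ee \<tau>) ^ 2 * eul 4 (ee \<tau>) ^ 2)"
  by (simp add: theta_def thsum_par_0_product ee_power del: One_nat_def)

lemma theta_1_product:
  "\<tau> \<in> uhp \<Longrightarrow> theta 1 \<tau> = 2 * ee (\<tau> / 4) * (eul 4 (ee \<tau>) ^ 2 / eul 2 (ee \<tau>))"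
  by (simp add: theta_def thsum_par_1_product ee_power del: One_nat_def)

lemma eul_ee_nonzero [simp]: "\<tau> \<in> uhp \<Longrightarrow> n > 0 \<Longrightarrow> eul n (ee \<tau>) \<noteq> 0"
  by (intro eul_nonzero) auto

lemma eta_nonzero: "\<tau> \<in> uhp \<Longrightarrow> eta \<tau> \<noteq> 0"
  by (simp add: eta_product)

lemma theta_nonzero: "\<tau> \<in> uhp \<Longrightarrow> c < 2 \<Longrightarrow> theta c \<tau> \<noteq> 0"
  using theta_0_product[of \<tau>] theta_1_product[of \<tau>] less_2_cases[of c] by auto

text \<open>Components of eta (\<tau> / 5) by the exponent of q^(1/120) mod 5. The component for 0
  is -eta (5 \<tau>), see \<open>eta_fifth\<close>.\<close>

definition eta_comp :: "int \<Rightarrow> complex \<Rightarrow> complex" where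
  "eta_comp j \<tau> = thsum (comp5 j chi) (ee (\<tau> / 120)) / 2"

definition theta_comp :: "int \<Rightarrow> nat \<Rightarrow> complex \<Rightarrow> complex" where
  "theta_comp j c \<tau> = thsum (comp5 j (par c)) (ee (\<tau> / 20))"

lemma eta_fifth:
  assumes "\<tau> \<in> uhp"
  shows "eta (\<tau> / 5) = eta_comp 1 \<tau> - eta (5 * \<tau>) + eta_comp 4 \<tau>"
  using thsum_split[OF unit_bounded_chi, of "ee (\<tau> / 120)"] assms
  by (simp add: eta_def eta_comp_def thsum_chi_0 ee_power add_divide_distrib)

lemma theta_fifth:
  assumes "\<tau> \<in> uhp"
  shows "theta c (\<tau> / 5) = theta c (5 * \<tau>) + theta_comp 1 c \<tau> + theta_comp 4 c \<tau>"
  using thsum_split[OF unit_bounded_par, of "ee (\<tau> / 20)" c] assms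
  by (simp add: theta_def theta_comp_def thsum_par_0 ee_power)

lemma eta_comp_product:
  assumes "\<tau> \<in> uhp"
  shows "eta_comp 1 \<tau> * eta_comp 4 \<tau> = - (eta (5 * \<tau>) ^ 2)"
  using chi_components[of "ee (\<tau> / 120)"] assms
  by (simp add: eta_def eta_comp_def ee_power power_divide)

lemma theta_comp_product:
  assumes "\<tau> \<in> uhp"
  shows "theta_comp 1 c \<tau> * theta_comp 4 c \<tau> = theta c \<tau> ^ 2 - theta c (5 * \<tau>) ^ 2"
  using par_components[of "ee (\<tau> / 20)" c] assms
  by (simp add: theta_def theta_comp_def ee_power)

lemma eta_theta_comp:
  assumes "\<tau> \<in> uhp"
  shows "eta_comp 1 \<tau> * theta_comp 4 c \<tau> + eta_comp 4 \<tau> * theta_comp 1 c \<tau> = 2 * eta (5 * \<tau>) * theta c (5 * \<tau>)"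
  using mixed_components[of "ee (\<tau> / 120)" c] assms
  by (simp add: theta_def theta_comp_def eta_comp_def eta_def ee_power field_simps)

text \<open>The Rogers--Ramanujan continued fraction.\<close>

definition rr :: "complex \<Rightarrow> complex" where
  "rr \<tau> = eta (5 * \<tau>) / eta_comp 1 \<tau>"

lemma eta_comp_nonzero:
  assumes "\<tau> \<in> uhp"
  shows "eta_comp 1 \<tau> \<noteq> 0"
  using eta_comp_product[OF assms] eta_nonzero[of "5 * \<tau>"] assms by auto

lemma rr_nonzero: "\<tau> \<in> uhp \<Longrightarrow> rr \<tau> \<noteq> 0"
  by (simp add: rr_def eta_nonzero eta_comp_nonzero)

lemma eta_comp_1_eq: "\<tau> \<in> uhp \<Longrightarrow> eta_comp 1 \<tau> = eta (5 * \<tau>) / rr \<tau>"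
  by (simp add: rr_def eta_nonzero)

lemma eta_comp_4_eq: "\<tau> \<in> uhp \<Longrightarrow> eta_comp 4 \<tau> = - rr \<tau> * eta (5 * \<tau>)"
  using eta_comp_product[of \<tau>] eta_comp_nonzero[of \<tau>]
  by (simp add: rr_def field_simps power2_eq_square)

lemma eta_fifth_rr: 
  assumes "\<tau> \<in> uhp"
  shows "eta (\<tau> / 5) = eta (5 * \<tau>) * (1 / rr \<tau> - 1 - rr \<tau>)"
  using eta_fifth[OF assms] eta_comp_1_eq[OF assms] eta_comp_4_eq[OF assms] by (simp add: algebra_simps)

text \<open>Behaviour along the imaginary axis towards the cusp at infinity, used to fix signs of
  square roots.\<close>

definition cusp_lim :: "(complex \<Rightarrow> complex) \<Rightarrow> complex \<Rightarrow> bool" where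
  "cusp_lim f L \<longleftrightarrow> ((\<lambda>y::real. f (\<i> * of_real y)) \<longlongrightarrow> L) at_top"

lemma ee_cusp: "c > 0 \<Longrightarrow> filterlim (\<lambda>y::real. ee (\<i> * of_real y * of_real c)) (nhds 0) at_top"
proof -
  assume c: "c > 0"
  have "((\<lambda>y::real. exp (- 2 * pi * (y * c))) \<longlongrightarrow> 0) at_top"
    using c by real_asymp
  hence "((\<lambda>y::real. norm (ee (\<i> * of_real y * of_real c))) \<longlongrightarrow> 0) at_top"
    by (simp add: norm_ee)
  thus ?thesis by (rule tendsto_norm_zero_cancel)
qed

lemma cusp_lim_ee: "c > 0 \<Longrightarrow> cusp_lim (\<lambda>\<tau>. ee (\<tau> * of_real c)) 0"
  unfolding cusp_lim_def by (rule ee_cusp)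

lemma cusp_lim_continuous:
  assumes "continuous_on (ball 0 1) g" "c > 0" "g 0 = L"
  shows "cusp_lim (\<lambda>\<tau>. g (ee (\<tau> * of_real c))) L"
proof -
  have "isCont g 0"
    using assms(1) by (simp add: continuous_on_eq_continuous_at)
  thus ?thesis
    unfolding cusp_lim_def assms(3)[symmetric]
    by (rule isCont_tendsto_compose[OF _ ee_cusp[OF assms(2)]])
qed

lemma cusp_lim_mult: "cusp_lim f a \<Longrightarrow> cusp_lim g b \<Longrightarrow> cusp_lim (\<lambda>\<tau>. f \<tau> * g \<tau>) (a * b)"
  and cusp_lim_add: "cusp_lim f a \<Longrightarrow> cusp_lim g b \<Longrightarrow> cusp_lim (\<lambda>\<tau>. f \<tau> + g \<tau>) (a + b)"
  and cusp_lim_diff: "cusp_lim f a \<Longrightarrow> cusp_lim g b \<Longrightarrow> cusp_lim (\<lambda>\<tau>. f \<tau> - g \<tau>) (a - b)"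
  and cusp_lim_divide: "cusp_lim f a \<Longrightarrow> cusp_lim g b \<Longrightarrow> b \<noteq> 0 \<Longrightarrow> cusp_lim (\<lambda>\<tau>. f \<tau> / g \<tau>) (a / b)"
  and cusp_lim_power: "cusp_lim f a \<Longrightarrow> cusp_lim (\<lambda>\<tau>. f \<tau> ^ n) (a ^ n)"
  and cusp_lim_const: "cusp_lim (\<lambda>_. a) a"
  unfolding cusp_lim_def by (auto intro!: tendsto_intros)

lemma cusp_lim_cong:
  assumes "\<And>\<tau>. \<tau> \<in> uhp \<Longrightarrow> f \<tau> = g \<tau>"
  shows "cusp_lim f L \<longleftrightarrow> cusp_lim g L"
  unfolding cusp_lim_def
  by (intro filterlim_cong refl eventually_mono[OF eventually_gt_at_top[of 0]] assms)
     (simp add: uhp_iff)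

lemma cusp_lim_eul: "n > 0 \<Longrightarrow> c > 0 \<Longrightarrow> cusp_lim (\<lambda>\<tau>. eul n (ee (\<tau> * of_real c))) 1"
  by (intro cusp_lim_continuous holomorphic_on_imp_continuous_on eul_holomorphic) auto

lemma continuous_ee: "continuous_on A (\<lambda>\<tau>. ee (\<tau> * c))"
  unfolding ee_def by (intro continuous_intros)

lemma continuous_thsum_ee:
  assumes "unit_bounded f" "c > 0"
  shows "continuous_on uhp (\<lambda>\<tau>. thsum f (ee (\<tau> / of_nat c)))"
proof -
  have "continuous_on uhp (\<lambda>\<tau>. ee (\<tau> * (1 / of_nat c)))" by (rule continuous_ee)
  moreover have "(\<lambda>\<tau>. ee (\<tau> * (1 / of_nat c))) ` uhp \<subseteq> ball 0 1"
    using uhp_div[OF _ assms(2)] by auto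
  ultimately have "continuous_on uhp (thsum f \<circ> (\<lambda>\<tau>. ee (\<tau> * (1 / of_nat c))))"
    using gsum_continuous[OF assms(1) lin_exp_sqe]
    by (intro continuous_on_compose) (auto intro: continuous_on_subset)
  thus ?thesis by (simp add: o_def)
qed

lemma continuous_eta: "continuous_on uhp eta"
  using continuous_thsum_ee[OF unit_bounded_chi, of 24] unfolding eta_def [abs_def]
  by (auto intro!: continuous_intros)

lemma continuous_theta: "continuous_on uhp (theta c)"
  using continuous_thsum_ee[OF unit_bounded_par, of 4] unfolding theta_def [abs_def] by simp

lemma continuous_eta_comp: "continuous_on uhp (eta_comp j)"
  using continuous_thsum_ee[OF unit_bounded_comp5[OF unit_bounded_chi], of 120] unfolding eta_comp_def [abs_def]
  by (auto intro!: continuous_intros)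

lemma continuous_theta_comp: "continuous_on uhp (theta_comp j c)"
  using continuous_thsum_ee[OF unit_bounded_comp5[OF unit_bounded_par], of 20] unfolding theta_comp_def [abs_def] by simp

lemma continuous_scale: "continuous_on uhp f \<Longrightarrow> k > 0 \<Longrightarrow> continuous_on uhp (\<lambda>\<tau>. f (of_nat k * \<tau>))"
  by (rule continuous_on_compose2[of uhp f]) (auto intro!: continuous_intros uhp_mult)

lemma continuous_rr: "continuous_on uhp rr"
  unfolding rr_def [abs_def]
  using continuous_scale[OF continuous_eta, of 5] continuous_eta_comp eta_comp_nonzero
  by (intro continuous_on_divide) auto

lemma cusp_lim_eta_comp: "cusp_lim (\<lambda>\<tau>. eta_comp 1 \<tau> / ee (\<tau> / 120)) 1"
proof -
  define f where "f = comp5 1 chi"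
  have f0: "f x = 0" if "sqe x < 1" for x
  proof -
    have "x\<^sup>2 < 1" using that by simp
    hence "x = 0" using abs_le_sq[of x] by linarith
    thus ?thesis by (simp add: f_def comp5_def chi12_def)
  qed
  \<comment> \<open>x = 0 belongs to the set because subtraction on the naturals truncates; its
    coefficient is 0.\<close>
  have e0: "{x::int. sqe x - 1 = 0} = {-1, 0, 1}"
  proof -
    have "sqe x - 1 = 0 \<longleftrightarrow> \<bar>x\<bar> \<le> 1" for x
    proof
      assume "sqe x - 1 = 0"
      hence "x\<^sup>2 \<le> 1" by linarith
      thus "\<bar>x\<bar> \<le> 1" using abs_le_sq[of x] by linarith
    next
      assume "\<bar>x\<bar> \<le> 1"
      hence "x = -1 \<or> x = 0 \<or> x = 1" by linarith
      thus "sqe x - 1 = 0" by auto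
    qed
    hence "{x::int. sqe x - 1 = 0} = {x. \<bar>x\<bar> \<le> 1}" by (simp only:)
    also have "\<dots> = {-1, 0, 1}" by auto
    finally show ?thesis .
  qed
  hence fin: "finite {x::int. sqe x - 1 = 0}" by (simp only: finite_insert finite.emptyI)
  have "gsum f (\<lambda>x. sqe x - 1) 0 = 2"
    unfolding gsum_at_0[OF fin] e0 by (simp add: f_def comp5_def chi12_def)
  moreover have "continuous_on (ball 0 1) (gsum f (\<lambda>x. sqe x - 1))"
    unfolding f_def by (intro gsum_continuous unit_bounded_comp5 unit_bounded_chi lin_exp_sqe_diff)
  ultimately have "cusp_lim (\<lambda>\<tau>. gsum f (\<lambda>x. sqe x - 1) (ee (\<tau> * of_real (1 / 120)))) 2"
    by (intro cusp_lim_continuous) auto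
  hence "cusp_lim (\<lambda>\<tau>. gsum f (\<lambda>x. sqe x - 1) (ee (\<tau> * of_real (1 / 120))) / 2) (2 / 2)"
    by (intro cusp_lim_divide cusp_lim_const) auto
  moreover have "eta_comp 1 \<tau> / ee (\<tau> / 120) = gsum f (\<lambda>x. sqe x - 1) (ee (\<tau> * of_real (1 / 120))) / 2" for \<tau>
    using thsum_factor[of 1 f "ee (\<tau> / 120)"] f0 by (simp add: eta_comp_def f_def)
  ultimately show ?thesis by (simp only:) simp
qed

lemma cusp_lim_eta: "k > 0 \<Longrightarrow> cusp_lim (\<lambda>\<tau>. eta (of_nat k * \<tau>) / ee (of_nat k * \<tau> / 24)) 1"
proof -
  assume k: "k > 0"
  have "cusp_lim (\<lambda>\<tau>. eul 1 (ee (\<tau> * of_real (real k)))) 1"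
    by (rule cusp_lim_eul) (use k in auto)
  thus ?thesis
    by (subst cusp_lim_cong) (use k uhp_mult in \<open>auto simp: eta_product mult.commute\<close>)
qed

text \<open>The leading exponents are 5/24 and 1/120, with difference 1/5.\<close>

lemma cusp_lim_rr: "cusp_lim (\<lambda>\<tau>. rr \<tau> / ee (\<tau> / 5)) 1"
proof -
  have "cusp_lim (\<lambda>\<tau>. (eta (of_nat 5 * \<tau>) / ee (of_nat 5 * \<tau> / 24)) / (eta_comp 1 \<tau> / ee (\<tau> / 120))) (1 / 1)"
    by (intro cusp_lim_divide cusp_lim_eta cusp_lim_eta_comp) auto
  moreover have "ee (5 * \<tau> / 24) = ee (\<tau> / 120) * ee (\<tau> / 5)" for \<tau>
    by (simp flip: ee_add)
  ultimately show ?thesis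
    by (simp add: rr_def mult.commute)
qed

text \<open>The class representatives of \<open>comp5_par_class\<close> for j = 4 are 2 and 3, that
  is, 2 + c; its square is the leading exponent.\<close>

lemma cusp_lim_theta_comp_4:
  assumes "c < 2"
  shows "cusp_lim (\<lambda>\<tau>. theta_comp 4 c \<tau> / ee (\<tau> / 20) ^ ((2 + c)\<^sup>2)) 2"
proof -
  define g where "g = (\<lambda>q. 2 * eul 10 q * gprod 1 (5 + (2 + c)) 10 q * gprod 1 (5 - (2 + c)) 10 q)"
  have "continuous_on (ball 0 1) g"
    unfolding g_def by (intro continuous_intros holomorphic_on_imp_continuous_on eul_holomorphic gprod_holomorphic) auto
  moreover have "g 0 = 2"
    using assms by (simp add: g_def gprod_def power_0_left)
  ultimately have "cusp_lim (\<lambda>\<tau>. g (ee (\<tau> * of_real 1))) 2"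
    by (intro cusp_lim_continuous) auto
  moreover have "theta_comp 4 c \<tau> / ee (\<tau> / 20) ^ ((2 + c)\<^sup>2) = g (ee (\<tau> * of_real 1))" if "\<tau> \<in> uhp" for \<tau>
  proof -
    have "theta_comp 4 c \<tau> = 2 * ee (\<tau> / 20) ^ ((2 + c)\<^sup>2) * eul 10 (ee (\<tau> / 20) ^ 20) *
        gprod 1 (5 + (2 + c)) 10 (ee (\<tau> / 20) ^ 20) * gprod 1 (5 - (2 + c)) 10 (ee (\<tau> / 20) ^ 20)"
      unfolding theta_comp_def by (rule comp5_par_class) (use that assms in auto)
    thus ?thesis by (simp add: g_def ee_power)
  qed
  ultimately show ?thesis
    by (subst cusp_lim_cong[where g = "\<lambda>\<tau>. g (ee (\<tau> * of_real 1))"])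
qed

lemma cusp_lim_theta_1: "cusp_lim (\<lambda>\<tau>. theta 1 \<tau> / ee (\<tau> / 4)) 2"
proof -
  have "cusp_lim (\<lambda>\<tau>. 2 * (eul 4 (ee (\<tau> * of_real 1)) ^ 2 / eul 2 (ee (\<tau> * of_real 1)))) (2 * (1 ^ 2 / 1))"
    by (intro cusp_lim_mult cusp_lim_divide cusp_lim_power cusp_lim_eul cusp_lim_const) auto
  thus ?thesis
    by (subst cusp_lim_cong) (auto simp: theta_1_product simp del: One_nat_def)
qed

lemma cusp_lim_theta_0: "k > 0 \<Longrightarrow> cusp_lim (\<lambda>\<tau>. theta 0 (of_nat k * \<tau>)) 1"
proof -
  assume k: "k > 0"
  let ?q = "\<lambda>\<tau>. ee (\<tau> * of_real (real k))"
  have "cusp_lim (\<lambda>\<tau>. eul 2 (?q \<tau>) ^ 5 / (eul 1 (?q \<tau>) ^ 2 * eul 4 (?q \<tau>) ^ 2)) (1 ^ 5 / (1 ^ 2 * 1 ^ 2))"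
    by (intro cusp_lim_mult cusp_lim_divide cusp_lim_power cusp_lim_eul cusp_lim_const) (use k in auto)
  thus ?thesis
    by (subst cusp_lim_cong) (use k uhp_mult in \<open>auto simp: theta_0_product mult.commute\<close>)
qed

section \<open>Choosing signs of square roots on the upper half-plane\<close>

lemma fsigma_uhp: "fsigma uhp"
proof -
  have "uhp = (\<Union>n. {\<tau>. Im \<tau> \<ge> 1 / real (Suc n)})"
  proof (intro equalityI subsetI)
    fix \<tau> assume "\<tau> \<in> uhp"
    then obtain n where "1 / real (Suc n) < Im \<tau>"
      using nat_approx_posE[of "Im \<tau>"] by (auto simp: uhp_iff)
    thus "\<tau> \<in> (\<Union>n. {\<tau>. Im \<tau> \<ge> 1 / real (Suc n)})" by (intro UN_I[of n]) auto
  next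
    fix \<tau> assume "\<tau> \<in> (\<Union>n. {\<tau>. Im \<tau> \<ge> 1 / real (Suc n)})"
    then obtain n where "Im \<tau> \<ge> 1 / real (Suc n)" by auto
    moreover have "1 / real (Suc n) > 0" by simp
    ultimately show "\<tau> \<in> uhp" unfolding uhp_iff by linarith
  qed
  moreover have "fsigma (\<Union>n. {\<tau>. Im \<tau> \<ge> 1 / real (Suc n)})"
    by (rule fsigma.intros) (simp add: closed_halfspace_Im_ge)
  ultimately show ?thesis by simp
qed

text \<open>Off the zeros of g the quotient f / g is continuous with values 1 and -1. These zeros
  are countable, so their complement is connected and the quotient is constant there; the limit
  selects 1.\<close>

lemma equal_squares_on_uhp:
  assumes cont: "continuous_on uhp f" and hol: "g holomorphic_on uhp"
    and sq: "\<And>\<tau>. \<tau> \<in> uhp \<Longrightarrow> f \<tau> ^ 2 = g \<tau> ^ 2"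
    and lim: "cusp_lim (\<lambda>\<tau>. f \<tau> / g \<tau>) 1" and \<tau>: "\<tau> \<in> uhp"
  shows "f \<tau> = g \<tau>"
proof -
  let ?h = "\<lambda>\<tau>. f \<tau> / g \<tau>"
  define U where "U = uhp - {\<sigma> \<in> uhp. g \<sigma> = 0}"
  have "\<forall>\<^sub>F y::real in at_top. ?h (\<i> * of_real y) \<in> - {0}"
    using lim unfolding cusp_lim_def by (intro topological_tendstoD) auto
  hence ev: "\<forall>\<^sub>F y::real in at_top. \<i> * of_real y \<in> U"
    using eventually_gt_at_top[of 0] by eventually_elim (auto simp: U_def uhp_iff)
  then obtain \<sigma>0 where \<sigma>0: "\<sigma>0 \<in> U"
    using eventually_happens'[OF trivial_limit_at_top_linorder ev] by blast
  have "countable {\<sigma> \<in> uhp. g \<sigma> = 0}"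
  proof (cases "g constant_on uhp")
    case True
    hence "{\<sigma> \<in> uhp. g \<sigma> = 0} = {}" using \<sigma>0 by (auto simp: constant_on_def U_def)
    thus ?thesis by (simp only: countable_empty)
  next
    case False
    thus ?thesis
      by (intro holomorphic_countable_zeros hol open_uhp connected_uhp fsigma_uhp)
  qed
  hence conn: "connected U"
    unfolding U_def by (intro connected_open_diff_countable open_uhp connected_uhp) auto
  have h: "?h \<sigma> \<in> {1, -1}" if "\<sigma> \<in> U" for \<sigma>
  proof -
    have "?h \<sigma> ^ 2 = 1" using sq[of \<sigma>] that by (simp add: power_divide U_def)
    thus ?thesis by (simp add: power2_eq_1_iff)
  qed
  have "finite (?h ` U)"
    by (rule finite_subset[of _ "{1, -1}"]) (use h in blast, simp)
  moreover have "continuous_on U ?h"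
    using cont holomorphic_on_imp_continuous_on[OF hol]
    by (intro continuous_on_divide continuous_on_subset[of uhp _ U]) (auto simp: U_def)
  ultimately have "?h constant_on U"
    using continuous_finite_range_constant[OF conn] by blast
  then obtain c where c: "\<And>\<sigma>. \<sigma> \<in> U \<Longrightarrow> ?h \<sigma> = c" by (auto simp: constant_on_def)
  have "((\<lambda>y::real. ?h (\<i> * of_real y)) \<longlongrightarrow> c) at_top"
    by (rule tendsto_eventually) (use ev c in \<open>auto elim!: eventually_mono\<close>)
  hence "c = 1"
    using lim unfolding cusp_lim_def by (intro tendsto_unique[OF trivial_limit_at_top_linorder])
  show ?thesis
  proof (cases "g \<tau> = 0")
    case True
    thus ?thesis using sq[OF \<tau>] by simp
  next
    case False
    thus ?thesis using c[of \<tau>] \<tau> \<open>c = 1\<close> by (auto simp: U_def)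
  qed
qed

lemma holomorphic_eul_ee: "n > 0 \<Longrightarrow> (\<lambda>\<tau>. eul n (ee \<tau>)) holomorphic_on uhp"
  by (rule holomorphic_on_compose_gen[OF ee_holomorphic eul_holomorphic, unfolded o_def]) auto

lemma holomorphic_theta:
  assumes "c < 2"
  shows "theta c holomorphic_on uhp" "(\<lambda>\<tau>. theta c (5 * \<tau>)) holomorphic_on uhp"
proof -
  have 0: "theta 0 holomorphic_on uhp"
    by (rule holomorphic_transform[OF _ theta_0_product [symmetric]])
       (auto intro!: holomorphic_intros holomorphic_eul_ee)
  have "(\<lambda>\<tau>. ee (\<tau> / 4)) holomorphic_on uhp"
    unfolding ee_def by (intro holomorphic_intros) simp_all
  hence 1: "theta 1 holomorphic_on uhp"
    by (intro holomorphic_transform[OF _ theta_1_product [symmetric]])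
       (auto intro!: holomorphic_intros holomorphic_eul_ee)
  show 2: "theta c holomorphic_on uhp"
    using 0 1 less_2_cases[OF assms] by auto
  show "(\<lambda>\<tau>. theta c (5 * \<tau>)) holomorphic_on uhp"
    by (rule holomorphic_on_compose_gen[OF _ 2, unfolded o_def]) (auto intro!: holomorphic_intros)
qed

text \<open>Both \<open>theta_comp 4 c / rr\<close> and \<open>- rr * theta_comp 1 c\<close> are roots of the same quadratic,
  whose discriminant is the square of \<open>2 * theta c\<close>.\<close>

lemma theta_comp_rr:
  assumes c: "c < 2" and \<tau>: "\<tau> \<in> uhp"
  shows "theta_comp 4 c \<tau> = rr \<tau> * (theta c \<tau> + theta c (5 * \<tau>))"
    and "theta_comp 1 c \<tau> = (theta c \<tau> - theta c (5 * \<tau>)) / rr \<tau>"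
proof -
  define f where "f = (\<lambda>\<tau>. theta_comp 4 c \<tau> / rr \<tau> - theta c (5 * \<tau>))"
  have diff: "theta_comp 4 c \<tau> / rr \<tau> - rr \<tau> * theta_comp 1 c \<tau> = 2 * theta c (5 * \<tau>)" if "\<tau> \<in> uhp" for \<tau>
  proof -
    have "eta (5 * \<tau>) * (theta_comp 4 c \<tau> / rr \<tau> - rr \<tau> * theta_comp 1 c \<tau>) =
        eta (5 * \<tau>) * (2 * theta c (5 * \<tau>))"
      using eta_theta_comp[OF that, of c]
      by (simp add: eta_comp_1_eq[OF that] eta_comp_4_eq[OF that] algebra_simps)
    moreover have "eta (5 * \<tau>) \<noteq> 0" using that by (intro eta_nonzero) simp
    ultimately show ?thesis by (simp only: mult_cancel_left simp_thms)
  qed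
  have sq: "f \<tau> ^ 2 = theta c \<tau> ^ 2" if "\<tau> \<in> uhp" for \<tau>
  proof -
    define X Y where "X = theta_comp 4 c \<tau> / rr \<tau>" and "Y = rr \<tau> * theta_comp 1 c \<tau>"
    have "X * Y = theta c \<tau> ^ 2 - theta c (5 * \<tau>) ^ 2"
      using theta_comp_product[OF that, of c] rr_nonzero[OF that] by (simp add: X_def Y_def mult.commute)
    moreover have "X - Y = 2 * theta c (5 * \<tau>)" using diff[OF that] by (simp add: X_def Y_def)
    ultimately have "(X - theta c (5 * \<tau>)) ^ 2 = theta c \<tau> ^ 2" by algebra
    thus ?thesis by (simp add: f_def X_def)
  qed
  have lim: "cusp_lim (\<lambda>\<tau>. f \<tau> / theta c \<tau>) 1"
  proof -
    let ?A = "\<lambda>\<tau>. theta_comp 4 c \<tau> / ee (\<tau> / 20) ^ ((2 + c)\<^sup>2)"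
    let ?R = "\<lambda>\<tau>. rr \<tau> / ee (\<tau> / 5)"
    from less_2_cases[OF c] show ?thesis
    proof
      assume c: "c = 0"
      have "cusp_lim (\<lambda>\<tau>. (?A \<tau> / ?R \<tau> - theta c (of_nat 5 * \<tau>)) / theta c (of_nat 1 * \<tau>)) ((2 / 1 - 1) / 1)"
        using cusp_lim_theta_comp_4[of c] c cusp_lim_theta_0[of 5] cusp_lim_theta_0[of 1]
        by (intro cusp_lim_divide cusp_lim_diff cusp_lim_rr) auto
      moreover have "ee (\<tau> / 20) ^ 4 = ee (\<tau> / 5)" for \<tau> by (simp add: ee_power)
      ultimately show ?thesis using c by (simp add: f_def)
    next
      assume c: "c = Suc 0"
      \<comment> \<open>Here \<open>theta 1\<close> tends to 0, so numerator and denominator are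
        divided by q^(1/4). The term theta 1 (5 \<tau>) then equals q times a convergent one and
        drops out.\<close>
      have "cusp_lim (\<lambda>\<tau>. theta 1 (of_nat 5 * \<tau>) / ee (of_nat 5 * \<tau> / 4)) 2"
      proof -
        have "cusp_lim (\<lambda>\<tau>. 2 * (eul 4 (ee (\<tau> * of_real 5)) ^ 2 / eul 2 (ee (\<tau> * of_real 5)))) (2 * (1 ^ 2 / 1))"
          by (intro cusp_lim_mult cusp_lim_divide cusp_lim_power cusp_lim_eul cusp_lim_const) auto
        moreover have "theta 1 (of_nat 5 * \<tau>) / ee (of_nat 5 * \<tau> / 4) =
            2 * (eul 4 (ee (\<tau> * of_real 5)) ^ 2 / eul 2 (ee (\<tau> * of_real 5)))" if "\<tau> \<in> uhp" for \<tau>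
          using theta_1_product[of "5 * \<tau>"] that by (simp add: mult.commute[of \<tau>] del: One_nat_def)
        ultimately show ?thesis
          using cusp_lim_cong[of "\<lambda>\<tau>. theta 1 (of_nat 5 * \<tau>) / ee (of_nat 5 * \<tau> / 4)"
            "\<lambda>\<tau>. 2 * (eul 4 (ee (\<tau> * of_real 5)) ^ 2 / eul 2 (ee (\<tau> * of_real 5)))" 2] by simp
      qed
      hence "cusp_lim (\<lambda>\<tau>. ee (\<tau> * of_real 1) * (theta 1 (of_nat 5 * \<tau>) / ee (of_nat 5 * \<tau> / 4))) (0 * 2)"
        by (intro cusp_lim_mult cusp_lim_ee) auto
      hence "cusp_lim (\<lambda>\<tau>. (?A \<tau> / ?R \<tau> - ee (\<tau> * of_real 1) * (theta 1 (of_nat 5 * \<tau>) / ee (of_nat 5 * \<tau> / 4))) /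
                (theta 1 \<tau> / ee (\<tau> / 4))) ((2 / 1 - 0 * 2) / 2)"
        using cusp_lim_theta_comp_4[of c] c
        by (intro cusp_lim_divide cusp_lim_diff cusp_lim_rr cusp_lim_theta_1) auto
      moreover have "(?A \<tau> / ?R \<tau> - ee (\<tau> * of_real 1) * (theta 1 (of_nat 5 * \<tau>) / ee (of_nat 5 * \<tau> / 4))) /
                (theta 1 \<tau> / ee (\<tau> / 4)) = f \<tau> / theta c \<tau>" for \<tau>
      proof -
        have "(2 + c)\<^sup>2 = 9" using c by simp
        hence e1: "ee (\<tau> / 20) ^ ((2 + c)\<^sup>2) = ee (\<tau> / 5) * ee (\<tau> / 4)"
          by (simp add: ee_power flip: ee_add)
        have e2: "ee (5 * \<tau> / 4) = ee \<tau> * ee (\<tau> / 4)"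
          by (simp flip: ee_add)
        have th: "theta c = theta 1" using c by simp
        have alg: "(A / (P * E) / (R / P) - q * (B / (q * E))) / (T / E) = (A / R - B) / T"
          if "P \<noteq> 0" "E \<noteq> 0" "q \<noteq> 0" for A B E P R T q :: complex
        proof -
          have "A / (P * E) / (R / P) = (A / R) / E" "q * (B / (q * E)) = B / E"
            using that by simp_all
          hence "(A / (P * E) / (R / P) - q * (B / (q * E))) / (T / E) = ((A / R - B) / E) / (T / E)"
            by (simp only: diff_divide_distrib)
          also have "\<dots> = (A / R - B) / T" using that(2) by simp
          finally show ?thesis .
        qed
        show ?thesis
          unfolding e1 f_def th of_nat_numeral of_real_1 mult_1_right e2
          by (rule alg) (rule ee_nonzero)+
      qed
      ultimately show ?thesis by simp
    qed
  qed
  have "f \<tau> = theta c \<tau>"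
  proof (rule equal_squares_on_uhp[OF _ holomorphic_theta(1)[OF c] sq lim \<tau>])
    show "continuous_on uhp f"
      unfolding f_def using continuous_scale[OF continuous_theta, of 5 c] rr_nonzero
      by (intro continuous_intros continuous_theta_comp continuous_rr) auto
  qed
  thus 1: "theta_comp 4 c \<tau> = rr \<tau> * (theta c \<tau> + theta c (5 * \<tau>))"
    using rr_nonzero[OF \<tau>] by (simp add: f_def field_simps)
  show "theta_comp 1 c \<tau> = (theta c \<tau> - theta c (5 * \<tau>)) / rr \<tau>"
  proof -
    have "theta_comp 4 c \<tau> / rr \<tau> = theta c \<tau> + theta c (5 * \<tau>)"
      using 1 rr_nonzero[OF \<tau>] by simp
    hence "rr \<tau> * theta_comp 1 c \<tau> = theta c \<tau> - theta c (5 * \<tau>)"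
      using diff[OF \<tau>] by algebra
    thus ?thesis using rr_nonzero[OF \<tau>] by (metis nonzero_mult_div_cancel_left)
  qed
qed

lemma theta_fifth_rr:
  assumes "c < 2" "\<tau> \<in> uhp"
  shows "theta c (\<tau> / 5) = theta c (5 * \<tau>) + rr \<tau> * (theta c \<tau> + theta c (5 * \<tau>)) +
     (theta c \<tau> - theta c (5 * \<tau>)) / rr \<tau>"
  using theta_fifth[OF assms(2), of c] theta_comp_rr[OF assms] by simp

section \<open>Fifth roots of unity and the relation between \<open>rr\<close> and
  \<open>fn_t\<close>\<close>

definition zeta5 :: complex where "zeta5 = ee (1 / 5)"

lemma zeta5_power_5: "zeta5 ^ 5 = 1"
  using ee_of_nat[of 1] by (simp add: zeta5_def ee_power)

lemma zeta5_power_mod: "zeta5 ^ n = zeta5 ^ (n mod 5)"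
proof -
  have "zeta5 ^ n = zeta5 ^ (5 * (n div 5) + n mod 5)" by simp
  also have "\<dots> = zeta5 ^ (n mod 5)"
    unfolding power_add power_mult zeta5_power_5 by simp
  finally show ?thesis .
qed

lemma zeta5_power_eq_1: "zeta5 ^ n = 1 \<longleftrightarrow> 5 dvd n"
proof
  assume "zeta5 ^ n = 1"
  hence "exp (2 * of_real pi * \<i> * (of_nat n / 5)) = 1"
    unfolding zeta5_def ee_power unfolding ee_def by simp
  then obtain k :: int where k: "2 * pi * (real n / 5) = of_int (2 * k) * pi"
    unfolding exp_eq_1 by (auto simp: Re_divide_numeral Im_divide_numeral)
  hence "real n = of_int (5 * k)" by simp
  hence "int n = 5 * k" by linarith
  thus "5 dvd n" by presburger
next
  assume "5 dvd n"
  thus "zeta5 ^ n = 1" by (metis dvd_eq_mod_eq_0 power_0 zeta5_power_mod)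
qed

lemma prod_fifth_roots:
  fixes \<omega> X :: complex
  assumes "\<omega> ^ 5 = 1" "\<omega> \<noteq> 1"
  shows "(\<Prod>k<5. 1 - \<omega> ^ k * X) = 1 - X ^ 5"
proof -
  have "(\<omega> - 1) * (1 + \<omega> + \<omega>^2 + \<omega>^3 + \<omega>^4) = \<omega> ^ 5 - 1" by algebra
  hence "1 + \<omega> + \<omega>^2 + \<omega>^3 + \<omega>^4 = 0" using assms by simp
  hence "(1 - X) * (1 - \<omega> * X) * (1 - \<omega>^2 * X) * (1 - \<omega>^3 * X) * (1 - \<omega>^4 * X) = 1 - X ^ 5"
    by algebra
  thus ?thesis by (simp add: lessThan_nat_numeral lessThan_Suc mult_ac)
qed

text \<open>1 - X - X^2 splits as (1 - a X) (1 - b X) with the golden ratio a and its conjugate b;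
  11 is the Lucas number a^5 + b^5, and (a b)^5 = -1.\<close>

lemma prod_fifth_roots_quadratic:
  fixes \<omega> x :: complex
  assumes "\<omega> ^ 5 = 1" "\<omega> \<noteq> 1"
  shows "(\<Prod>k<5. 1 - \<omega> ^ k * x - (\<omega> ^ k * x) ^ 2) = 1 - 11 * x ^ 5 - x ^ 10"
proof -
  define c where "c = csqrt 5"
  define a :: complex where "a = (1 + c) / 2"
  define b :: complex where "b = 1 - a"
  have sq: "c ^ 2 = 5" unfolding c_def by (rule power2_csqrt)
  have a2: "a ^ 2 = a + 1" unfolding a_def using sq by (simp add: power2_eq_square field_simps)
  have ab: "a * b = -1" unfolding b_def using a2 by (simp add: power2_eq_square algebra_simps)
  have "1 - \<omega> ^ k * x - (\<omega> ^ k * x) ^ 2 = (1 - \<omega> ^ k * (a * x)) * (1 - \<omega> ^ k * (b * x))" for k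
  proof -
    have "a + b = 1" by (simp add: b_def)
    moreover have "(1 - \<omega> ^ k * (a * x)) * (1 - \<omega> ^ k * (b * x)) =
        1 - (a + b) * (\<omega> ^ k * x) + (a * b) * (\<omega> ^ k * x) ^ 2"
      by (simp add: power2_eq_square algebra_simps)
    ultimately show ?thesis using ab by simp
  qed
  hence "(\<Prod>k<5. 1 - \<omega> ^ k * x - (\<omega> ^ k * x) ^ 2) = (1 - (a * x) ^ 5) * (1 - (b * x) ^ 5)"
    by (simp add: prod.distrib prod_fifth_roots[OF assms])
  also have "\<dots> = 1 - 11 * x ^ 5 - x ^ 10"
    using a2 ab b_def by algebra
  finally show ?thesis .
qed

text \<open>Factors 1 - Q^n with n prime to 5 combine over the five roots to 1 - Q^(5 n); the others
  are fixed and occur five times.\<close>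

lemma eul_norm:
  assumes Q: "norm Q < 1" and \<omega>: "\<omega> ^ 5 = 1" "\<And>j. \<omega> ^ j = 1 \<Longrightarrow> 5 dvd j"
  shows "(\<Prod>k<5. eul 1 (\<omega> ^ k * Q)) = eul 1 (Q ^ 5) ^ 6 / eul 1 (Q ^ 25)"
proof -
  have n\<omega>: "norm \<omega> = 1"
    using \<omega>(1) by (metis norm_ge_zero norm_one norm_power power_eq_1_iff zero_neq_numeral)
  have nQ: "norm (\<omega> ^ k * Q) < 1" for k
    using Q n\<omega> by (simp add: norm_mult norm_power)
  have \<omega>5: "\<omega> ^ (5 * n) = 1" for n by (simp add: power_mult \<omega>(1))
  have split: "eul 1 q = gprod (-1) 1 5 q * gprod (-1) 2 5 q * gprod (-1) 3 5 q * gprod (-1) 4 5 q * eul 5 q"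
    if "norm q < 1" for q
    using gprod_dissect[OF that, of 1 5 "-1" 1]
    by (simp add: eul_eq lessThan_nat_numeral lessThan_Suc mult_ac del: One_nat_def)
  have e5: "eul 5 (\<omega> ^ k * Q) = eul 1 (Q ^ 5)" for k
    using eul_power[of 5 1] by (simp add: power_mult_distrib \<omega>5 flip: power_mult) (simp add: mult.commute[of k] \<omega>5)
  have j: "(\<Prod>k<5. gprod (-1) j 5 (\<omega> ^ k * Q)) = gprod (-1) j 5 (Q ^ 5)" if "\<not> 5 dvd j" for j
  proof -
    have "(\<Prod>k<5. gprod (-1) j 5 (\<omega> ^ k * Q)) = (\<Prod>m. \<Prod>k<5. 1 + (-1) * (\<omega> ^ k * Q) ^ (5 * m + j))"
      unfolding gprod_def by (intro prodinf_prod [symmetric] convergent_prod_geometric_progression nQ) auto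
    moreover have "(\<Prod>k<5. 1 + (-1) * (\<omega> ^ k * Q) ^ (5 * m + j)) = 1 + (-1) * (Q ^ 5) ^ (5 * m + j)" for m
    proof -
      have "(\<omega> ^ k * Q) ^ (5 * m + j) = (\<omega> ^ j) ^ k * Q ^ (5 * m + j)" for k
      proof -
        have "(\<omega> ^ k) ^ (5 * m + j) = \<omega> ^ (5 * (k * m)) * (\<omega> ^ j) ^ k"
          unfolding power_mult [symmetric] power_add [symmetric] by (simp add: algebra_simps)
        thus ?thesis by (simp add: power_mult_distrib \<omega>5)
      qed
      moreover have "(\<omega> ^ j) ^ 5 = 1" unfolding power_mult [symmetric] mult.commute[of j] by (rule \<omega>5)
      moreover have "\<omega> ^ j \<noteq> 1" using that \<omega>(2) by blast
      ultimately have "(\<Prod>k<5. 1 + (-1) * (\<omega> ^ k * Q) ^ (5 * m + j)) = 1 - (Q ^ (5 * m + j)) ^ 5"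
        using prod_fifth_roots[of "\<omega> ^ j" "Q ^ (5 * m + j)"] by simp
      thus ?thesis by (simp add: mult.commute flip: power_mult)
    qed
    ultimately show ?thesis by (simp only: gprod_def)
  qed
  have Q5: "norm (Q ^ 5) < 1" using Q by (simp add: norm_power power_less_one_iff)
  have "(\<Prod>k<5. eul 1 (\<omega> ^ k * Q)) =
     gprod (-1) 1 5 (Q ^ 5) * gprod (-1) 2 5 (Q ^ 5) * gprod (-1) 3 5 (Q ^ 5) * gprod (-1) 4 5 (Q ^ 5) * eul 1 (Q ^ 5) ^ 5"
    unfolding split[OF nQ] prod.distrib e5 by (simp add: j del: One_nat_def)
  moreover have "eul 5 (Q ^ 5) = eul 1 (Q ^ 25)"
    using eul_power[of 5 1 "Q ^ 5"] by (simp flip: power_mult)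
  moreover have "eul 5 (Q ^ 5) \<noteq> 0" using Q5 by (intro eul_nonzero) auto
  ultimately show ?thesis
    using split[OF Q5] by (simp add: field_simps eval_nat_numeral)
qed

lemma thsum_comp5_1_twist:
  assumes "w ^ 5 = 1"
  shows "thsum (comp5 1 f) (z * w) = w * thsum (comp5 1 f) z"
proof -
  have "comp5 1 f x * (z * w) ^ sqe x = w * (comp5 1 f x * z ^ sqe x)" for x
  proof (cases "x\<^sup>2 mod 5 = 1")
    case True
    hence "sqe x mod 5 = 1" using nat_mod_distrib[of "x\<^sup>2" 5] by simp
    hence "sqe x = 5 * (sqe x div 5) + 1" using mult_div_mod_eq[of 5 "sqe x"] by simp
    hence "w ^ sqe x = w ^ (5 * (sqe x div 5)) * w" by (metis power_add power_one_right)
    also have "w ^ (5 * (sqe x div 5)) = 1" by (simp add: power_mult assms)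
    finally show ?thesis by (simp add: power_mult_distrib)
  qed (simp add: comp5_def)
  thus ?thesis
    unfolding gsum_def by (simp only: infsum_cmult_right')
qed

text \<open>The translations by \<open>24 k\<close> act on \<open>q^(1/5)\<close> through fifth roots of unity and fix \<open>q^(1/24)\<close>.\<close>

lemma eta_comp_shift: "eta_comp 1 (\<tau> + 24 * of_nat k) = zeta5 ^ k * eta_comp 1 \<tau>"
proof -
  have "ee ((\<tau> + 24 * of_nat k) / 120) = ee (\<tau> / 120) * zeta5 ^ k"
    by (simp add: zeta5_def ee_power add_divide_distrib ee_add)
  moreover have "(zeta5 ^ k) ^ 5 = 1"
    by (metis power_commutes power_mult mult.commute power_one zeta5_power_5)
  ultimately show ?thesis
    by (simp add: eta_comp_def thsum_comp5_1_twist)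
qed

lemma eta_shift: "eta (\<tau> + 24 * of_nat k) = eta \<tau>"
  by (simp add: eta_def add_divide_distrib ee_add)

lemma eta_5_shift: "eta (5 * (\<tau> + 24 * of_nat k)) = eta (5 * \<tau>)"
  using eta_shift[of "5 * \<tau>" "5 * k"] by (simp add: algebra_simps)

lemma theta_shift: "theta c (\<tau> + 24 * of_nat k) = theta c \<tau>"
proof -
  have "ee ((\<tau> + 24 * of_nat k) / 4) = ee (\<tau> / 4) * ee (of_nat (6 * k))"
    by (simp flip: ee_add add: add_divide_distrib)
  thus ?thesis by (simp only: theta_def ee_of_nat mult_1_right)
qed

lemma theta_5_shift: "theta c (5 * (\<tau> + 24 * of_nat k)) = theta c (5 * \<tau>)"
  using theta_shift[of c "5 * \<tau>" "5 * k"] by (simp add: algebra_simps)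

lemma rr_shift: "rr (\<tau> + 24 * of_nat k) = rr \<tau> / zeta5 ^ k"
  unfolding rr_def eta_5_shift eta_comp_shift by (simp add: mult.commute)

lemma uhp_shift: "\<tau> \<in> uhp \<Longrightarrow> \<tau> + 24 * of_nat k \<in> uhp"
  by (simp add: uhp_iff)

lemma eta_fifth_shift:
  assumes "\<tau> \<in> uhp"
  shows "eta ((\<tau> + 24 * of_nat k) / 5) = eta (5 * \<tau>) * (zeta5 ^ k / rr \<tau> - 1 - rr \<tau> / zeta5 ^ k)"
  using eta_fifth_rr[OF uhp_shift[OF assms]] unfolding rr_shift eta_5_shift by simp

lemma zeta5_nonzero [simp]: "zeta5 \<noteq> 0"
  by (simp add: zeta5_def)

lemma prod_eta_fifth:
  assumes "\<tau> \<in> uhp"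
  shows "(\<Prod>k<5. eta ((\<tau> + 24 * of_nat k) / 5)) = eta \<tau> ^ 6 / eta (5 * \<tau>)"
proof -
  have e: "eta ((\<tau> + 24 * of_nat k) / 5) = ee (\<tau> / 120) * zeta5 ^ k * eul 1 ((zeta5 ^ 24) ^ k * ee (\<tau> / 5))" for k
  proof -
    have "ee ((\<tau> + 24 * of_nat k) / 5 / 24) = ee (\<tau> / 120) * zeta5 ^ k"
      by (simp add: zeta5_def ee_power add_divide_distrib ee_add)
    moreover have "ee ((\<tau> + 24 * of_nat k) / 5) = (zeta5 ^ 24) ^ k * ee (\<tau> / 5)"
      by (simp add: zeta5_def ee_power add_divide_distrib ee_add mult_ac)
    ultimately show ?thesis
      using eta_product[of "(\<tau> + 24 * of_nat k) / 5"] uhp_shift[OF assms] by (simp del: One_nat_def)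
  qed
  have "zeta5 ^ (0 + 1 + 2 + 3 + 4) = 1"
    using zeta5_power_eq_1[of 10] by simp
  hence z: "(\<Prod>k<5. ee (\<tau> / 120) * zeta5 ^ k) = ee (\<tau> / 24)"
    by (simp add: prod.distrib lessThan_nat_numeral lessThan_Suc ee_power mult_ac flip: power_Suc power_add)
  have "(\<Prod>k<5. eta ((\<tau> + 24 * of_nat k) / 5)) =
      ee (\<tau> / 24) * (eul 1 (ee (\<tau> / 5) ^ 5) ^ 6 / eul 1 (ee (\<tau> / 5) ^ 25))"
    unfolding e prod.distrib [of "\<lambda>k. ee (\<tau> / 120) * zeta5 ^ k"] z
  proof (subst eul_norm)
    show "(zeta5 ^ 24) ^ 5 = 1"
      using zeta5_power_eq_1[of 120] by (simp flip: power_mult)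
    show "5 dvd j" if "(zeta5 ^ 24) ^ j = 1" for j
    proof -
      have "5 dvd 24 * j" using that zeta5_power_eq_1[of "24 * j"] by (simp add: power_mult)
      thus ?thesis by presburger
    qed
  qed (use assms in auto)
  also have "\<dots> = eta \<tau> ^ 6 / eta (5 * \<tau>)"
  proof -
    have "ee (\<tau> / 24) ^ 6 = ee (\<tau> / 24) * ee (5 * \<tau> / 24)"
      by (simp add: ee_power flip: ee_add)
    thus ?thesis
      using assms by (simp add: eta_product power_mult_distrib ee_power del: One_nat_def)
  qed
  finally show ?thesis .
qed

text \<open>The product of eta over the five points (\<tau> + 24 k) / 5 is evaluated twice: by the
  dissection in r and by \<open>prod_eta_fifth\<close>.\<close>

lemma rr_t_relation:
  assumes "\<tau> \<in> uhp"
  shows "1 / rr \<tau> ^ 5 - 11 - rr \<tau> ^ 5 = eta \<tau> ^ 6 / eta (5 * \<tau>) ^ 6"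
proof -
  define \<omega> where "\<omega> = 1 / zeta5"
  define r where "r = rr \<tau>"
  have \<omega>: "\<omega> ^ 5 = 1" "\<omega> \<noteq> 1"
    using zeta5_power_5 zeta5_power_eq_1[of 1] by (auto simp: \<omega>_def power_divide)
  have r: "r \<noteq> 0" unfolding r_def by (rule rr_nonzero[OF assms])
  have x: "zeta5 ^ k / r - 1 - r / zeta5 ^ k = (1 - \<omega> ^ k * r - (\<omega> ^ k * r) ^ 2) / (\<omega> ^ k * r)" for k
    using r by (simp add: \<omega>_def power_divide field_simps power2_eq_square)
  have "(\<Prod>k<5. \<omega> ^ k * r) = r ^ 5"
  proof -
    have "\<omega> ^ 10 = 1" using \<omega>(1) by (metis mult_2 numeral_Bit0 power_add mult_1)
    hence "r * (\<omega> * r) * (\<omega>^2 * r) * (\<omega>^3 * r) * (\<omega>^4 * r) = r ^ 5" by algebra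
    thus ?thesis by (simp add: lessThan_nat_numeral lessThan_Suc mult_ac)
  qed
  hence "(\<Prod>k<5. zeta5 ^ k / r - 1 - r / zeta5 ^ k) = (1 - 11 * r ^ 5 - r ^ 10) / r ^ 5"
    unfolding x prod_dividef prod_fifth_roots_quadratic[OF \<omega>] by simp
  also have "\<dots> = 1 / r ^ 5 - 11 - r ^ 5"
    using r by (simp add: field_simps flip: power_add)
  finally have "eta (5 * \<tau>) ^ 5 * (1 / r ^ 5 - 11 - r ^ 5) = eta \<tau> ^ 6 / eta (5 * \<tau>)"
    using prod_eta_fifth[OF assms] unfolding eta_fifth_shift[OF assms] prod.distrib r_def by simp
  moreover have "eta (5 * \<tau>) \<noteq> 0" using assms by (intro eta_nonzero) simp
  ultimately show ?thesis
    unfolding r_def by (simp add: field_simps eval_nat_numeral)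
qed

section \<open>Relations of level 20\<close>

lemma ee_surj:
  assumes "q \<noteq> 0" "norm q < 1"
  obtains \<tau> where "\<tau> \<in> uhp" "ee \<tau> = q"
proof
  define \<tau> where "\<tau> = Ln q / (2 * of_real pi * \<i>)"
  show e: "ee \<tau> = q"
    using assms by (simp add: ee_def \<tau>_def)
  show "\<tau> \<in> uhp"
    using assms(2) norm_ee_less_1[of \<tau>] unfolding e by (simp add: uhp_iff)
qed

lemma eul_ee_multiple: "eul n (ee (of_nat k * \<tau>)) = eul (k * n) (ee \<tau>)"
  by (simp add: eul_power ee_power)

lemma theta_0_product_5:
  assumes "\<tau> \<in> uhp"
  shows "theta 0 (5 * \<tau>) = eul 10 (ee \<tau>) ^ 5 / (eul 5 (ee \<tau>) ^ 2 * eul 20 (ee \<tau>) ^ 2)"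
  using theta_0_product[of "5 * \<tau>"] assms eul_ee_multiple[of 1 5 \<tau>] eul_ee_multiple[of 2 5 \<tau>] eul_ee_multiple[of 4 5 \<tau>]
  by simp

lemma theta_1_product_5:
  assumes "\<tau> \<in> uhp"
  shows "theta 1 (5 * \<tau>) = 2 * ee (5 * \<tau> / 4) * (eul 20 (ee \<tau>) ^ 2 / eul 10 (ee \<tau>))"
  using theta_1_product[of "5 * \<tau>"] assms eul_ee_multiple[of 2 5 \<tau>] eul_ee_multiple[of 4 5 \<tau>]
  by simp

lemma eta_product_5:
  assumes "\<tau> \<in> uhp"
  shows "eta (5 * \<tau>) = ee (5 * \<tau> / 24) * eul 5 (ee \<tau>)"
  using eta_product[of "5 * \<tau>"] assms eul_ee_multiple[of 1 5 \<tau>]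
  by simp

text \<open>The product of the two theta components is known as a difference of theta squares and,
  class by class mod 10, as a product of Euler factors. Comparing the two gives the identity; the
  next lemma does the same for \<open>theta 1\<close>.\<close>

lemma eul_identity_theta_0:
  assumes "q \<noteq> 0" "norm q < 1"
  shows "(eul 2 q ^ 5 / (eul 1 q ^ 2 * eul 4 q ^ 2)) ^ 2 - (eul 10 q ^ 5 / (eul 5 q ^ 2 * eul 20 q ^ 2)) ^ 2 =
         4 * q * (eul 2 q ^ 2 * eul 5 q * eul 20 q / (eul 1 q * eul 4 q))"
proof -
  obtain \<tau> where \<tau>: "\<tau> \<in> uhp" and q: "q = ee \<tau>" using ee_surj[OF assms] by metis
  define w where "w = ee (\<tau> / 20)"
  have w: "w \<noteq> 0" "norm w < 1" and w20: "w ^ 20 = q"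
    using \<tau> by (simp_all add: w_def ee_power q)
  have 1: "theta_comp 1 0 \<tau> = 2 * w ^ 16 * eul 10 q * gprod 1 9 10 q * gprod 1 1 10 q"
    using comp5_par_class[OF w, of 1 0 4] unfolding w20 by (simp add: theta_comp_def w_def)
  have 4: "theta_comp 4 0 \<tau> = 2 * w ^ 4 * eul 10 q * gprod 1 7 10 q * gprod 1 3 10 q"
    using comp5_par_class[OF w, of 4 0 2] unfolding w20 by (simp add: theta_comp_def w_def)
  have w16: "w ^ 16 * w ^ 4 = q" by (simp add: w20 flip: power_add)
  have "theta_comp 1 0 \<tau> * theta_comp 4 0 \<tau> = 4 * q * eul 10 q ^ 2 *
      (gprod 1 7 10 q * gprod 1 3 10 q * gprod 1 9 10 q * gprod 1 1 10 q)"
  proof -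
    have "2 * A * e * p * r * (2 * B * e * s * t) = 4 * (A * B) * e ^ 2 * (s * t * p * r)" for A B e p r s t :: complex
      by algebra
    thus ?thesis unfolding 1 4 w16 [symmetric] .
  qed
  also have "\<dots> = 4 * q * (eul 2 q ^ 2 * eul 5 q * eul 20 q / (eul 1 q * eul 4 q))"
    unfolding gprod_residues_odd[OF assms(2)] using eul_nonzero[OF assms(2)] by (simp add: field_simps)
  finally show ?thesis
    using theta_comp_product[OF \<tau>, of 0] unfolding theta_0_product[OF \<tau>] theta_0_product_5[OF \<tau>] q by simp
qed

lemma eul_identity_theta_1:
  assumes "q \<noteq> 0" "norm q < 1"
  shows "(eul 4 q ^ 2 / eul 2 q) ^ 2 - q ^ 2 * (eul 20 q ^ 2 / eul 10 q) ^ 2 =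
         eul 4 q * eul 10 q ^ 3 / (eul 2 q * eul 20 q)"
proof -
  obtain \<tau> where \<tau>: "\<tau> \<in> uhp" and q: "q = ee \<tau>" using ee_surj[OF assms] by metis
  define w where "w = ee (\<tau> / 20)"
  have w: "w \<noteq> 0" "norm w < 1" and w20: "w ^ 20 = q"
    using \<tau> by (simp_all add: w_def ee_power q)
  have 1: "theta_comp 1 1 \<tau> = 2 * w * eul 10 q * gprod 1 6 10 q * gprod 1 4 10 q"
    using comp5_par_class[OF w, of 1 1 1] unfolding w20 by (simp add: theta_comp_def w_def)
  have 4: "theta_comp 4 1 \<tau> = 2 * w ^ 9 * eul 10 q * gprod 1 8 10 q * gprod 1 2 10 q"
    using comp5_par_class[OF w, of 4 1 3] unfolding w20 by (simp add: theta_comp_def w_def)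
  have "theta_comp 1 1 \<tau> * theta_comp 4 1 \<tau> = 4 * w ^ 10 * (eul 10 q ^ 2 *
      (gprod 1 6 10 q * gprod 1 4 10 q * gprod 1 8 10 q * gprod 1 2 10 q))"
    unfolding 1 4 by algebra
  also have "\<dots> = 4 * w ^ 10 * (eul 4 q * eul 10 q ^ 3 / (eul 2 q * eul 20 q))"
    unfolding gprod_residues_even[OF assms(2)] by (simp add: power2_eq_square power3_eq_cube)
  finally have P: "theta_comp 1 1 \<tau> * theta_comp 4 1 \<tau> = \<dots>" .
  have e: "ee (\<tau> / 4) = w ^ 5" "ee (5 * \<tau> / 4) = w ^ 5 * q"
    by (simp_all add: w_def q ee_power flip: ee_add)
  define A B where "A = eul 4 q ^ 2 / eul 2 q" and "B = eul 20 q ^ 2 / eul 10 q"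
  have "theta 1 \<tau> ^ 2 - theta 1 (5 * \<tau>) ^ 2 = (2 * w ^ 5 * A) ^ 2 - (2 * (w ^ 5 * q) * B) ^ 2"
    unfolding theta_1_product[OF \<tau>] theta_1_product_5[OF \<tau>] e A_def B_def q ..
  also have "\<dots> = 4 * w ^ 10 * (A ^ 2 - q ^ 2 * B ^ 2)" by algebra
  finally have "4 * w ^ 10 * (A ^ 2 - q ^ 2 * B ^ 2) = 4 * w ^ 10 * (eul 4 q * eul 10 q ^ 3 / (eul 2 q * eul 20 q))"
    using theta_comp_product[OF \<tau>, of 1] P by simp
  moreover have "4 * w ^ 10 \<noteq> 0" using w(1) by simp
  ultimately show ?thesis unfolding A_def B_def by (simp only: mult_cancel_left simp_thms)
qed

lemma eul_even_uminus: "even n \<Longrightarrow> eul n (- q) = eul n q"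
  by (elim evenE) (simp add: eul_power)

lemma eul_odd_uminus:
  assumes "norm q < 1" "odd n"
  shows "eul n (- q) = eul (2 * n) q ^ 3 / (eul n q * eul (4 * n) q)"
proof -
  have n: "n > 0" using assms(2) by (cases n) auto
  have "gprod (-1) n (2 * n) (- q) = gprod 1 n (2 * n) q"
  proof -
    have "(- q) ^ (2 * n * m + n) = - (q ^ (2 * n * m + n))" for m
      using assms(2) by (intro power_minus_odd) simp
    thus ?thesis by (simp add: gprod_def)
  qed
  moreover have "gprod (-1) (2 * n) (2 * n) (- q) = eul (2 * n) q"
    using eul_even_uminus[of "2 * n" q] by (simp add: eul_eq)
  ultimately show ?thesis
    using gprod_odd[of "- q" n "-1"] assms n gprod_plus_odd[of q n]
    by (simp add: eul_eq power2_eq_square power3_eq_cube)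
qed

text \<open>Obtained from the previous identities by \<open>q \<mapsto> -q\<close> and by \<open>q \<mapsto> q^(1/2)\<close>.\<close>

lemma eul_identity_10a:
  assumes "q \<noteq> 0" "norm q < 1"
  shows "eul 5 q ^ 4 / eul 10 q ^ 2 = eul 1 q ^ 4 / eul 2 q ^ 2 + 4 * q * (eul 1 q * eul 10 q ^ 3 / (eul 2 q * eul 5 q))"
proof -
  define a b c d f g where "a = eul 1 q" and "b = eul 2 q" and "c = eul 4 q"
    and "d = eul 5 q" and "f = eul 10 q" and "g = eul 20 q"
  have nz: "a \<noteq> 0" "b \<noteq> 0" "c \<noteq> 0" "d \<noteq> 0" "f \<noteq> 0" "g \<noteq> 0"
    using eul_nonzero[OF assms(2)] by (simp_all add: a_def b_def c_def d_def f_def g_def)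
  have m: "eul 1 (- q) = b ^ 3 / (a * c)" "eul 5 (- q) = f ^ 3 / (d * g)" "eul 2 (- q) = b"
    "eul 4 (- q) = c" "eul 10 (- q) = f" "eul 20 (- q) = g"
    using eul_odd_uminus[OF assms(2), of 1] eul_odd_uminus[OF assms(2), of 5]
    by (simp_all add: a_def b_def c_def d_def f_def g_def eul_even_uminus)
  have "(b ^ 5 / ((b ^ 3 / (a * c)) ^ 2 * c ^ 2)) ^ 2 - (f ^ 5 / ((f ^ 3 / (d * g)) ^ 2 * g ^ 2)) ^ 2 =
        4 * (- q) * (b ^ 2 * (f ^ 3 / (d * g)) * g / ((b ^ 3 / (a * c)) * c))"
    using eul_identity_theta_0[of "- q"] assms unfolding m by simp
  also have "b ^ 5 / ((b ^ 3 / (a * c)) ^ 2 * c ^ 2) = a ^ 2 / b"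
    using nz by (simp add: field_simps eval_nat_numeral)
  also have "f ^ 5 / ((f ^ 3 / (d * g)) ^ 2 * g ^ 2) = d ^ 2 / f"
    using nz by (simp add: field_simps eval_nat_numeral)
  also have "b ^ 2 * (f ^ 3 / (d * g)) * g / ((b ^ 3 / (a * c)) * c) = a * f ^ 3 / (b * d)"
    using nz by (simp add: field_simps eval_nat_numeral)
  finally have "(d ^ 2 / f) ^ 2 = (a ^ 2 / b) ^ 2 + 4 * q * (a * f ^ 3 / (b * d))"
    by (simp add: algebra_simps)
  thus ?thesis
    by (simp add: a_def b_def d_def f_def power_divide)
qed

lemma eul_identity_10b:
  assumes "q \<noteq> 0" "norm q < 1"
  shows "eul 2 q ^ 4 / eul 1 q ^ 2 = q * (eul 10 q ^ 4 / eul 5 q ^ 2) + eul 2 q * eul 5 q ^ 3 / (eul 1 q * eul 10 q)"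
proof -
  define Q where "Q = csqrt q"
  have Q: "Q ^ 2 = q" unfolding Q_def by (rule power2_csqrt)
  have Q': "Q \<noteq> 0" "norm Q < 1"
    using assms Q by (auto, metis norm_ge_zero norm_power power_less_one_iff zero_less_numeral)
  have "eul (2 * n) Q = eul n q" for n
    by (simp add: eul_power Q)
  from this[of 1] this[of 2] this[of 5] this[of 10]
  have e: "eul 2 Q = eul 1 q" "eul 4 Q = eul 2 q" "eul 10 Q = eul 5 q" "eul 20 Q = eul 10 q"
    by simp_all
  show ?thesis
    using eul_identity_theta_1[OF Q'] unfolding e Q by (simp add: power_divide algebra_simps)
qed

section \<open>The theta quotients as algebraic functions of \<open>fn_x\<close>\<close>

definition zz :: "nat \<Rightarrow> complex \<Rightarrow> complex" where
  "zz c \<tau> = theta c (5 * \<tau>) / theta c \<tau>"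

text \<open>A holomorphic square root of 1 + 4 x, available as an eta quotient.\<close>

definition ss :: "complex \<Rightarrow> complex" where
  "ss \<tau> = eul 2 (ee \<tau>) * eul 5 (ee \<tau>) ^ 2 / (eul 1 (ee \<tau>) ^ 2 * eul 10 (ee \<tau>))"

lemma fn_eul:
  "fn_t \<tau> = ee \<tau> * (eul 5 (ee \<tau>) ^ 6 / eul 1 (ee \<tau>) ^ 6)"
  "fn_x \<tau> = ee \<tau> * (eul 2 (ee \<tau>) * eul 10 (ee \<tau>) ^ 3 / (eul 1 (ee \<tau>) ^ 3 * eul 5 (ee \<tau>)))"
  "fn_y \<tau> = ee \<tau> ^ 2 * (eul 2 (ee \<tau>) ^ 2 * eul 4 (ee \<tau>) * eul 5 (ee \<tau>) * eul 20 (ee \<tau>) ^ 3 / (eul 1 (ee \<tau>) ^ 5 * eul 10 (ee \<tau>) ^ 2))"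
  by (simp_all add: fn_t_def fn_x_def fn_y_def Let_def nome_eq_ee eul_def)

lemma fn_t_eta: "\<tau> \<in> uhp \<Longrightarrow> fn_t \<tau> = eta (5 * \<tau>) ^ 6 / eta \<tau> ^ 6"
proof -
  assume "\<tau> \<in> uhp"
  moreover have "ee (5 * \<tau> / 24) ^ 6 = ee \<tau> * ee (\<tau> / 24) ^ 6"
    by (simp add: ee_power flip: ee_add)
  ultimately show ?thesis
    unfolding eta_product_5[OF \<open>\<tau> \<in> uhp\<close>] eta_product[OF \<open>\<tau> \<in> uhp\<close>] fn_eul power_mult_distrib by simp
qed

lemma fn_nonzero:
  assumes "\<tau> \<in> uhp"
  shows "fn_t \<tau> \<noteq> 0" "fn_x \<tau> \<noteq> 0"
  using assms by (simp_all add: fn_eul)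

text \<open>The four identities between Euler products turn 1 + 4 x, 1 + 5 x and both 1 - z^2 into
  quotients of Euler products; the claims become equalities of monomials or nonvanishing of a
  quotient.\<close>

lemma
  assumes \<tau>: "\<tau> \<in> uhp"
  shows ss_square: "ss \<tau> ^ 2 = 1 + 4 * fn_x \<tau>"
    and ss_nonzero: "ss \<tau> \<noteq> 0"
    and v_nonzero: "1 + 5 * fn_x \<tau> \<noteq> 0"
    and t_eq_x: "fn_t \<tau> * (1 + 5 * fn_x \<tau>) = fn_x \<tau> * (1 + 4 * fn_x \<tau>) ^ 2"
    and zz_mult: "zz 0 \<tau> * zz 1 \<tau> * (1 + 5 * fn_x \<tau>) = fn_x \<tau>"
    and zz_compl: "(1 - zz 0 \<tau> ^ 2) * (1 - zz 1 \<tau> ^ 2) * (1 + 5 * fn_x \<tau>) ^ 2 = 4 * fn_x \<tau> * (1 + 4 * fn_x \<tau>)"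
    and fn_y_zz: "fn_y \<tau> * (1 - zz 1 \<tau> ^ 2) = ss \<tau> * fn_x \<tau> * zz 1 \<tau>"
    and zz_compl_nonzero: "1 - zz 1 \<tau> ^ 2 \<noteq> 0"
proof -
  define q where "q = ee \<tau>"
  define a b c d f g where "a = eul 1 q" and "b = eul 2 q" and "c = eul 4 q"
    and "d = eul 5 q" and "f = eul 10 q" and "g = eul 20 q"
  have q: "q \<noteq> 0" "norm q < 1" using \<tau> by (simp_all add: q_def)
  have nz: "a \<noteq> 0" "b \<noteq> 0" "c \<noteq> 0" "d \<noteq> 0" "f \<noteq> 0" "g \<noteq> 0"
    using eul_nonzero[OF q(2)] by (simp_all add: a_def b_def c_def d_def f_def g_def)
  note defs = q_def [symmetric] a_def [symmetric] b_def [symmetric] c_def [symmetric]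
    d_def [symmetric] f_def [symmetric] g_def [symmetric]
  have x: "fn_x \<tau> = q * (b * f ^ 3 / (a ^ 3 * d))" and t: "fn_t \<tau> = q * (d ^ 6 / a ^ 6)"
    and y: "fn_y \<tau> = q ^ 2 * (b ^ 2 * c * d * g ^ 3 / (a ^ 5 * f ^ 2))"
    and s: "ss \<tau> = b * d ^ 2 / (a ^ 2 * f)"
    unfolding fn_eul ss_def defs by simp_all
  have z0: "zz 0 \<tau> = f ^ 5 * a ^ 2 * c ^ 2 / (d ^ 2 * g ^ 2 * b ^ 5)"
    unfolding zz_def theta_0_product[OF \<tau>] theta_0_product_5[OF \<tau>] defs using nz by (simp add: field_simps)
  have z1: "zz 1 \<tau> = q * (g ^ 2 * b / (f * c ^ 2))"
  proof -
    have "ee (5 * \<tau> / 4) = q * ee (\<tau> / 4)" by (simp add: q_def flip: ee_add)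
    thus ?thesis
      unfolding zz_def theta_1_product[OF \<tau>] theta_1_product_5[OF \<tau>] defs using nz by (simp add: field_simps)
  qed
  have u: "1 + 4 * fn_x \<tau> = b ^ 2 * d ^ 4 / (a ^ 4 * f ^ 2)"
  proof -
    have "b ^ 2 * d ^ 4 / (a ^ 4 * f ^ 2) = b ^ 2 / a ^ 4 * (d ^ 4 / f ^ 2)" by simp
    also have "\<dots> = b ^ 2 / a ^ 4 * (a ^ 4 / b ^ 2 + 4 * q * (a * f ^ 3 / (b * d)))"
      using eul_identity_10a[OF q] unfolding defs by simp
    also have "\<dots> = 1 + 4 * fn_x \<tau>"
      unfolding x using nz by (simp add: field_simps eval_nat_numeral)
    finally show ?thesis ..
  qed
  have v: "1 + 5 * fn_x \<tau> = b ^ 5 * d / (a ^ 5 * f)"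
  proof -
    have "b ^ 5 * d / (a ^ 5 * f) = b * d / (a ^ 3 * f) * (b ^ 4 / a ^ 2)"
      using nz by (simp add: field_simps eval_nat_numeral)
    also have "\<dots> = b * d / (a ^ 3 * f) * (q * (f ^ 4 / d ^ 2) + b * d ^ 3 / (a * f))"
      using eul_identity_10b[OF q] unfolding defs by simp
    also have "\<dots> = fn_x \<tau> + b ^ 2 * d ^ 4 / (a ^ 4 * f ^ 2)"
      unfolding x using nz by (simp add: field_simps eval_nat_numeral)
    finally show ?thesis unfolding u [symmetric] by simp
  qed
  have c0: "1 - zz 0 \<tau> ^ 2 = 4 * q * (a ^ 3 * c ^ 3 * d * g / b ^ 8)"
  proof -
    have "1 - zz 0 \<tau> ^ 2 = (a ^ 2 * c ^ 2 / b ^ 5) ^ 2 * ((b ^ 5 / (a ^ 2 * c ^ 2)) ^ 2 - (f ^ 5 / (d ^ 2 * g ^ 2)) ^ 2)"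
      unfolding z0 using nz by (simp add: field_simps)
    also have "\<dots> = (a ^ 2 * c ^ 2 / b ^ 5) ^ 2 * (4 * q * (b ^ 2 * d * g / (a * c)))"
      using eul_identity_theta_0[OF q] unfolding defs by simp
    also have "\<dots> = 4 * q * (a ^ 3 * c ^ 3 * d * g / b ^ 8)"
      using nz by (simp add: field_simps eval_nat_numeral)
    finally show ?thesis .
  qed
  have c1: "1 - zz 1 \<tau> ^ 2 = b * f ^ 3 / (c ^ 3 * g)"
  proof -
    have "1 - zz 1 \<tau> ^ 2 = (b / c ^ 2) ^ 2 * ((c ^ 2 / b) ^ 2 - q ^ 2 * (g ^ 2 / f) ^ 2)"
      unfolding z1 using nz by (simp add: field_simps)
    also have "\<dots> = (b / c ^ 2) ^ 2 * (c * f ^ 3 / (b * g))"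
      using eul_identity_theta_1[OF q] unfolding defs by simp
    also have "\<dots> = b * f ^ 3 / (c ^ 3 * g)"
      using nz by (simp add: field_simps eval_nat_numeral)
    finally show ?thesis .
  qed
  show "ss \<tau> ^ 2 = 1 + 4 * fn_x \<tau>"
    unfolding u s by (simp add: power_divide power_mult_distrib flip: power_mult)
  show "ss \<tau> \<noteq> 0" unfolding s using nz by simp
  show "1 + 5 * fn_x \<tau> \<noteq> 0" unfolding v using nz by simp
  show "fn_t \<tau> * (1 + 5 * fn_x \<tau>) = fn_x \<tau> * (1 + 4 * fn_x \<tau>) ^ 2"
    unfolding u v unfolding x t using nz by (simp add: field_simps eval_nat_numeral)
  show "zz 0 \<tau> * zz 1 \<tau> * (1 + 5 * fn_x \<tau>) = fn_x \<tau>"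
    unfolding v unfolding x z0 z1 using nz by (simp add: field_simps eval_nat_numeral)
  show "(1 - zz 0 \<tau> ^ 2) * (1 - zz 1 \<tau> ^ 2) * (1 + 5 * fn_x \<tau>) ^ 2 = 4 * fn_x \<tau> * (1 + 4 * fn_x \<tau>)"
    unfolding u v c0 c1 unfolding x using nz by (simp add: field_simps eval_nat_numeral)
  show "fn_y \<tau> * (1 - zz 1 \<tau> ^ 2) = ss \<tau> * fn_x \<tau> * zz 1 \<tau>"
    unfolding c1 unfolding x y s z1 using nz by (simp add: field_simps eval_nat_numeral)
  show "1 - zz 1 \<tau> ^ 2 \<noteq> 0" unfolding c1 using nz by simp
qed

lemma holomorphic_zz: "c < 2 \<Longrightarrow> zz c holomorphic_on uhp"
  unfolding zz_def [abs_def] by (intro holomorphic_intros holomorphic_theta theta_nonzero)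

lemma holomorphic_fn: "fn_x holomorphic_on uhp" "fn_t holomorphic_on uhp" "fn_y holomorphic_on uhp" "ss holomorphic_on uhp"
  unfolding fn_eul [abs_def] ss_def [abs_def]
  by (intro holomorphic_intros holomorphic_eul_ee ee_holomorphic; simp)+

lemma cusp_lim_ee_1: "cusp_lim ee 0"
  using cusp_lim_ee[of 1] by simp

lemma cusp_lim_eul_1: "n > 0 \<Longrightarrow> cusp_lim (\<lambda>\<tau>. eul n (ee \<tau>)) 1"
  using cusp_lim_eul[of n 1] by simp

lemma cusp_lim_x_over_q: "cusp_lim (\<lambda>\<tau>. fn_x \<tau> / ee \<tau>) 1"
proof -
  have "cusp_lim (\<lambda>\<tau>. eul 2 (ee \<tau>) * eul 10 (ee \<tau>) ^ 3 / (eul 1 (ee \<tau>) ^ 3 * eul 5 (ee \<tau>))) (1 * 1 ^ 3 / (1 ^ 3 * 1))"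
    by (intro cusp_lim_mult cusp_lim_divide cusp_lim_power cusp_lim_eul_1) auto
  thus ?thesis by (simp add: fn_eul)
qed

lemma cusp_lim_x: "cusp_lim fn_x 0"
proof -
  have "cusp_lim (\<lambda>\<tau>. fn_x \<tau> / ee \<tau> * ee \<tau>) (1 * 0)"
    by (intro cusp_lim_mult cusp_lim_x_over_q cusp_lim_ee_1)
  thus ?thesis by simp
qed

lemma cusp_lim_zz_0: "cusp_lim (zz 0) 1"
proof -
  have "cusp_lim (\<lambda>\<tau>. theta 0 (of_nat 5 * \<tau>) / theta 0 (of_nat 1 * \<tau>)) (1 / 1)"
    by (intro cusp_lim_divide cusp_lim_theta_0) auto
  thus ?thesis by (simp add: zz_def [abs_def])
qed

lemma zz_nonzero: "\<tau> \<in> uhp \<Longrightarrow> c < 2 \<Longrightarrow> zz c \<tau> \<noteq> 0"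
  by (simp add: zz_def theta_nonzero)

lemma cusp_lim_v: "cusp_lim (\<lambda>\<tau>. 1 + 5 * fn_x \<tau>) 1"
proof -
  have "cusp_lim (\<lambda>\<tau>. 1 + 5 * fn_x \<tau>) (1 + 5 * 0)"
    by (intro cusp_lim_add cusp_lim_mult cusp_lim_const cusp_lim_x)
  thus ?thesis by simp
qed

lemma cusp_lim_zz_1: "cusp_lim (zz 1) 0"
proof -
  have "cusp_lim (\<lambda>\<tau>. fn_x \<tau> / (zz 0 \<tau> * (1 + 5 * fn_x \<tau>))) (0 / (1 * 1))"
    by (intro cusp_lim_divide cusp_lim_mult cusp_lim_zz_0 cusp_lim_v cusp_lim_x) auto
  moreover have "zz 1 \<tau> = fn_x \<tau> / (zz 0 \<tau> * (1 + 5 * fn_x \<tau>))" if "\<tau> \<in> uhp" for \<tau>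
    using zz_mult[OF that] zz_nonzero[OF that, of 0] v_nonzero[OF that]
    by (subst nonzero_eq_divide_eq) (auto simp: mult_ac)
  ultimately show ?thesis
    using cusp_lim_cong[of "zz 1" "\<lambda>\<tau>. fn_x \<tau> / (zz 0 \<tau> * (1 + 5 * fn_x \<tau>))" 0] by simp
qed

text \<open>Expanding the second hypothesis and inserting the known product b a v yields v^2 (a^2 +
  b^2), hence the squares of v (b - a) and v (b + a).\<close>

lemma pair_from_sum_product:
  fixes a b v x :: complex
  assumes "b * a * v = x" "(1 - b ^ 2) * (1 - a ^ 2) * v ^ 2 = 4 * x * (1 + 4 * x)" "v = 1 + 5 * x"
  shows "(v * (b - a)) ^ 2 = 1 + 4 * x" "(v * (b + a)) ^ 2 = 1 + 8 * x + 20 * x ^ 2"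
proof -
  have "(1 - b ^ 2) * (1 - a ^ 2) * v ^ 2 = v ^ 2 - v ^ 2 * (b ^ 2 + a ^ 2) + (b * a * v) ^ 2" by algebra
  hence S: "v ^ 2 * (b ^ 2 + a ^ 2) = v ^ 2 + x ^ 2 - 4 * x * (1 + 4 * x)"
    unfolding assms(1,2) by algebra
  have "(v * (b - a)) ^ 2 = v ^ 2 * (b ^ 2 + a ^ 2) - 2 * v * (b * a * v)" by algebra
  thus "(v * (b - a)) ^ 2 = 1 + 4 * x" unfolding S assms(1) unfolding assms(3) by algebra
  have "(v * (b + a)) ^ 2 = v ^ 2 * (b ^ 2 + a ^ 2) + 2 * v * (b * a * v)" by algebra
  thus "(v * (b + a)) ^ 2 = 1 + 8 * x + 20 * x ^ 2" unfolding S assms(1) unfolding assms(3) by algebra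
qed

text \<open>With v (b - a) = \<open>ss\<close> and v (b + a) = \<open>dd\<close> this is
  \<open>dd_ss\<close> multiplied by 1 - a^2, the factor that \<open>fn_y_zz\<close> needs. The
  quadratic equation satisfied by a^2 eliminates a^4.\<close>

lemma pair_quadratic:
  fixes a b v x :: complex
  assumes "b * a * v = x" "(1 - b ^ 2) * (1 - a ^ 2) * v ^ 2 = 4 * x * (1 + 4 * x)" "v = 1 + 5 * x"
  shows "(v * (b - a)) * (v * (b + a)) * (1 - a ^ 2) = 8 * ((v * (b - a)) * x * a) + (1 + 6 * x) * (1 - a ^ 2)"
proof -
  have "(v * (b + a)) ^ 2 = v ^ 2 * (b ^ 2 + a ^ 2) + 2 * v * (b * a * v)" by algebra
  hence S: "v ^ 2 * (b ^ 2 + a ^ 2) = 1 + 6 * x + 10 * x ^ 2"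
    unfolding pair_from_sum_product(2)[OF assms] assms(1) unfolding assms(3) by algebra
  have "v ^ 2 * a ^ 4 = v ^ 2 * (b ^ 2 + a ^ 2) * a ^ 2 - (b * a * v) ^ 2" by algebra
  hence H2: "v ^ 2 * a ^ 4 = (1 + 6 * x + 10 * x ^ 2) * a ^ 2 - x ^ 2" unfolding S assms(1) .
  have H3: "(v * (b - a)) * x * a = x * (b * a * v) - v * a ^ 2 * x" by algebra
  have "(v * (b - a)) * (v * (b + a)) * (1 - a ^ 2) =
      (v ^ 2 * (b ^ 2 + a ^ 2)) * (1 - a ^ 2) - 2 * v ^ 2 * a ^ 2 + 2 * (v ^ 2 * a ^ 4)" by algebra
  also have "\<dots> = 8 * (x * x - v * a ^ 2 * x) + (1 + 6 * x) * (1 - a ^ 2)"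
    unfolding S H2 unfolding assms(3) by algebra
  finally show ?thesis unfolding H3 assms(1) .
qed

lemma zz_diff:
  assumes \<tau>: "\<tau> \<in> uhp"
  shows "(1 + 5 * fn_x \<tau>) * (zz 0 \<tau> - zz 1 \<tau>) = ss \<tau>"
proof (rule equal_squares_on_uhp[OF _ _ _ _ \<tau>])
  show "continuous_on uhp (\<lambda>\<tau>. (1 + 5 * fn_x \<tau>) * (zz 0 \<tau> - zz 1 \<tau>))"
    by (intro continuous_intros holomorphic_on_imp_continuous_on holomorphic_fn holomorphic_zz) auto
  show "ss holomorphic_on uhp" by (rule holomorphic_fn)
  show "((1 + 5 * fn_x \<tau>) * (zz 0 \<tau> - zz 1 \<tau>)) ^ 2 = ss \<tau> ^ 2" if "\<tau> \<in> uhp" for \<tau>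
    unfolding ss_square[OF that] by (rule pair_from_sum_product[OF zz_mult[OF that] zz_compl[OF that] refl])
  have "cusp_lim (\<lambda>\<tau>. (1 + 5 * fn_x \<tau>) * (zz 0 \<tau> - zz 1 \<tau>) /
      (eul 2 (ee \<tau>) * eul 5 (ee \<tau>) ^ 2 / (eul 1 (ee \<tau>) ^ 2 * eul 10 (ee \<tau>)))) (1 * (1 - 0) / (1 * 1 ^ 2 / (1 ^ 2 * 1)))"
    by (intro cusp_lim_divide cusp_lim_mult cusp_lim_diff cusp_lim_zz_0 cusp_lim_zz_1 cusp_lim_v cusp_lim_power cusp_lim_eul_1) auto
  thus "cusp_lim (\<lambda>\<tau>. (1 + 5 * fn_x \<tau>) * (zz 0 \<tau> - zz 1 \<tau>) / ss \<tau>) 1"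
    by (simp add: ss_def)
qed

text \<open>A square root of 1 + 8 x + 20 x^2, holomorphic because it is built from the theta
  quotients.\<close>

definition dd :: "complex \<Rightarrow> complex" where
  "dd \<tau> = (1 + 5 * fn_x \<tau>) * (zz 0 \<tau> + zz 1 \<tau>)"

lemma dd_square:
  assumes "\<tau> \<in> uhp"
  shows "dd \<tau> ^ 2 = 1 + 8 * fn_x \<tau> + 20 * fn_x \<tau> ^ 2"
  unfolding dd_def by (rule pair_from_sum_product[OF zz_mult[OF assms] zz_compl[OF assms] refl])

lemma dd_ss:
  assumes \<tau>: "\<tau> \<in> uhp"
  shows "ss \<tau> * dd \<tau> = 8 * fn_y \<tau> + 1 + 6 * fn_x \<tau>"
proof -
  have "(ss \<tau> * dd \<tau>) * (1 - zz 1 \<tau> ^ 2) = (8 * fn_y \<tau> + 1 + 6 * fn_x \<tau>) * (1 - zz 1 \<tau> ^ 2)"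
    using pair_quadratic[OF zz_mult[OF \<tau>] zz_compl[OF \<tau>] refl] fn_y_zz[OF \<tau>]
    unfolding dd_def zz_diff[OF \<tau>] by algebra
  thus ?thesis using zz_compl_nonzero[OF \<tau>] by (simp only: mult_cancel_right simp_thms)
qed

definition WW :: "complex \<Rightarrow> complex" where
  "WW \<tau> = 1 / rr \<tau> ^ 5 + rr \<tau> ^ 5"

lemma rr_t: "\<tau> \<in> uhp \<Longrightarrow> 1 / rr \<tau> ^ 5 - 11 - rr \<tau> ^ 5 = 1 / fn_t \<tau>"
  by (simp add: rr_t_relation fn_t_eta)

lemma WW_square:
  assumes \<tau>: "\<tau> \<in> uhp"
  shows "WW \<tau> ^ 2 = (1 / fn_t \<tau> + 11) ^ 2 + 4"
proof -
  have "1 / fn_t \<tau> + 11 = 1 / rr \<tau> ^ 5 - rr \<tau> ^ 5" using rr_t[OF \<tau>] by algebra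
  moreover have "1 / rr \<tau> ^ 5 * rr \<tau> ^ 5 = 1" using rr_nonzero[OF \<tau>] by simp
  ultimately show ?thesis unfolding WW_def by algebra
qed

lemma cusp_lim_q_WW: "cusp_lim (\<lambda>\<tau>. WW \<tau> * ee \<tau>) 1"
proof -
  let ?R = "\<lambda>\<tau>. (rr \<tau> / ee (\<tau> / 5)) ^ 5"
  have "cusp_lim (\<lambda>\<tau>. 1 / ?R \<tau> + ?R \<tau> * ee \<tau> ^ 2) (1 / 1 ^ 5 + 1 ^ 5 * 0 ^ 2)"
    by (intro cusp_lim_divide cusp_lim_mult cusp_lim_add cusp_lim_power cusp_lim_const cusp_lim_rr cusp_lim_ee_1) auto
  moreover have "1 / ?R \<tau> + ?R \<tau> * ee \<tau> ^ 2 = WW \<tau> * ee \<tau>" for \<tau>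
  proof -
    have "ee (\<tau> / 5) ^ 5 = ee \<tau>" by (simp add: ee_power)
    thus ?thesis by (simp add: WW_def power_divide field_simps power2_eq_square)
  qed
  ultimately show ?thesis by simp
qed

lemma u_nonzero: "\<tau> \<in> uhp \<Longrightarrow> 1 + 4 * fn_x \<tau> \<noteq> 0"
  using ss_square[of \<tau>] ss_nonzero[of \<tau>] by auto

text \<open>Substituting t = x (1 + 4 x)^2 / (1 + 5 x) into (1/t + 11)^2 + 4 gives the square of
  this expression. Since \<open>WW\<close> is so far only continuous, equality with
  \<open>WWx\<close> also provides its holomorphy.\<close>

definition WWx :: "complex \<Rightarrow> complex" where
  "WWx \<tau> = dd \<tau> * (1 + 12 * fn_x \<tau> + 40 * fn_x \<tau> ^ 2) / (fn_x \<tau> * (1 + 4 * fn_x \<tau>) ^ 2)"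

lemma holomorphic_WWx: "WWx holomorphic_on uhp"
  unfolding WWx_def [abs_def] dd_def
  by (intro holomorphic_intros holomorphic_fn holomorphic_zz) (use u_nonzero fn_nonzero in auto)

lemma cusp_lim_q_WWx: "cusp_lim (\<lambda>\<tau>. WWx \<tau> * ee \<tau>) 1"
proof -
  have "cusp_lim (\<lambda>\<tau>. (1 + 5 * fn_x \<tau>) * (zz 0 \<tau> + zz 1 \<tau>) * (1 + 12 * fn_x \<tau> + 40 * fn_x \<tau> ^ 2) /
     (fn_x \<tau> / ee \<tau> * (1 + 4 * fn_x \<tau>) ^ 2)) (1 * (1 + 0) * (1 + 12 * 0 + 40 * 0 ^ 2) / (1 * (1 + 4 * 0) ^ 2))"
    by (intro cusp_lim_mult cusp_lim_divide cusp_lim_add cusp_lim_power cusp_lim_const cusp_lim_v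
        cusp_lim_x cusp_lim_zz_0 cusp_lim_zz_1 cusp_lim_x_over_q) auto
  moreover have "A / (x / e * u) = A / (x * u) * e" for A x e u :: complex by simp
  ultimately show ?thesis by (simp add: WWx_def dd_def)
qed

lemma WW_eq_WWx:
  assumes \<tau>: "\<tau> \<in> uhp"
  shows "WW \<tau> = WWx \<tau>"
proof (rule equal_squares_on_uhp[OF _ holomorphic_WWx _ _ \<tau>])
  show "continuous_on uhp WW"
    unfolding WW_def [abs_def] by (intro continuous_intros continuous_rr) (auto simp: rr_nonzero)
  show "WW \<tau> ^ 2 = WWx \<tau> ^ 2" if \<tau>: "\<tau> \<in> uhp" for \<tau>
  proof -
    define x where "x = fn_x \<tau>"
    have nz: "x \<noteq> 0" "1 + 4 * x \<noteq> 0" "1 + 5 * x \<noteq> 0"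
      using fn_nonzero[OF \<tau>] u_nonzero[OF \<tau>] v_nonzero[OF \<tau>] by (simp_all add: x_def)
    have T: "1 / fn_t \<tau> = (1 + 5 * x) / (x * (1 + 4 * x) ^ 2)"
      using t_eq_x[OF \<tau>] fn_nonzero[OF \<tau>] nz by (simp add: x_def frac_eq_eq mult.commute)
    have "WWx \<tau> ^ 2 = (1 + 8 * x + 20 * x ^ 2) * (1 + 12 * x + 40 * x ^ 2) ^ 2 / (x * (1 + 4 * x) ^ 2) ^ 2"
      unfolding WWx_def power_divide power_mult_distrib[of "dd \<tau>"] dd_square[OF \<tau>] x_def ..
    also have "(1 + 8 * x + 20 * x ^ 2) * (1 + 12 * x + 40 * x ^ 2) ^ 2 =
        (1 + 5 * x + 11 * (x * (1 + 4 * x) ^ 2)) ^ 2 + 4 * (x * (1 + 4 * x) ^ 2) ^ 2" by algebra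
    also have "\<dots> / (x * (1 + 4 * x) ^ 2) ^ 2 = ((1 + 5 * x) / (x * (1 + 4 * x) ^ 2) + 11) ^ 2 + 4"
    proof -
      have "(V + 11 * U) ^ 2 + 4 * U ^ 2 = ((V / U + 11) ^ 2 + 4) * U ^ 2" if "U \<noteq> 0" for U V :: complex
      proof -
        have "V = V / U * U" using that by simp
        thus ?thesis by algebra
      qed
      thus ?thesis using nz by simp
    qed
    finally show ?thesis unfolding WW_square[OF \<tau>] T ..
  qed
  have "cusp_lim (\<lambda>\<tau>. (WW \<tau> * ee \<tau>) / (WWx \<tau> * ee \<tau>)) (1 / 1)"
    by (intro cusp_lim_divide cusp_lim_q_WW cusp_lim_q_WWx) auto
  thus "cusp_lim (\<lambda>\<tau>. WW \<tau> / WWx \<tau>) 1" by simp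
qed

section \<open>Values at \<tau> / 5 in terms of v = 1/r - r\<close>

lemma cusp_lim_div_5: "cusp_lim f L \<Longrightarrow> cusp_lim (\<lambda>\<tau>. f (\<tau> / 5)) L"
proof -
  assume "cusp_lim f L"
  moreover have "filterlim (\<lambda>y::real. y / 5) at_top at_top" by real_asymp
  ultimately have "((\<lambda>y::real. f (\<i> * of_real (y / 5))) \<longlongrightarrow> L) at_top"
    unfolding cusp_lim_def by (rule filterlim_compose)
  thus ?thesis by (simp add: cusp_lim_def)
qed

text \<open>\<open>npol\<close> satisfies \<open>(v^2 + 4) npol^2 = (v - 1)^10 + 22 (v - 1)^5 mpol + 125 mpol^2\<close>.\<close>

definition mpol :: "complex \<Rightarrow> complex" where "mpol v = v^4 + v^3 + 6 * v^2 + 6 * v + 11"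
definition npol :: "complex \<Rightarrow> complex" where "npol v = v^4 + 6 * v^3 + 21 * v^2 + 36 * v + 61"

definition vv :: "complex \<Rightarrow> complex" where "vv r = 1 / r - r"

lemma vv_quintic: "r \<noteq> 0 \<Longrightarrow> vv r ^ 5 + 5 * vv r ^ 3 + 5 * vv r = 1 / r ^ 5 - r ^ 5"
proof -
  assume "r \<noteq> 0"
  define s where "s = 1 / r"
  have "s * r = 1" using \<open>r \<noteq> 0\<close> by (simp add: s_def)
  hence "(s - r) ^ 5 + 5 * (s - r) ^ 3 + 5 * (s - r) = s ^ 5 - r ^ 5" by algebra
  thus ?thesis by (simp add: s_def vv_def power_divide)
qed

text \<open>1/t = r^-5 - 11 - r^5 is a quintic in v that vanishes at v = 1, and \<open>mpol\<close>
  is the cofactor of v - 1. As v - 1 is also eta (\<tau> / 5) / eta (5 \<tau>), its sixth power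
  converts t at \<tau> into t at \<tau> / 5.\<close>

lemma inverse_t_fifth:
  assumes \<tau>: "\<tau> \<in> uhp"
  shows "1 / fn_t \<tau> = (vv (rr \<tau>) - 1) * mpol (vv (rr \<tau>))" (is ?A)
    and "fn_t (\<tau> / 5) = mpol (vv (rr \<tau>)) ^ 6 * fn_t \<tau> ^ 5" (is ?B)
    and "1 / fn_t (\<tau> / 5) = (vv (rr \<tau>) - 1) ^ 6 * fn_t \<tau>" (is ?C)
proof -
  define v where "v = vv (rr \<tau>)"
  have "1 / rr \<tau> ^ 5 - rr \<tau> ^ 5 = v ^ 5 + 5 * v ^ 3 + 5 * v"
    using vv_quintic[OF rr_nonzero[OF \<tau>]] by (simp add: v_def)
  hence A: "1 / fn_t \<tau> = (v - 1) * mpol v"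
    unfolding rr_t[OF \<tau>, symmetric] mpol_def by algebra
  thus ?A by (simp add: v_def)
  have t: "fn_t \<tau> \<noteq> 0" using fn_nonzero[OF \<tau>] by simp
  have nz: "v - 1 \<noteq> 0" "mpol v \<noteq> 0" using A t by auto
  have e: "eta (\<tau> / 5) = eta (5 * \<tau>) * (v - 1)"
    using eta_fifth_rr[OF \<tau>] by (simp add: v_def vv_def algebra_simps)
  have "fn_t (\<tau> / 5) = eta \<tau> ^ 6 / eta (\<tau> / 5) ^ 6"
    using fn_t_eta[of "\<tau> / 5"] \<tau> by simp
  also have "\<dots> = (eta \<tau> ^ 6 / eta (5 * \<tau>) ^ 6) / (v - 1) ^ 6"
    unfolding e power_mult_distrib by simp
  also have "eta \<tau> ^ 6 / eta (5 * \<tau>) ^ 6 = 1 / fn_t \<tau>"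
    using fn_t_eta[OF \<tau>] by simp
  finally have D: "fn_t (\<tau> / 5) = 1 / fn_t \<tau> / (v - 1) ^ 6" .
  thus ?C using t nz by (simp add: v_def)
  have v1: "v - 1 = 1 / (fn_t \<tau> * mpol v)"
    using A t nz by (simp add: field_simps)
  have "1 / s / (1 / (s * m)) ^ 6 = m ^ 6 * s ^ 5" if "s \<noteq> 0" "m \<noteq> 0" for s m :: complex
    using that by (simp add: field_simps eval_nat_numeral)
  thus ?B using t nz unfolding v_def [symmetric] D v1 by blast
qed

text \<open>Both sides square to the same value: the left through \<open>WW_square\<close> at \<tau>
  / 5, the right because (r + 1/r)^2 = v^2 + 4 and \<open>npol\<close> satisfies its defining
  identity. The common leading term q^(-1/5) decides the sign.\<close>

lemma WW_fifth:
  assumes \<tau>: "\<tau> \<in> uhp"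
  shows "WW (\<tau> / 5) = (rr \<tau> + 1 / rr \<tau>) * npol (vv (rr \<tau>)) * (vv (rr \<tau>) - 1) * fn_t \<tau>"
proof -
  define f where "f = (\<lambda>\<tau>. (rr \<tau> + 1 / rr \<tau>) * npol (vv (rr \<tau>)) * (vv (rr \<tau>) - 1) * fn_t \<tau>)"
  have "f \<tau> = WWx (\<tau> / 5)"
  proof (rule equal_squares_on_uhp[OF _ _ _ _ \<tau>])
    show "continuous_on uhp f"
      unfolding f_def npol_def vv_def
      by (intro continuous_intros continuous_rr holomorphic_on_imp_continuous_on holomorphic_fn) (auto simp: rr_nonzero)
    show "(\<lambda>\<tau>. WWx (\<tau> / 5)) holomorphic_on uhp"
      by (rule holomorphic_on_compose_gen[OF _ holomorphic_WWx, unfolded o_def]) (auto intro!: holomorphic_intros)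
    show "f \<tau> ^ 2 = WWx (\<tau> / 5) ^ 2" if \<tau>: "\<tau> \<in> uhp" for \<tau>
    proof -
      define v where "v = vv (rr \<tau>)"
      define T where "T = 1 / fn_t \<tau>"
      have t: "fn_t \<tau> \<noteq> 0" using fn_nonzero[OF \<tau>] by simp
      have "(rr \<tau> + 1 / rr \<tau>) ^ 2 = v ^ 2 + 4"
      proof -
        define r where "r = rr \<tau>"
        define s where "s = 1 / r"
        have "s * r = 1" using rr_nonzero[OF \<tau>] by (simp add: s_def r_def)
        hence "(r + s) ^ 2 = (s - r) ^ 2 + 4" by algebra
        thus ?thesis by (simp add: v_def vv_def s_def r_def)
      qed
      hence "f \<tau> ^ 2 = (v ^ 2 + 4) * npol v ^ 2 * (v - 1) ^ 2 * fn_t \<tau> ^ 2"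
        unfolding f_def power_mult_distrib v_def by simp
      moreover have "WWx (\<tau> / 5) ^ 2 = ((v - 1) ^ 6 * fn_t \<tau> + 11) ^ 2 + 4"
        using WW_eq_WWx[of "\<tau> / 5"] WW_square[of "\<tau> / 5"] inverse_t_fifth(3)[OF \<tau>] \<tau> by (simp add: v_def)
      moreover have "(v ^ 2 + 4) * npol v ^ 2 = (v - 1) ^ 10 + 22 * (v - 1) ^ 5 * mpol v + 125 * mpol v ^ 2"
        unfolding npol_def mpol_def by algebra
      moreover have "1 = (v - 1) * mpol v * fn_t \<tau>"
        using inverse_t_fifth(1)[OF \<tau>] t by (simp add: v_def field_simps)
      moreover have "((v - 1) ^ 10 + 22 * (v - 1) ^ 5 * m + 125 * m ^ 2) * (v - 1) ^ 2 * s ^ 2 =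
          ((v - 1) ^ 6 * s + 11) ^ 2 + 4" if "1 = (v - 1) * m * s" for m s
        using that by algebra
      ultimately show ?thesis by simp
    qed
    define R where "R = (\<lambda>\<tau>. rr \<tau> / ee (\<tau> / 5))"
    have R: "cusp_lim R 1" unfolding R_def by (rule cusp_lim_rr)
    have ee5: "cusp_lim (\<lambda>\<tau>. ee (\<tau> / 5)) 0"
      using cusp_lim_ee[of "1 / 5"] by simp
    have "cusp_lim (\<lambda>\<tau>. R \<tau> * ee (\<tau> / 5)) (1 * 0)"
      by (intro cusp_lim_mult R ee5)
    hence r0: "cusp_lim rr 0" by (simp add: R_def)
    have t0: "cusp_lim (\<lambda>\<tau>. 1 - 11 * rr \<tau> ^ 5 - rr \<tau> ^ 10) (1 - 11 * 0 ^ 5 - 0 ^ 10)"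
      by (intro cusp_lim_diff cusp_lim_mult cusp_lim_power cusp_lim_const r0)
    \<comment> \<open>M (r) is (r + 1/r) npol (v) (v - 1) multiplied by r^6, a polynomial with M (0)
      = 1; hence the limit can be taken at r = 0.\<close>
    define M where "M = (\<lambda>r::complex. (1 + r ^ 2) * ((1 - r^2)^4 + 6*r*(1-r^2)^3 + 21*r^2*(1-r^2)^2 + 36*r^3*(1-r^2) + 61*r^4) * (1 - r^2 - r))"
    have "cusp_lim (\<lambda>\<tau>. M (rr \<tau>)) (M 0)"
      unfolding M_def
      by (intro cusp_lim_diff cusp_lim_mult cusp_lim_add cusp_lim_power cusp_lim_const r0)
    moreover have "cusp_lim (\<lambda>\<tau>. WWx (\<tau> / 5) * ee (\<tau> / 5)) 1"
      using cusp_lim_div_5[OF cusp_lim_q_WWx] .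
    ultimately have "cusp_lim (\<lambda>\<tau>. (M (rr \<tau>) / (1 - 11 * rr \<tau> ^ 5 - rr \<tau> ^ 10)) / (WWx (\<tau> / 5) * ee (\<tau> / 5) * R \<tau>))
        ((M 0 / (1 - 11 * 0 ^ 5 - 0 ^ 10)) / (1 * 1))"
      using t0 R by (intro cusp_lim_divide cusp_lim_mult) auto
    moreover have "(M (rr \<tau>) / (1 - 11 * rr \<tau> ^ 5 - rr \<tau> ^ 10)) / (WWx (\<tau> / 5) * ee (\<tau> / 5) * R \<tau>) = f \<tau> / WWx (\<tau> / 5)"
      if \<tau>: "\<tau> \<in> uhp" for \<tau>
    proof -
      define r where "r = rr \<tau>"
      define s where "s = 1 / r"
      have r: "r \<noteq> 0" using rr_nonzero[OF \<tau>] by (simp add: r_def)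
      have sr: "s * r = 1" using r by (simp add: s_def)
      have t: "fn_t \<tau> \<noteq> 0" using fn_nonzero[OF \<tau>] by simp
      have "1 / fn_t \<tau> = (1 - 11 * r ^ 5 - r ^ 10) / r ^ 5"
        using rr_t[OF \<tau>] r by (simp add: r_def field_simps flip: power_add)
      hence t': "fn_t \<tau> = r ^ 5 / (1 - 11 * r ^ 5 - r ^ 10)"
        by (metis divide_divide_eq_right div_by_1 mult_1)
      have "M r = ((r + s) * npol (s - r) * (s - r - 1)) * r ^ 5 * r"
        using sr unfolding M_def npol_def by algebra
      hence "M r / (1 - 11 * r ^ 5 - r ^ 10) = f \<tau> * r"
        unfolding f_def t' by (simp add: r_def [symmetric] s_def vv_def)
      thus ?thesis using r by (simp add: R_def r_def [symmetric])
    qed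
    ultimately show "cusp_lim (\<lambda>\<tau>. f \<tau> / WWx (\<tau> / 5)) 1"
      using cusp_lim_cong[of "\<lambda>\<tau>. (M (rr \<tau>) / (1 - 11 * rr \<tau> ^ 5 - rr \<tau> ^ 10)) / (WWx (\<tau> / 5) * ee (\<tau> / 5) * R \<tau>)"
         "\<lambda>\<tau>. f \<tau> / WWx (\<tau> / 5)" 1] by (simp add: M_def)
  qed
  thus ?thesis using WW_eq_WWx[of "\<tau> / 5"] \<tau> by (simp add: f_def)
qed

text \<open>Multiplication by 2 (1 + 5 x)^2 and the relation between t and x collapse the long
  polynomials to short expressions. Changing \<beta> just replaces Y by -Y, in p0 as well as in
  p1.\<close>

lemma fn_p_formulas:
  fixes t x y Y :: complex
  assumes t: "t * (1 + 5 * x) = x * (1 + 4 * x) ^ 2" and y: "Y = 8 * y + 1 + 6 * x"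
  defines "k \<equiv> 1 + 12 * x + 40 * x ^ 2" and "D \<equiv> 1 + 8 * x + 20 * x ^ 2"
  shows "2 * (1 + 5 * x) ^ 2 * (85*t + 625*t^2 - 24*x - 64*x^2 - 4*y - 1000*t*y - 12500*t^2*y
       + 992*x*y + 12000*t*x*y + 3520*x^2*y + 40000*t*x^2*y) =
      2 * (1 + 5 * x) ^ 2 * (1 + 70 * t + 625 * t ^ 2) - k * (D + Y)"
    and "2 * (1 + 5 * x) ^ 2 * (1 + 5*t + 64*x + 600*t*x + 208*x^2 + 2000*t*x^2 + 4*y + 1000*t*y + 12500*t^2*y
       - 992*x*y - 12000*t*x*y - 3520*x^2*y - 40000*t*x^2*y) =
      2 * (1 + 5 * x) ^ 2 * (1 + 70 * t + 625 * t ^ 2) - k * (D - Y)"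
    and "2 * (1 + 5 * x) ^ 2 * (t + 25*t^2 - 8*t*x - 4*y - 8*t*y - 500*t^2*y
       - 32*x*y + 480*t*x*y - 64*x^2*y + 1600*t*x^2*y) = (1 + 4 * x) ^ 2 * k * (D - Y)"
    and "2 * (1 + 5 * x) ^ 2 * (1 + 9*t + 8*x + 64*t*x + 16*x^2 + 80*t*x^2 + 4*y + 8*t*y + 500*t^2*y
       + 32*x*y - 480*t*x*y + 64*x^2*y - 1600*t*x^2*y) = (1 + 4 * x) ^ 2 * k * (D + Y)"
  using t unfolding y k_def D_def by algebra+

text \<open>With D = v^2 (a + b)^2 and Y = v^2 (b^2 - a^2) the sums D + Y and D - Y factor as 2 v^2
  (a + b) b and 2 v^2 (a + b) a, and (a + b) k is t W. So the sign of Y decides which theta quotient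
  appears.\<close>

lemma fn_p_theta:
  assumes \<tau>: "\<tau> \<in> uhp" and \<beta>: "\<beta> \<in> {0, 1}"
  shows "fn_p0 \<beta> \<tau> = 1 + 70 * fn_t \<tau> + 625 * fn_t \<tau> ^ 2 - fn_t \<tau> * (WW \<tau> * zz (1 - \<beta>) \<tau>)"
    and "fn_p1 \<beta> \<tau> = fn_t \<tau> ^ 2 * (WW \<tau> / zz (1 - \<beta>) \<tau>)"
proof -
  define x y t a b k v where "x = fn_x \<tau>" and "y = fn_y \<tau>" and "t = fn_t \<tau>"
    and "a = zz 1 \<tau>" and "b = zz 0 \<tau>" and "k = 1 + 12 * x + 40 * x ^ 2" and "v = 1 + 5 * x"
  define Y where "Y = 8 * y + 1 + 6 * x"
  have nz: "x \<noteq> 0" "1 + 4 * x \<noteq> 0" "v \<noteq> 0" "a \<noteq> 0" "b \<noteq> 0" "t \<noteq> 0"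
    using fn_nonzero[OF \<tau>] u_nonzero[OF \<tau>] v_nonzero[OF \<tau>] zz_nonzero[OF \<tau>]
    by (simp_all add: x_def v_def a_def b_def t_def)
  have tv: "t * (1 + 5 * x) = x * (1 + 4 * x) ^ 2"
    using t_eq_x[OF \<tau>] by (simp add: x_def t_def)
  have abv: "b * a * v = x" using zz_mult[OF \<tau>] by (simp add: a_def b_def x_def v_def)
  have D: "1 + 8 * x + 20 * x ^ 2 = v ^ 2 * (a + b) ^ 2"
    using dd_square[OF \<tau>] unfolding dd_def by (simp add: x_def v_def a_def b_def power_mult_distrib add.commute)
  have "Y = v * (b - a) * (v * (b + a))"
    using dd_ss[OF \<tau>] unfolding dd_def zz_diff[OF \<tau>, symmetric]
    by (simp add: Y_def x_def y_def v_def a_def b_def)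
  hence Y: "Y = v ^ 2 * (b ^ 2 - a ^ 2)" by algebra
  have tW: "t * WW \<tau> = (a + b) * k"
  proof -
    have "WW \<tau> = v * (a + b) * k / (x * (1 + 4 * x) ^ 2)"
      using WW_eq_WWx[OF \<tau>] unfolding WWx_def dd_def by (simp add: x_def v_def a_def b_def k_def add.commute)
    hence "t * WW \<tau> = t * v * ((a + b) * k) / (x * (1 + 4 * x) ^ 2)" by (simp add: mult_ac)
    also have "t * v = x * (1 + 4 * x) ^ 2" using tv by (simp add: v_def)
    finally show ?thesis using nz by simp
  qed
  have DY: "1 + 8 * x + 20 * x ^ 2 + Y = 2 * v ^ 2 * ((a + b) * b)"
    "1 + 8 * x + 20 * x ^ 2 - Y = 2 * v ^ 2 * ((a + b) * a)"
    unfolding D Y by algebra+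
  have v2: "2 * v ^ 2 \<noteq> 0" using nz by simp
  have cancel: "P = Q" if "2 * v ^ 2 * P = 2 * v ^ 2 * Q" for P Q
    using that v2 by (simp only: mult_cancel_left simp_thms)
  note F = fn_p_formulas[OF tv Y_def, folded k_def v_def, unfolded DY]
  \<comment> \<open>As b a v = x, the relation between t and x says t = (1 + 4 x)^2 a b; dividing by
    one of a, b leaves the other.\<close>
  have bb: "t * (t * WW \<tau> / b) = (1 + 4 * x) ^ 2 * k * ((a + b) * a)"
    and aa: "t * (t * WW \<tau> / a) = (1 + 4 * x) ^ 2 * k * ((a + b) * b)"
  proof -
    have "t * (b * a * v) = x * (1 + 4 * x) ^ 2 * (a * b)" using tv unfolding v_def by algebra
    hence "t = (1 + 4 * x) ^ 2 * (a * b)" unfolding abv using nz(1) by simp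
    thus "t * (t * WW \<tau> / b) = (1 + 4 * x) ^ 2 * k * ((a + b) * a)"
      "t * (t * WW \<tau> / a) = (1 + 4 * x) ^ 2 * k * ((a + b) * b)"
      unfolding tW using nz by (simp_all add: mult_ac)
  qed
  consider "\<beta> = 1" | "\<beta> = 0" using \<beta> by auto
  thus "fn_p0 \<beta> \<tau> = 1 + 70 * fn_t \<tau> + 625 * fn_t \<tau> ^ 2 - fn_t \<tau> * (WW \<tau> * zz (1 - \<beta>) \<tau>)"
  proof cases
    case 1
    have "fn_p0 \<beta> \<tau> = 1 + 70 * t + 625 * t ^ 2 - k * ((a + b) * b)"
      unfolding fn_p0_def Let_def x_def [symmetric] y_def [symmetric] t_def [symmetric] if_P[OF 1]
      by (rule cancel, unfold F(1)) algebra
    thus ?thesis using tW 1 by (simp add: t_def b_def mult_ac)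
  next
    case 2
    have "fn_p0 \<beta> \<tau> = 1 + 70 * t + 625 * t ^ 2 - k * ((a + b) * a)"
      unfolding fn_p0_def Let_def x_def [symmetric] y_def [symmetric] t_def [symmetric] 2 if_not_P[OF zero_neq_one]
      by (rule cancel, unfold F(2)) algebra
    thus ?thesis using tW 2 by (simp add: t_def a_def mult_ac)
  qed
  show "fn_p1 \<beta> \<tau> = fn_t \<tau> ^ 2 * (WW \<tau> / zz (1 - \<beta>) \<tau>)"
    using \<open>\<beta> \<in> {0, 1}\<close>
  proof (elim insertE emptyE)
    assume 1: "\<beta> = 1"
    have "fn_p1 \<beta> \<tau> = (1 + 4 * x) ^ 2 * k * ((a + b) * a)"
      unfolding fn_p1_def Let_def x_def [symmetric] y_def [symmetric] t_def [symmetric] if_P[OF 1]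
      by (rule cancel, unfold F(3)) algebra
    thus ?thesis using bb 1 by (simp add: t_def b_def power2_eq_square mult_ac)
  next
    assume 2: "\<beta> = 0"
    have "fn_p1 \<beta> \<tau> = (1 + 4 * x) ^ 2 * k * ((a + b) * b)"
      unfolding fn_p1_def Let_def x_def [symmetric] y_def [symmetric] t_def [symmetric] 2 if_not_P[OF zero_neq_one]
      by (rule cancel, unfold F(4)) algebra
    thus ?thesis using aa 2 by (simp add: t_def a_def power2_eq_square mult_ac)
  qed
qed

text \<open>Laurent polynomials, as functions off 0; the value at 0 is left open since t has no
  zeros in \<open>uhp\<close>.\<close>

definition laur :: "(complex \<Rightarrow> complex) \<Rightarrow> bool" where
  "laur A \<longleftrightarrow> (\<exists>P n. \<forall>t. t \<noteq> 0 \<longrightarrow> A t = poly P t / t ^ n)"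

lemma laurI: "(\<And>t. t \<noteq> 0 \<Longrightarrow> A t = poly P t / t ^ n) \<Longrightarrow> laur A"
  unfolding laur_def by blast

lemma laur_const: "laur (\<lambda>_. c)"
  by (rule laurI[of _ "[:c:]" 0]) simp

lemma laur_id: "laur (\<lambda>t. t)"
  by (rule laurI[of _ "[:0, 1:]" 0]) simp

lemma laur_inverse: "laur (\<lambda>t. 1 / t)"
  by (rule laurI[of _ 1 1]) simp

lemma laur_add:
  assumes "laur A" "laur B"
  shows "laur (\<lambda>t. A t + B t)"
proof -
  obtain P m Q n where A: "\<And>t. t \<noteq> 0 \<Longrightarrow> A t = poly P t / t ^ m" and B: "\<And>t. t \<noteq> 0 \<Longrightarrow> B t = poly Q t / t ^ n"
    using assms unfolding laur_def by metis
  show ?thesis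
    by (rule laurI[of _ "P * monom 1 n + Q * monom 1 m" "m + n"])
       (simp add: A B poly_monom field_simps power_add)
qed

lemma laur_mult:
  assumes "laur A" "laur B"
  shows "laur (\<lambda>t. A t * B t)"
proof -
  obtain P m Q n where A: "\<And>t. t \<noteq> 0 \<Longrightarrow> A t = poly P t / t ^ m" and B: "\<And>t. t \<noteq> 0 \<Longrightarrow> B t = poly Q t / t ^ n"
    using assms unfolding laur_def by metis
  show ?thesis
    by (rule laurI[of _ "P * Q" "m + n"]) (simp add: A B power_add)
qed

lemma laur_power: "laur A \<Longrightarrow> laur (\<lambda>t. A t ^ n)"
proof (induction n)
  case 0
  show ?case using laur_const[of 1] by simp
next
  case (Suc n)
  show ?case unfolding power_Suc by (rule laur_mult[OF Suc.prems Suc.IH[OF Suc.prems]])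
qed

lemma laur_poly_compose: "laur A \<Longrightarrow> laur (\<lambda>t. poly P (A t))"
proof (induction P)
  case 0
  show ?case using laur_const[of 0] by simp
next
  case (pCons a P)
  show ?case unfolding poly_pCons by (intro laur_add laur_const laur_mult pCons.IH pCons.prems)
qed

section \<open>Power sums over the five conjugates of r\<close>

abbreviation rt :: "complex \<Rightarrow> nat \<Rightarrow> complex" where "rt r k \<equiv> r / zeta5 ^ k"

lemma vv_rt_quintic:
  assumes "r \<noteq> 0"
  shows "vv (rt r k) ^ 5 + 5 * vv (rt r k) ^ 3 + 5 * vv (rt r k) = 1 / r ^ 5 - r ^ 5"
proof -
  have "(zeta5 ^ k) ^ 5 = 1"
    by (metis power_commutes power_mult mult.commute power_one zeta5_power_5)
  thus ?thesis
    using vv_quintic[of "rt r k"] assms by (simp add: power_divide)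
qed

lemma zeta5_cyclotomic: "1 + zeta5 + zeta5 ^ 2 + zeta5 ^ 3 + zeta5 ^ 4 = 0"
proof -
  have "(zeta5 - 1) * (1 + zeta5 + zeta5 ^ 2 + zeta5 ^ 3 + zeta5 ^ 4) = zeta5 ^ 5 - 1" by algebra
  moreover have "zeta5 \<noteq> 1" using zeta5_power_eq_1[of 1] by auto
  ultimately show ?thesis by (simp add: zeta5_power_5)
qed

lemma zeta5_inverse:
  assumes "a + b = 5"
  shows "1 / zeta5 ^ a = zeta5 ^ b"
proof -
  have "zeta5 ^ b * zeta5 ^ a = 1"
    using assms zeta5_power_5 by (simp add: add.commute flip: power_add)
  thus ?thesis by (metis nonzero_eq_divide_eq power_not_zero zeta5_nonzero)
qed

lemmas zeta5_inverses = zeta5_inverse[of 1 4, simplified] zeta5_inverse[of 2 3, simplified]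
  zeta5_inverse[of 3 2, simplified] zeta5_inverse[of 4 1, simplified]

lemma divide_zeta5:
  assumes "a + b = 5"
  shows "r / zeta5 ^ a = zeta5 ^ b * r"
  unfolding zeta5_inverse[OF assms, symmetric] by simp

lemmas divides_zeta5 = divide_zeta5[of 1 4, simplified] divide_zeta5[of 2 3, simplified]
  divide_zeta5[of 3 2, simplified] divide_zeta5[of 4 1, simplified]

text \<open>Division by powers of \<open>zeta5\<close> is rewritten as multiplication, so that
  \<open>algebra\<close> can reduce modulo the cyclotomic relation.\<close>

lemma vv_rt_expand:
  "(\<Sum>k<5. F (rt r k)) = F r + F (zeta5 ^ 4 * r) + F (zeta5 ^ 3 * r) + F (zeta5 ^ 2 * r) + F (zeta5 * r)"
proof -
  have "{..<5::nat} = {0, 1, 2, 3, 4}" by auto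
  hence "(\<Sum>k<5. F (rt r k)) = F (r / zeta5 ^ 0) + F (r / zeta5 ^ 1) + F (r / zeta5 ^ 2) + F (r / zeta5 ^ 3) + F (r / zeta5 ^ 4)"
    by (simp add: add_ac)
  thus ?thesis
    unfolding power_one_right power_0 div_by_1 divides_zeta5 .
qed

lemma vv_zeta:
  "vv (zeta5 ^ 4 * r) = zeta5 * (1 / r) - zeta5 ^ 4 * r" "1 / (zeta5 ^ 4 * r) = zeta5 * (1 / r)"
  "vv (zeta5 ^ 3 * r) = zeta5 ^ 2 * (1 / r) - zeta5 ^ 3 * r" "1 / (zeta5 ^ 3 * r) = zeta5 ^ 2 * (1 / r)"
  "vv (zeta5 ^ 2 * r) = zeta5 ^ 3 * (1 / r) - zeta5 ^ 2 * r" "1 / (zeta5 ^ 2 * r) = zeta5 ^ 3 * (1 / r)"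
  "vv (zeta5 * r) = zeta5 ^ 4 * (1 / r) - zeta5 * r" "1 / (zeta5 * r) = zeta5 ^ 4 * (1 / r)"
proof -
  have "1 / (a * r) = (1 / a) * (1 / r)" for a by simp
  from this[of zeta5] this[of "zeta5 ^ 2"] this[of "zeta5 ^ 3"] this[of "zeta5 ^ 4"]
  have i: "1 / (zeta5 * r) = zeta5 ^ 4 * (1 / r)" "1 / (zeta5 ^ 2 * r) = zeta5 ^ 3 * (1 / r)"
    "1 / (zeta5 ^ 3 * r) = zeta5 ^ 2 * (1 / r)" "1 / (zeta5 ^ 4 * r) = zeta5 * (1 / r)"
    unfolding zeta5_inverses .
  show "vv (zeta5 ^ 4 * r) = zeta5 * (1 / r) - zeta5 ^ 4 * r" "1 / (zeta5 ^ 4 * r) = zeta5 * (1 / r)"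
    "vv (zeta5 ^ 3 * r) = zeta5 ^ 2 * (1 / r) - zeta5 ^ 3 * r" "1 / (zeta5 ^ 3 * r) = zeta5 ^ 2 * (1 / r)"
    "vv (zeta5 ^ 2 * r) = zeta5 ^ 3 * (1 / r) - zeta5 ^ 2 * r" "1 / (zeta5 ^ 2 * r) = zeta5 ^ 3 * (1 / r)"
    "vv (zeta5 * r) = zeta5 ^ 4 * (1 / r) - zeta5 * r" "1 / (zeta5 * r) = zeta5 ^ 4 * (1 / r)"
    unfolding vv_def i by (rule refl)+
qed

text \<open>The conjugates of v are the roots of v^5 + 5 v^3 + 5 v = V, and Newton's identities give
  -2 * 5 = -10 and 2 * 5^2 - 4 * 5 = 30. In the weighted sums only powers of r^5 survive; they first
  appear for v^4.\<close>

lemma vv_power_sums_base: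
  assumes "r \<noteq> 0"
  shows "(\<Sum>k<5. vv (rt r k)) = 0" "(\<Sum>k<5. vv (rt r k) ^ 2) = -10"
    "(\<Sum>k<5. vv (rt r k) ^ 3) = 0" "(\<Sum>k<5. vv (rt r k) ^ 4) = 30"
    "(\<Sum>k<5. rt r k + 1 / rt r k) = 0"
    "(\<Sum>k<5. (rt r k + 1 / rt r k) * vv (rt r k)) = 0"
    "(\<Sum>k<5. (rt r k + 1 / rt r k) * vv (rt r k) ^ 2) = 0"
    "(\<Sum>k<5. (rt r k + 1 / rt r k) * vv (rt r k) ^ 3) = 0"
    "(\<Sum>k<5. (rt r k + 1 / rt r k) * vv (rt r k) ^ 4) = 5 * (1 / r ^ 5 + r ^ 5)"
proof -
  define s where "s = 1 / r"
  have sr: "s * r = 1" using assms by (simp add: s_def)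
  have s5: "1 / r ^ 5 = s ^ 5" by (simp add: s_def power_divide)
  have v1: "vv r = s - r" by (simp add: vv_def s_def)
  note z = zeta5_cyclotomic
  note exp = vv_zeta[of r, folded s_def] v1 s_def [symmetric]
  show "(\<Sum>k<5. vv (rt r k)) = 0"
    unfolding vv_rt_expand[of vv] exp using z by algebra
  show "(\<Sum>k<5. vv (rt r k) ^ 2) = -10"
    unfolding vv_rt_expand[of "\<lambda>r. vv r ^ 2"] exp using z sr by algebra
  show "(\<Sum>k<5. vv (rt r k) ^ 3) = 0"
    unfolding vv_rt_expand[of "\<lambda>r. vv r ^ 3"] exp using z sr by algebra
  show "(\<Sum>k<5. vv (rt r k) ^ 4) = 30"
    unfolding vv_rt_expand[of "\<lambda>r. vv r ^ 4"] exp using z sr by algebra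
  show "(\<Sum>k<5. rt r k + 1 / rt r k) = 0"
    unfolding vv_rt_expand[of "\<lambda>r. r + 1 / r"] exp using z sr by algebra
  show "(\<Sum>k<5. (rt r k + 1 / rt r k) * vv (rt r k)) = 0"
    unfolding vv_rt_expand[of "\<lambda>r. (r + 1 / r) * vv r"] exp using z sr by algebra
  show "(\<Sum>k<5. (rt r k + 1 / rt r k) * vv (rt r k) ^ 2) = 0"
    unfolding vv_rt_expand[of "\<lambda>r. (r + 1 / r) * vv r ^ 2"] exp using z sr by algebra
  show "(\<Sum>k<5. (rt r k + 1 / rt r k) * vv (rt r k) ^ 3) = 0"
    unfolding vv_rt_expand[of "\<lambda>r. (r + 1 / r) * vv r ^ 3"] exp using z sr by algebra
  show "(\<Sum>k<5. (rt r k + 1 / rt r k) * vv (rt r k) ^ 4) = 5 * (1 / r ^ 5 + r ^ 5)"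
    unfolding vv_rt_expand[of "\<lambda>r. (r + 1 / r) * vv r ^ 4"] exp s5 using z sr by algebra
qed

section \<open>Averages over fifth roots of unity\<close>

lemma quintic_recurrence:
  fixes w v V :: complex
  assumes "v ^ 5 + 5 * v ^ 3 + 5 * v = V" "n \<ge> 5"
  shows "w * v ^ n = V * (w * v ^ (n - 5)) - 5 * (w * v ^ (n - 2)) - 5 * (w * v ^ (n - 4))"
proof -
  obtain m where m: "n = m + 5" using assms(2) by (metis add.commute le_Suc_ex)
  have e: "n - 5 = m" "n - 2 = m + 3" "n - 4 = m + 1" using m by auto
  have "w * v ^ n = w * v ^ m * v ^ 5" unfolding m power_add by simp
  also have "v ^ 5 = V - 5 * v ^ 3 - 5 * v" unfolding assms(1) [symmetric] by simp
  finally show ?thesis unfolding e power_add by (simp add: algebra_simps)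
qed

lemma power_sum_recurrence:
  assumes "r \<noteq> 0" "n \<ge> 5"
  shows "(\<Sum>k<5. f k * vv (rt r k) ^ n) = (1 / r ^ 5 - r ^ 5) * (\<Sum>k<5. f k * vv (rt r k) ^ (n - 5))
     - 5 * (\<Sum>k<5. f k * vv (rt r k) ^ (n - 2)) - 5 * (\<Sum>k<5. f k * vv (rt r k) ^ (n - 4))"
  by (simp only: quintic_recurrence[OF vv_rt_quintic[OF assms(1)] assms(2)] sum_subtractf sum_distrib_left)

text \<open>The recurrence reduces everything to n < 5. W is the common factor of those base cases:
  1 for the plain sums, r^-5 + r^5 for the weighted ones.\<close>

lemma power_sum_poly:
  assumes "\<And>n. n < 5 \<Longrightarrow> \<exists>P. \<forall>r. r \<noteq> 0 \<longrightarrow> (\<Sum>k<5. f r k * vv (rt r k) ^ n) = W r * poly P (1 / r ^ 5 - r ^ 5)"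
  shows "\<exists>P. \<forall>r. r \<noteq> 0 \<longrightarrow> (\<Sum>k<5. f r k * vv (rt r k) ^ n) = W r * poly P (1 / r ^ 5 - r ^ 5)"
proof (induction n rule: less_induct)
  case (less n)
  show ?case
  proof (cases "n < 5")
    case True
    thus ?thesis by (rule assms)
  next
    case False
    obtain P1 P2 P3 where
      P1: "\<And>r. r \<noteq> 0 \<Longrightarrow> (\<Sum>k<5. f r k * vv (rt r k) ^ (n - 5)) = W r * poly P1 (1 / r ^ 5 - r ^ 5)" and
      P2: "\<And>r. r \<noteq> 0 \<Longrightarrow> (\<Sum>k<5. f r k * vv (rt r k) ^ (n - 2)) = W r * poly P2 (1 / r ^ 5 - r ^ 5)" and
      P3: "\<And>r. r \<noteq> 0 \<Longrightarrow> (\<Sum>k<5. f r k * vv (rt r k) ^ (n - 4)) = W r * poly P3 (1 / r ^ 5 - r ^ 5)"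
      using less.IH[of "n - 5"] less.IH[of "n - 2"] less.IH[of "n - 4"] False by auto
    have "(\<Sum>k<5. f r k * vv (rt r k) ^ n) = W r * poly ([:0, 1:] * P1 - [:5:] * P2 - [:5:] * P3) (1 / r ^ 5 - r ^ 5)"
      if r: "r \<noteq> 0" for r
    proof -
      have n: "n \<ge> 5" using False by simp
      show ?thesis
        unfolding power_sum_recurrence[OF r n, of "f r"] P1[OF r] P2[OF r] P3[OF r]
        by (simp add: algebra_simps)
    qed
    thus ?thesis by blast
  qed
qed

lemma less_5_cases: "(n::nat) < 5 \<Longrightarrow> n = 0 \<or> n = 1 \<or> n = 2 \<or> n = 3 \<or> n = 4"
  by linarith

lemma even_power_sum:
  "\<exists>P. \<forall>r. r \<noteq> 0 \<longrightarrow> (\<Sum>k<5. vv (rt r k) ^ n) = poly P (1 / r ^ 5 - r ^ 5)"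
proof -
  have "\<exists>P. \<forall>r. r \<noteq> 0 \<longrightarrow> (\<Sum>k<5. 1 * vv (rt r k) ^ n) = 1 * poly P (1 / r ^ 5 - r ^ 5)"
  proof (rule power_sum_poly)
    fix n :: nat assume "n < 5"
    define c :: complex where "c = (if n = 0 then 5 else if n = 2 then -10 else if n = 4 then 30 else 0)"
    have "(\<Sum>k<5. 1 * vv (rt r k) ^ n) = 1 * poly [:c:] (1 / r ^ 5 - r ^ 5)" if "r \<noteq> 0" for r
      using less_5_cases[OF \<open>n < 5\<close>] vv_power_sums_base(1-4)[OF that] by (elim disjE) (simp_all add: c_def)
    thus "\<exists>P. \<forall>r. r \<noteq> 0 \<longrightarrow> (\<Sum>k<5. 1 * vv (rt r k) ^ n) = 1 * poly P (1 / r ^ 5 - r ^ 5)" by blast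
  qed
  thus ?thesis by simp
qed

lemma odd_power_sum:
  "\<exists>P. \<forall>r. r \<noteq> 0 \<longrightarrow> (\<Sum>k<5. (rt r k + 1 / rt r k) * vv (rt r k) ^ n) = (1 / r ^ 5 + r ^ 5) * poly P (1 / r ^ 5 - r ^ 5)"
proof (rule power_sum_poly)
  fix n :: nat assume "n < 5"
  define c :: complex where "c = (if n = 4 then 5 else 0)"
  have "(\<Sum>k<5. (rt r k + 1 / rt r k) * vv (rt r k) ^ n) = (1 / r ^ 5 + r ^ 5) * poly [:c:] (1 / r ^ 5 - r ^ 5)"
    if "r \<noteq> 0" for r
    using less_5_cases[OF \<open>n < 5\<close>] vv_power_sums_base(5-9)[OF that]
    by (elim disjE) (simp_all only: c_def power_0 mult_1_right power_one_right poly_pCons poly_0, simp_all)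
  thus "\<exists>P. \<forall>r. r \<noteq> 0 \<longrightarrow> (\<Sum>k<5. (rt r k + 1 / rt r k) * vv (rt r k) ^ n) =
      (1 / r ^ 5 + r ^ 5) * poly P (1 / r ^ 5 - r ^ 5)" by blast
qed

text \<open>The two sums are even and odd under \<open>r \<mapsto> -1 / r\<close>, which fixes \<open>v\<close> and \<open>t\<close> and negates
  \<open>1 / r ^ 5 + r ^ 5\<close>.\<close>

definition good_avg :: "(complex \<Rightarrow> complex \<Rightarrow> complex) \<Rightarrow> bool" where
  "good_avg F \<longleftrightarrow> (\<exists>C D. laur C \<and> laur D \<and> (\<forall>r t. r \<noteq> 0 \<longrightarrow> t \<noteq> 0 \<longrightarrow> 1 / r ^ 5 - r ^ 5 = 1 / t + 11 \<longrightarrow>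
     (\<Sum>k<5. F (vv (rt r k)) t) = C t \<and>
     (\<Sum>k<5. (rt r k + 1 / rt r k) * F (vv (rt r k)) t) = (1 / r ^ 5 + r ^ 5) * D t))"

lemma good_avg_monomial:
  assumes "laur A"
  shows "good_avg (\<lambda>v t. v ^ n * A t)"
proof -
  obtain P where P: "\<And>r. r \<noteq> 0 \<Longrightarrow> (\<Sum>k<5. vv (rt r k) ^ n) = poly P (1 / r ^ 5 - r ^ 5)"
    using even_power_sum[of n] by blast
  obtain Q where Q: "\<And>r. r \<noteq> 0 \<Longrightarrow> (\<Sum>k<5. (rt r k + 1 / rt r k) * vv (rt r k) ^ n) =
      (1 / r ^ 5 + r ^ 5) * poly Q (1 / r ^ 5 - r ^ 5)"
    using odd_power_sum[of n] by blast
  have "laur (\<lambda>t. poly R (1 / t + 11) * A t)" for R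
    by (intro laur_mult laur_poly_compose laur_add laur_inverse laur_const assms)
  moreover have "(\<Sum>k<5. vv (rt r k) ^ n * A t) = poly P (1 / t + 11) * A t \<and>
     (\<Sum>k<5. (rt r k + 1 / rt r k) * (vv (rt r k) ^ n * A t)) = (1 / r ^ 5 + r ^ 5) * (poly Q (1 / t + 11) * A t)"
    if "r \<noteq> 0" "1 / r ^ 5 - r ^ 5 = 1 / t + 11" for r t
    using P[OF that(1)] Q[OF that(1)] unfolding that(2)
    by (simp only: mult.assoc [symmetric] sum_distrib_right [symmetric])
  ultimately show ?thesis
    unfolding good_avg_def by blast
qed

lemma good_avg_add:
  assumes "good_avg F" "good_avg G"
  shows "good_avg (\<lambda>v t. F v t + G v t)"
proof -
  obtain C D where 1: "laur C" "laur D" "\<And>r t. r \<noteq> 0 \<Longrightarrow> t \<noteq> 0 \<Longrightarrow> 1 / r ^ 5 - r ^ 5 = 1 / t + 11 \<Longrightarrow>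
     (\<Sum>k<5. F (vv (rt r k)) t) = C t \<and>
     (\<Sum>k<5. (rt r k + 1 / rt r k) * F (vv (rt r k)) t) = (1 / r ^ 5 + r ^ 5) * D t"
    using assms(1) unfolding good_avg_def by blast
  obtain C' D' where 2: "laur C'" "laur D'" "\<And>r t. r \<noteq> 0 \<Longrightarrow> t \<noteq> 0 \<Longrightarrow> 1 / r ^ 5 - r ^ 5 = 1 / t + 11 \<Longrightarrow>
     (\<Sum>k<5. G (vv (rt r k)) t) = C' t \<and>
     (\<Sum>k<5. (rt r k + 1 / rt r k) * G (vv (rt r k)) t) = (1 / r ^ 5 + r ^ 5) * D' t"
    using assms(2) unfolding good_avg_def by blast
  have "laur (\<lambda>t. C t + C' t)" "laur (\<lambda>t. D t + D' t)"
    by (intro laur_add 1 2)+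
  moreover have "(\<Sum>k<5. F (vv (rt r k)) t + G (vv (rt r k)) t) = C t + C' t \<and>
     (\<Sum>k<5. (rt r k + 1 / rt r k) * (F (vv (rt r k)) t + G (vv (rt r k)) t)) = (1 / r ^ 5 + r ^ 5) * (D t + D' t)"
    if "r \<noteq> 0" "t \<noteq> 0" "1 / r ^ 5 - r ^ 5 = 1 / t + 11" for r t
    using 1(3)[OF that] 2(3)[OF that] by (simp only: sum.distrib distrib_left)
  ultimately show ?thesis unfolding good_avg_def by blast
qed

lemma good_avg_zero: "good_avg (\<lambda>v t. 0)"
  using good_avg_monomial[OF laur_const[of 0], of 0] by simp

lemma good_avg_sum: "(\<And>i. i \<in> I \<Longrightarrow> good_avg (F i)) \<Longrightarrow> good_avg (\<lambda>v t. \<Sum>i\<in>I. F i v t)"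
proof (induction I rule: infinite_finite_induct)
  case (insert i I)
  show ?case
    unfolding sum.insert[OF insert.hyps] by (intro good_avg_add insert.IH insert.prems) auto
qed (simp_all add: good_avg_zero)

lemma good_avg_poly:
  assumes "laur A"
  shows "good_avg (\<lambda>v t. poly P v * A t)"
proof -
  have "good_avg (\<lambda>v t. \<Sum>i\<le>degree P. v ^ i * (coeff P i * A t))"
    by (intro good_avg_sum good_avg_monomial laur_mult laur_const assms)
  also have "(\<lambda>v t. \<Sum>i\<le>degree P. v ^ i * (coeff P i * A t)) = (\<lambda>v t. poly P v * A t)"
    unfolding poly_altdef sum_distrib_right by (simp only: mult_ac)
  finally show ?thesis .
qed

definition mp :: "complex poly" where "mp = [:11, 6, 6, 1, 1:]"
definition np :: "complex poly" where "np = [:61, 36, 21, 6, 1:]"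

lemma poly_mp: "poly mp v = mpol v"
  by (simp add: mp_def mpol_def algebra_simps eval_nat_numeral)

lemma poly_np: "poly np v = npol v"
  by (simp add: np_def npol_def algebra_simps eval_nat_numeral)

lemma quintic_factor: "v ^ 5 + 5 * v ^ 3 + 5 * v - 11 = (v - 1) * mpol v"
  unfolding mpol_def by algebra

text \<open>All conjugates of v lie on the curve (v - 1) mpol (v) t = 1, so F may be altered away
  from it.\<close>

lemma good_avg_cong:
  assumes "good_avg F" "\<And>v t. t \<noteq> 0 \<Longrightarrow> (v - 1) * mpol v * t = 1 \<Longrightarrow> F v t = G v t"
  shows "good_avg G"
proof -
  have "F (vv (rt r k)) t = G (vv (rt r k)) t" if "r \<noteq> 0" "t \<noteq> 0" "1 / r ^ 5 - r ^ 5 = 1 / t + 11" for r t k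
  proof (rule assms(2)[OF that(2)])
    have "(vv (rt r k) - 1) * mpol (vv (rt r k)) = 1 / t"
      unfolding quintic_factor [symmetric] vv_rt_quintic[OF that(1)] that(3) by simp
    thus "(vv (rt r k) - 1) * mpol (vv (rt r k)) * t = 1" using that(2) by simp
  qed
  thus ?thesis using assms(1) unfolding good_avg_def by (simp cong: conj_cong)
qed

text \<open>The variable \<open>mpol v ^ 6 * t ^ 5\<close> is \<open>t\<close> at \<open>\<tau> / 5\<close>.\<close>

lemma good_avg_t_fifth:
  assumes "laur A"
  shows "good_avg (\<lambda>v t. poly E v * t ^ j * A (mpol v ^ 6 * t ^ 5))"
proof -
  obtain P n where A: "\<And>t. t \<noteq> 0 \<Longrightarrow> A t = poly P t / t ^ n"
    using assms unfolding laur_def by blast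
  \<comment> \<open>On the curve the inverse of \<open>mpol v ^ 6 * t ^ 5\<close> is (v - 1)^6 t, so
    the denominator of A turns into polynomial factors.\<close>
  have "good_avg (\<lambda>v t. \<Sum>i\<le>degree P. poly (E * mp ^ (6 * i) * ([:-1, 1:] ^ (6 * n))) v * (coeff P i * (t ^ j * t ^ (5 * i) * t ^ n)))"
    by (intro good_avg_sum good_avg_poly laur_mult laur_const laur_power laur_id)
  thus ?thesis
  proof (rule good_avg_cong)
    fix v t :: complex
    assume t: "t \<noteq> 0" and rel: "(v - 1) * mpol v * t = 1"
    have nz: "mpol v ^ 6 * t ^ 5 \<noteq> 0" using rel t by auto
    have "(v - 1) ^ 6 * t * (mpol v ^ 6 * t ^ 5) = ((v - 1) * mpol v * t) ^ 6" by algebra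
    hence "1 / (mpol v ^ 6 * t ^ 5) = (v - 1) ^ 6 * t"
      unfolding rel using nz by (simp add: divide_eq_eq)
    hence "(1 / (mpol v ^ 6 * t ^ 5)) ^ n = ((v - 1) ^ 6 * t) ^ n" by simp
    hence inv: "1 / (mpol v ^ 6 * t ^ 5) ^ n = (v - 1) ^ (6 * n) * t ^ n"
      by (simp add: power_divide power_mult_distrib power_mult)
    have "poly E v * t ^ j * A (mpol v ^ 6 * t ^ 5) =
        poly E v * t ^ j * (poly P (mpol v ^ 6 * t ^ 5) * ((v - 1) ^ (6 * n) * t ^ n))"
      unfolding A[OF nz] inv [symmetric] by simp
    also have "\<dots> = (\<Sum>i\<le>degree P. poly E v * t ^ j * (coeff P i * (mpol v ^ 6 * t ^ 5) ^ i * ((v - 1) ^ (6 * n) * t ^ n)))"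
      unfolding poly_altdef sum_distrib_left sum_distrib_right ..
    also have "\<dots> = (\<Sum>i\<le>degree P. poly (E * mp ^ (6 * i) * ([:-1, 1:] ^ (6 * n))) v * (coeff P i * (t ^ j * t ^ (5 * i) * t ^ n)))"
    proof (intro sum.cong refl)
      fix i
      have e: "(mpol v ^ 6 * t ^ 5) ^ i = mpol v ^ (6 * i) * t ^ (5 * i)"
        by (simp only: power_mult_distrib power_mult)
      have "poly [:-1, 1:] v = v - 1" by simp
      thus "poly E v * t ^ j * (coeff P i * (mpol v ^ 6 * t ^ 5) ^ i * ((v - 1) ^ (6 * n) * t ^ n)) =
          poly (E * mp ^ (6 * i) * ([:-1, 1:] ^ (6 * n))) v * (coeff P i * (t ^ j * t ^ (5 * i) * t ^ n))"
        unfolding e poly_mult poly_power poly_mp by (simp only: mult_ac)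
    qed
    finally show "(\<Sum>i\<le>degree P. poly (E * mp ^ (6 * i) * ([:-1, 1:] ^ (6 * n))) v * (coeff P i * (t ^ j * t ^ (5 * i) * t ^ n))) =
      poly E v * t ^ j * A (mpol v ^ 6 * t ^ 5)" ..
  qed
qed

lemma good_avg_apply:
  assumes "good_avg F"
  obtains C D where "laur C" "laur D"
    "\<And>\<tau>. \<tau> \<in> uhp \<Longrightarrow> (\<Sum>k<5. F (vv (rt (rr \<tau>) k)) (fn_t \<tau>)) = C (fn_t \<tau>)"
    "\<And>\<tau>. \<tau> \<in> uhp \<Longrightarrow> (\<Sum>k<5. (rt (rr \<tau>) k + 1 / rt (rr \<tau>) k) * F (vv (rt (rr \<tau>) k)) (fn_t \<tau>)) = WW \<tau> * D (fn_t \<tau>)"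
proof -
  obtain C D where CD: "laur C" "laur D" "\<And>r t. r \<noteq> 0 \<Longrightarrow> t \<noteq> 0 \<Longrightarrow> 1 / r ^ 5 - r ^ 5 = 1 / t + 11 \<Longrightarrow>
     (\<Sum>k<5. F (vv (rt r k)) t) = C t \<and>
     (\<Sum>k<5. (rt r k + 1 / rt r k) * F (vv (rt r k)) t) = (1 / r ^ 5 + r ^ 5) * D t"
    using assms unfolding good_avg_def by blast
  have "1 / rr \<tau> ^ 5 - rr \<tau> ^ 5 = 1 / fn_t \<tau> + 11" if "\<tau> \<in> uhp" for \<tau>
    using rr_t[OF that] by algebra
  note CD(3)[OF rr_nonzero fn_nonzero(1) this]
  with CD(1,2) show ?thesis
    by (intro that[of C D]) (simp_all add: WW_def)
qed

section \<open>The five points above \<tau> and the passage from one power of 5 to the next\<close>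

lemma fn_t_shift: "\<tau> \<in> uhp \<Longrightarrow> fn_t (\<tau> + 24 * of_nat k) = fn_t \<tau>"
  using uhp_shift[of \<tau> k] by (simp only: fn_t_eta eta_shift eta_5_shift)

lemma fifth_shift:
  assumes \<tau>: "\<tau> \<in> uhp" and c: "c < 2"
  defines "r \<equiv> rt (rr \<tau>)" and "\<sigma> \<equiv> \<lambda>k. (\<tau> + 24 * of_nat k) / 5"
  shows "fn_t (\<sigma> k) = mpol (vv (r k)) ^ 6 * fn_t \<tau> ^ 5" (is ?t)
    and "WW (\<sigma> k) = (r k + 1 / r k) * npol (vv (r k)) * (vv (r k) - 1) * fn_t \<tau>" (is ?W)
    and "eta (\<sigma> k) = eta (5 * \<tau>) * (vv (r k) - 1)" (is ?e)
    and "eta (5 * \<sigma> k) = eta \<tau>" (is ?e5)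
    and "theta c (\<sigma> k) = theta c (5 * \<tau>) * (1 - vv (r k)) + theta c \<tau> * (r k + 1 / r k)" (is ?th)
    and "theta c (5 * \<sigma> k) = theta c \<tau>" (is ?th5)
    and "(vv (r k) - 1) * mpol (vv (r k)) * fn_t \<tau> = 1" (is ?rel)
proof -
  note s = uhp_shift[OF \<tau>, of k]
  have \<sigma>5: "5 * \<sigma> k = \<tau> + 24 * of_nat k" by (simp add: \<sigma>_def)
  note sh = rr_shift fn_t_shift[OF \<tau>] theta_shift theta_5_shift eta_shift eta_5_shift
  show ?t using inverse_t_fifth(2)[OF s] unfolding sh \<sigma>_def r_def .
  show ?W using WW_fifth[OF s] unfolding sh \<sigma>_def r_def .
  show ?e using eta_fifth_rr[OF s] unfolding sh \<sigma>_def r_def vv_def by (simp add: algebra_simps)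
  show ?e5 unfolding \<sigma>5 sh ..
  show ?th5 unfolding \<sigma>5 sh ..
  show ?th using theta_fifth_rr[OF c s] unfolding sh \<sigma>_def r_def vv_def by (simp add: algebra_simps diff_divide_distrib)
  show ?rel using inverse_t_fifth(1)[OF s] fn_nonzero(1)[OF \<tau>] unfolding sh r_def by (simp add: field_simps)
qed

text \<open>Dividing by the square of eta brings (v - 1)^-2, which is (mpol (v) t)^2 on the curve;
  this explains \<open>mp\<close> in F1 and F2. F1 collects the terms with theta (5 \<tau>), F2
  those with (r + 1/r) theta \<tau>. A' and B' are free of c because the rules for both theta
  functions coincide.\<close>

lemma step_even:
  assumes "laur A" "laur B"
  obtains A' B' where "laur A'" "laur B'"
    "\<And>c \<tau>. c < 2 \<Longrightarrow> \<tau> \<in> uhp \<Longrightarrow>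
      (\<Sum>k<5. let \<sigma> = (\<tau> + 24 * of_nat k) / 5 in
         (A (fn_t \<sigma>) * theta c \<sigma> + WW \<sigma> * B (fn_t \<sigma>) * theta c (5 * \<sigma>)) / eta \<sigma> ^ 2) =
      (A' (fn_t \<tau>) * theta c (5 * \<tau>) + WW \<tau> * B' (fn_t \<tau>) * theta c \<tau>) / eta (5 * \<tau>) ^ 2"
proof -
  define F1 where "F1 = (\<lambda>v t. poly (- mp) v * t ^ 1 * A (mpol v ^ 6 * t ^ 5))"
  define F2 where "F2 = (\<lambda>v t. poly (mp ^ 2) v * t ^ 2 * A (mpol v ^ 6 * t ^ 5) + poly (np * mp) v * t ^ 2 * B (mpol v ^ 6 * t ^ 5))"
  have "good_avg F1" "good_avg F2"
    unfolding F1_def F2_def by (intro good_avg_add good_avg_t_fifth assms)+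
  then obtain A' D1 C2 B' where *: "laur A'" "laur B'"
    "\<And>\<tau>. \<tau> \<in> uhp \<Longrightarrow> (\<Sum>k<5. F1 (vv (rt (rr \<tau>) k)) (fn_t \<tau>)) = A' (fn_t \<tau>)"
    "\<And>\<tau>. \<tau> \<in> uhp \<Longrightarrow> (\<Sum>k<5. (rt (rr \<tau>) k + 1 / rt (rr \<tau>) k) * F2 (vv (rt (rr \<tau>) k)) (fn_t \<tau>)) = WW \<tau> * B' (fn_t \<tau>)"
    by (elim good_avg_apply) (rule that)
  show ?thesis
  proof (rule that[OF *(1,2)])
    fix c :: nat and \<tau> assume c: "c < 2" and \<tau>: "\<tau> \<in> uhp"
    define r where "r = rt (rr \<tau>)"
    define t where "t = fn_t \<tau>"
    have rk: "rt (rr \<tau>) k = r k" for k by (simp add: r_def)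
    have "(let \<sigma> = (\<tau> + 24 * of_nat k) / 5 in
         (A (fn_t \<sigma>) * theta c \<sigma> + WW \<sigma> * B (fn_t \<sigma>) * theta c (5 * \<sigma>)) / eta \<sigma> ^ 2) =
      (F1 (vv (r k)) t * theta c (5 * \<tau>) + (r k + 1 / r k) * F2 (vv (r k)) t * theta c \<tau>) / eta (5 * \<tau>) ^ 2" for k
    proof -
      note f = fifth_shift[OF \<tau> c, of k, unfolded rk, folded t_def]
      define v where "v = vv (r k)"
      define m where "m = mpol v"
      define a b n \<rho> h g where "a = A (m ^ 6 * t ^ 5)" and "b = B (m ^ 6 * t ^ 5)"
        and "n = npol v" and "\<rho> = r k + 1 / r k" and "h = theta c (5 * \<tau>)" and "g = theta c \<tau>"
      have rel: "(v - 1) * m * t = 1" using f(7) by (simp add: v_def m_def)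
      hence v1: "v - 1 \<noteq> 0" by auto
      have "a * (h * (1 - v) + g * \<rho>) + \<rho> * n * (v - 1) * t * b * g =
          (v - 1) ^ 2 * ((- m) * t ^ 1 * a * h + \<rho> * (m ^ 2 * t ^ 2 * a + (n * m) * t ^ 2 * b) * g)"
        using rel by algebra
      hence "(a * (h * (1 - v) + g * \<rho>) + \<rho> * n * (v - 1) * t * b * g) / (eta (5 * \<tau>) * (v - 1)) ^ 2 =
          ((- m) * t ^ 1 * a * h + \<rho> * (m ^ 2 * t ^ 2 * a + (n * m) * t ^ 2 * b) * g) / eta (5 * \<tau>) ^ 2"
        using v1 by (simp add: power_mult_distrib)
      thus ?thesis
        unfolding Let_def f(1-3,5,6) F1_def F2_def poly_minus poly_mult poly_power poly_mp poly_np
          v_def [symmetric] m_def [symmetric] a_def [symmetric] b_def [symmetric]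
          n_def [symmetric] \<rho>_def [symmetric] h_def [symmetric] g_def [symmetric] .
    qed
    hence "(\<Sum>k<5. let \<sigma> = (\<tau> + 24 * of_nat k) / 5 in
         (A (fn_t \<sigma>) * theta c \<sigma> + WW \<sigma> * B (fn_t \<sigma>) * theta c (5 * \<sigma>)) / eta \<sigma> ^ 2) =
      ((\<Sum>k<5. F1 (vv (r k)) t) * theta c (5 * \<tau>) + (\<Sum>k<5. (r k + 1 / r k) * F2 (vv (r k)) t) * theta c \<tau>) / eta (5 * \<tau>) ^ 2"
      by (simp only: sum_divide_distrib [symmetric] sum.distrib sum_distrib_right)
    thus "(\<Sum>k<5. let \<sigma> = (\<tau> + 24 * of_nat k) / 5 in
         (A (fn_t \<sigma>) * theta c \<sigma> + WW \<sigma> * B (fn_t \<sigma>) * theta c (5 * \<sigma>)) / eta \<sigma> ^ 2) =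
      (A' (fn_t \<tau>) * theta c (5 * \<tau>) + WW \<tau> * B' (fn_t \<tau>) * theta c \<tau>) / eta (5 * \<tau>) ^ 2"
      unfolding r_def t_def *(3)[OF \<tau>] *(4)[OF \<tau>] .
  qed
qed

text \<open>W at the shifted point already contains r + 1/r. Its product with the (r + 1/r) term of
  theta produces (r + 1/r)^2 = v^2 + 4 and so falls into F1; this is q. The remaining cross term is
  p.\<close>

lemma step_odd:
  assumes "laur A" "laur B"
  obtains A' B' where "laur A'" "laur B'"
    "\<And>c \<tau>. c < 2 \<Longrightarrow> \<tau> \<in> uhp \<Longrightarrow>
      (\<Sum>k<5. let \<sigma> = (\<tau> + 24 * of_nat k) / 5 in
         (A (fn_t \<sigma>) * theta c (5 * \<sigma>) + WW \<sigma> * B (fn_t \<sigma>) * theta c \<sigma>) / eta (5 * \<sigma>) ^ 2) =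
      (A' (fn_t \<tau>) * theta c \<tau> + WW \<tau> * B' (fn_t \<tau>) * theta c (5 * \<tau>)) / eta \<tau> ^ 2"
proof -
  define q :: "complex poly" where "q = [:4, 0, 1:] * np * [:-1, 1:]"
  define p :: "complex poly" where "p = - np * [:-1, 1:] ^ 2"
  define F1 where "F1 = (\<lambda>v t. poly 1 v * t ^ 0 * A (mpol v ^ 6 * t ^ 5) + poly q v * t ^ 1 * B (mpol v ^ 6 * t ^ 5))"
  define F2 where "F2 = (\<lambda>v t. poly p v * t ^ 1 * B (mpol v ^ 6 * t ^ 5))"
  have q: "poly q v = (v ^ 2 + 4) * npol v * (v - 1)" for v
    by (simp add: q_def poly_np power2_eq_square algebra_simps)
  have p: "poly p v = - npol v * (v - 1) ^ 2" for v
    by (simp add: p_def poly_np power2_eq_square algebra_simps)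
  have "good_avg F1" "good_avg F2"
    unfolding F1_def F2_def by (intro good_avg_add good_avg_t_fifth assms)+
  then obtain A' D1 C2 B' where *: "laur A'" "laur B'"
    "\<And>\<tau>. \<tau> \<in> uhp \<Longrightarrow> (\<Sum>k<5. F1 (vv (rt (rr \<tau>) k)) (fn_t \<tau>)) = A' (fn_t \<tau>)"
    "\<And>\<tau>. \<tau> \<in> uhp \<Longrightarrow> (\<Sum>k<5. (rt (rr \<tau>) k + 1 / rt (rr \<tau>) k) * F2 (vv (rt (rr \<tau>) k)) (fn_t \<tau>)) = WW \<tau> * B' (fn_t \<tau>)"
    by (elim good_avg_apply) (rule that)
  show ?thesis
  proof (rule that[OF *(1,2)])
    fix c :: nat and \<tau> assume c: "c < 2" and \<tau>: "\<tau> \<in> uhp"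
    define r where "r = rt (rr \<tau>)"
    define t where "t = fn_t \<tau>"
    have rk: "rt (rr \<tau>) k = r k" for k by (simp add: r_def)
    have "(let \<sigma> = (\<tau> + 24 * of_nat k) / 5 in
         (A (fn_t \<sigma>) * theta c (5 * \<sigma>) + WW \<sigma> * B (fn_t \<sigma>) * theta c \<sigma>) / eta (5 * \<sigma>) ^ 2) =
      (F1 (vv (r k)) t * theta c \<tau> + (r k + 1 / r k) * F2 (vv (r k)) t * theta c (5 * \<tau>)) / eta \<tau> ^ 2" for k
    proof -
      note f = fifth_shift[OF \<tau> c, of k, unfolded rk, folded t_def]
      define v where "v = vv (r k)"
      define a b n \<rho> h g where "a = A (mpol v ^ 6 * t ^ 5)" and "b = B (mpol v ^ 6 * t ^ 5)"
        and "n = npol v" and "\<rho> = r k + 1 / r k" and "h = theta c (5 * \<tau>)" and "g = theta c \<tau>"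
      have "r k \<noteq> 0" using rr_nonzero[OF \<tau>] by (simp add: r_def)
      hence "(1 / r k) * r k = 1" by simp
      hence \<rho>2: "\<rho> ^ 2 = v ^ 2 + 4" unfolding \<rho>_def v_def vv_def by algebra
      have "a * g + \<rho> * n * (v - 1) * t * b * (h * (1 - v) + g * \<rho>) =
          (1 * t ^ 0 * a + (v ^ 2 + 4) * n * (v - 1) * t ^ 1 * b) * g + \<rho> * (- n * (v - 1) ^ 2 * t ^ 1 * b) * h"
        unfolding \<rho>2 [symmetric] by algebra
      thus ?thesis
        unfolding Let_def f(1,2,4,5,6) F1_def F2_def q p poly_1
          v_def [symmetric] a_def [symmetric] b_def [symmetric]
          n_def [symmetric] \<rho>_def [symmetric] h_def [symmetric] g_def [symmetric] by (simp only:)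
    qed
    hence "(\<Sum>k<5. let \<sigma> = (\<tau> + 24 * of_nat k) / 5 in
         (A (fn_t \<sigma>) * theta c (5 * \<sigma>) + WW \<sigma> * B (fn_t \<sigma>) * theta c \<sigma>) / eta (5 * \<sigma>) ^ 2) =
      ((\<Sum>k<5. F1 (vv (r k)) t) * theta c \<tau> + (\<Sum>k<5. (r k + 1 / r k) * F2 (vv (r k)) t) * theta c (5 * \<tau>)) / eta \<tau> ^ 2"
      by (simp only: sum_divide_distrib [symmetric] sum.distrib sum_distrib_right)
    thus "(\<Sum>k<5. let \<sigma> = (\<tau> + 24 * of_nat k) / 5 in
         (A (fn_t \<sigma>) * theta c (5 * \<sigma>) + WW \<sigma> * B (fn_t \<sigma>) * theta c \<sigma>) / eta (5 * \<sigma>) ^ 2) =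
      (A' (fn_t \<tau>) * theta c \<tau> + WW \<tau> * B' (fn_t \<tau>) * theta c (5 * \<tau>)) / eta \<tau> ^ 2"
      unfolding r_def t_def *(3)[OF \<tau>] *(4)[OF \<tau>] .
  qed
qed

section \<open>The generating functions\<close>

lemma CPsi2_holomorphic: "CPsi2 \<beta> holomorphic_on ball 0 1"
proof -
  have nz: "eul n q \<noteq> 0" if "q \<in> ball 0 1" "n > 0" for n q
    using that by (intro eul_nonzero) auto
  have "(\<lambda>q. eul 2 q ^ 5 / (eul 1 q ^ 4 * eul 4 q ^ 2)) holomorphic_on ball 0 1"
    by (intro holomorphic_intros eul_holomorphic) (simp_all add: nz)
  moreover have "(\<lambda>q. eul 4 q ^ 2 / (eul 1 q ^ 2 * eul 2 q)) holomorphic_on ball 0 1"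
    by (intro holomorphic_intros eul_holomorphic) (simp_all add: nz)
  ultimately show ?thesis
    by (cases "\<beta> = 1") (simp_all add: CPsi2_def [abs_def] eul_def)
qed

lemma CPsi2_sums:
  assumes "norm q < 1"
  shows "(\<lambda>n. cpsi2 \<beta> n * q ^ n) sums CPsi2 \<beta> q"
  using holomorphic_power_series[OF CPsi2_holomorphic, of q \<beta>] assms
  by (simp add: cpsi2_def fps_expansion_def)

lemma cpsi2_abs_summable:
  assumes "norm q < 1"
  shows "summable (\<lambda>n. norm (cpsi2 \<beta> n * q ^ n))"
proof -
  define R where "R = (1 + norm q) / 2"
  have R: "norm q < R" "R < 1" "R \<ge> 0" using assms by (auto simp: R_def add_nonneg_nonneg)
  have "summable (\<lambda>n. cpsi2 \<beta> n * of_real R ^ n)"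
    using CPsi2_sums[of "of_real R" \<beta>] R by (auto simp: sums_iff)
  thus ?thesis
    by (rule powser_insidea) (use R in auto)
qed

lemma cpsi2_summable_on:
  assumes "norm q < 1"
  shows "(\<lambda>n. cpsi2 \<beta> n * q ^ n) summable_on A"
  using cpsi2_abs_summable[OF assms, of \<beta>]
  by (intro summable_on_subset_banach[of _ UNIV A] norm_summable_imp_summable_on) auto

text \<open>The exponents of \<open>q\<close> in \<open>theta (1 - \<beta>) / eta ^ 2\<close> are \<open>n - shift12 \<beta> / 12\<close>.\<close>

definition shift12 :: "nat \<Rightarrow> int" where
  "shift12 \<beta> = (if \<beta> = 1 then 1 else -2)"

definition index_set :: "nat \<Rightarrow> nat \<Rightarrow> nat set" where
  "index_set \<beta> \<alpha> = {n. 5 ^ \<alpha> dvd 12 * int n - shift12 \<beta>}"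

text \<open>Keeping the true exponent n - shift12 / 12 of theta / eta^2 makes the sieve a plain
  divisibility by 5^\<alpha>, so that all steps are the same average over translates.\<close>

definition Vser :: "nat \<Rightarrow> nat \<Rightarrow> complex \<Rightarrow> complex" where
  "Vser \<beta> \<alpha> \<tau> = (\<Sum>\<^sub>\<infinity>n\<in>index_set \<beta> \<alpha>. cpsi2 \<beta> n * ee (of_int (12 * int n - shift12 \<beta>) * \<tau> / (12 * 5 ^ \<alpha>)))"

lemma Vser_term:
  "cpsi2 \<beta> n * ee (of_int (12 * int n - shift12 \<beta>) * \<tau> / (12 * 5 ^ \<alpha>)) =
     ee (- of_int (shift12 \<beta>) * \<tau> / (12 * 5 ^ \<alpha>)) * (cpsi2 \<beta> n * ee (\<tau> / 5 ^ \<alpha>) ^ n)"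
proof -
  have "of_int (12 * int n - shift12 \<beta>) * \<tau> / (12 * 5 ^ \<alpha>) =
      - of_int (shift12 \<beta>) * \<tau> / (12 * 5 ^ \<alpha>) + of_nat n * (\<tau> / 5 ^ \<alpha>)"
    by (simp add: field_simps)
  thus ?thesis by (simp only: ee_add ee_power mult_ac)
qed

lemma uhp_div_power: "\<tau> \<in> uhp \<Longrightarrow> \<tau> / 5 ^ \<alpha> \<in> uhp"
  using uhp_div[of \<tau> "5 ^ \<alpha>"] by simp

lemma Vser_summable:
  assumes "\<tau> \<in> uhp"
  shows "(\<lambda>n. cpsi2 \<beta> n * ee (of_int (12 * int n - shift12 \<beta>) * \<tau> / (12 * 5 ^ \<alpha>))) summable_on A"
  unfolding Vser_term
  by (intro summable_on_cmult_right cpsi2_summable_on ee_disc uhp_div_power assms)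

lemma ee_of_int [simp]: "ee (of_int n) = 1"
  using exp_integer_2pi[of "of_int n"] by (simp add: ee_def mult_ac)

lemma ee_fifth_eq_1: "ee (of_int j / 5) = 1 \<longleftrightarrow> 5 dvd j"
proof
  assume "ee (of_int j / 5) = 1"
  hence "exp (2 * of_real pi * \<i> * (of_int j / 5)) = 1" unfolding ee_def .
  then obtain k :: int where k: "2 * pi * (real_of_int j / 5) = of_int (2 * k) * pi"
    unfolding exp_eq_1 by (auto simp: Re_divide_numeral Im_divide_numeral)
  hence "real_of_int j = of_int (5 * k)" by simp
  hence "j = 5 * k" by linarith
  thus "5 dvd j" by simp
next
  assume "5 dvd j"
  then obtain i where "j = 5 * i" by (elim dvdE)
  thus "ee (of_int j / 5) = 1" by simp
qed

lemma sum_fifth_roots: "(\<Sum>k<5. ee (of_int j / 5) ^ k) = (if 5 dvd j then 5 else 0)"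
proof (cases "5 dvd j")
  case True
  thus ?thesis using ee_fifth_eq_1[of j] by simp
next
  case False
  have "ee (of_int j / 5) ^ 5 = 1" by (simp add: ee_power)
  thus ?thesis using False ee_fifth_eq_1[of j] by (simp add: sum_gp_strict)
qed

lemma infsum_finite_sum:
  fixes f :: "'i \<Rightarrow> 'a \<Rightarrow> complex"
  assumes "finite I" "\<And>k. k \<in> I \<Longrightarrow> f k summable_on A"
  shows "(\<lambda>n. \<Sum>k\<in>I. f k n) summable_on A \<and> (\<Sum>\<^sub>\<infinity>n\<in>A. \<Sum>k\<in>I. f k n) = (\<Sum>k\<in>I. infsum (f k) A)"
  using assms
proof (induction I rule: finite_induct)
  case (insert i I)
  have "f i summable_on A" "(\<lambda>n. \<Sum>k\<in>I. f k n) summable_on A"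
    and IH: "(\<Sum>\<^sub>\<infinity>n\<in>A. \<Sum>k\<in>I. f k n) = (\<Sum>k\<in>I. infsum (f k) A)"
    using insert.IH insert.prems by auto
  from summable_on_add[OF this(1,2)] infsum_add[OF this(1,2)] show ?case
    unfolding sum.insert[OF insert.hyps] IH by simp
qed simp

lemma Vser_step:
  assumes \<tau>: "\<tau> \<in> uhp"
  shows "(\<Sum>k<5. Vser \<beta> \<alpha> ((\<tau> + 24 * of_nat k) / 5)) = 5 * Vser \<beta> (Suc \<alpha>) \<tau>"
proof -
  define T where "T = (\<lambda>n. cpsi2 \<beta> n * ee (of_int (12 * int n - shift12 \<beta>) * \<tau> / (12 * 5 ^ Suc \<alpha>)))"
  let ?S = "index_set \<beta> \<alpha>"
  have sub: "index_set \<beta> (Suc \<alpha>) \<subseteq> ?S"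
    by (auto simp: index_set_def intro: dvd_trans[rotated])
  have \<sigma>: "(\<tau> + 24 * of_nat k) / 5 \<in> uhp" for k
    using uhp_shift[OF \<tau>] by simp
  have "(\<Sum>k<5. Vser \<beta> \<alpha> ((\<tau> + 24 * of_nat k) / 5)) =
      (\<Sum>\<^sub>\<infinity>n\<in>?S. \<Sum>k<5. cpsi2 \<beta> n * ee (of_int (12 * int n - shift12 \<beta>) * ((\<tau> + 24 * of_nat k) / 5) / (12 * 5 ^ \<alpha>)))"
    unfolding Vser_def
    by (rule infsum_finite_sum [THEN conjunct2, symmetric]) (rule finite_lessThan, rule Vser_summable, rule \<sigma>)
  also have "\<dots> = (\<Sum>\<^sub>\<infinity>n\<in>?S. if n \<in> index_set \<beta> (Suc \<alpha>) then 5 * T n else 0)"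
  proof (rule infsum_cong)
    fix n assume "n \<in> ?S"
    then obtain m where m: "12 * int n - shift12 \<beta> = 5 ^ \<alpha> * m" by (auto simp: index_set_def)
    \<comment> \<open>Since 24 k / (12 * 5) = 2 k / 5, the translate by 24 k multiplies the term by
      the k-th power of a fifth root of unity.\<close>
    have "cpsi2 \<beta> n * ee (of_int (12 * int n - shift12 \<beta>) * ((\<tau> + 24 * of_nat k) / 5) / (12 * 5 ^ \<alpha>)) =
        T n * ee (of_int (2 * m) / 5) ^ k" for k
    proof -
      have "of_int (12 * int n - shift12 \<beta>) * ((\<tau> + 24 * of_nat k) / 5) / (12 * 5 ^ \<alpha>) =
          of_int (12 * int n - shift12 \<beta>) * \<tau> / (12 * 5 ^ Suc \<alpha>) + of_nat k * (of_int (2 * m) / 5)"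
        unfolding m by (simp add: field_simps)
      thus ?thesis by (simp only: T_def ee_add ee_power mult.assoc)
    qed
    hence "(\<Sum>k<5. cpsi2 \<beta> n * ee (of_int (12 * int n - shift12 \<beta>) * ((\<tau> + 24 * of_nat k) / 5) / (12 * 5 ^ \<alpha>))) =
        T n * (if 5 dvd 2 * m then 5 else 0)"
      by (simp only: sum_distrib_left [symmetric] sum_fifth_roots)
    also have "5 dvd 2 * m \<longleftrightarrow> n \<in> index_set \<beta> (Suc \<alpha>)"
    proof -
      have "n \<in> index_set \<beta> (Suc \<alpha>) \<longleftrightarrow> 5 ^ \<alpha> * 5 dvd 5 ^ \<alpha> * m"
        unfolding index_set_def mem_Collect_eq m power_Suc2 ..
      also have "\<dots> \<longleftrightarrow> 5 dvd m" by simp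
      also have "\<dots> \<longleftrightarrow> 5 dvd 2 * m" by presburger
      finally show ?thesis ..
    qed
    finally show "(\<Sum>k<5. cpsi2 \<beta> n * ee (of_int (12 * int n - shift12 \<beta>) * ((\<tau> + 24 * of_nat k) / 5) / (12 * 5 ^ \<alpha>))) =
        (if n \<in> index_set \<beta> (Suc \<alpha>) then 5 * T n else 0)" by simp
  qed
  also have "\<dots> = (\<Sum>\<^sub>\<infinity>n\<in>index_set \<beta> (Suc \<alpha>). 5 * T n)"
    by (rule infsum_cong_neutral) (use sub in auto)
  also have "\<dots> = 5 * Vser \<beta> (Suc \<alpha>) \<tau>"
    unfolding Vser_def T_def by (rule infsum_cmult_right')
  finally show ?thesis .
qed

text \<open>Compensates the leading coefficient 2 of \<open>theta 1\<close>; it cancels in the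
  quotient that defines \<open>Lser\<close>.\<close>

definition kappa :: "nat \<Rightarrow> complex" where
  "kappa \<beta> = (if \<beta> = 1 then 1 else 1 / 2)"

lemma CPsi2_theta:
  assumes "\<tau> \<in> uhp" "\<beta> \<in> {0, 1}"
  shows "CPsi2 \<beta> (ee \<tau>) = ee (of_int (shift12 \<beta>) * \<tau> / 12) * (kappa \<beta> * (theta (1 - \<beta>) \<tau> / eta \<tau> ^ 2))"
proof -
  have e: "ee (\<tau> / 24) ^ 2 = ee (\<tau> / 12)" by (simp add: ee_power)
  have e': "ee (- (2 * \<tau>) / 12) * ee (\<tau> / 4) = ee (\<tau> / 12)" by (simp flip: ee_add)
  have nz: "eul n (ee \<tau>) \<noteq> 0" if "n > 0" for n using assms that by simp
  from assms(2) show ?thesis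
  proof (elim insertE emptyE)
    assume \<beta>: "\<beta> = 1"
    have "A / (C ^ 4 * D) = p * (1 * (A / (C ^ 2 * D) / (p * C ^ 2)))" if "C \<noteq> 0" "p \<noteq> 0" for A C D p :: complex
      using that by (simp add: field_simps flip: power_add)
    thus ?thesis
      using assms(1) \<beta> unfolding theta_0_product[OF assms(1)] eta_product[OF assms(1)] power_mult_distrib e
      by (simp add: CPsi2_def kappa_def shift12_def theta_0_product power_mult_distrib e flip: eul_def del: One_nat_def)
  next
    assume \<beta>: "\<beta> = 0"
    have "A / (C ^ 2 * D) = s * (1 / 2 * ((2 * r * (A / D)) / (p * C ^ 2)))" if "s * r = p" "p \<noteq> 0" for A C D p r s :: complex
      using that by (auto simp: field_simps)
    from this[OF e', of "eul 4 (ee \<tau>) ^ 2" "eul 1 (ee \<tau>)" "eul 2 (ee \<tau>)"] show ?thesis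
      using assms(1) \<beta> unfolding CPsi2_def kappa_def shift12_def
      by (simp add: theta_1_product eta_product power_mult_distrib e flip: eul_def del: One_nat_def)
  qed
qed

lemma kappa_nonzero: "kappa \<beta> \<noteq> 0"
  by (simp add: kappa_def)

lemma Vser_0:
  assumes "\<tau> \<in> uhp" "\<beta> \<in> {0, 1}"
  shows "Vser \<beta> 0 \<tau> = kappa \<beta> * (theta (1 - \<beta>) \<tau> / eta \<tau> ^ 2)"
proof -
  have "norm (ee \<tau>) < 1" using assms by simp
  hence "((\<lambda>n. cpsi2 \<beta> n * ee \<tau> ^ n) has_sum CPsi2 \<beta> (ee \<tau>)) UNIV"
    by (intro norm_summable_imp_has_sum cpsi2_abs_summable CPsi2_sums)
  hence "Vser \<beta> 0 \<tau> = ee (- of_int (shift12 \<beta>) * \<tau> / 12) * CPsi2 \<beta> (ee \<tau>)"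
    unfolding Vser_def Vser_term by (simp add: index_set_def infsum_cmult_right' infsumI)
  also have "ee (- of_int (shift12 \<beta>) * \<tau> / 12) * ee (of_int (shift12 \<beta>) * \<tau> / 12) = 1"
    by (simp add: ee_def flip: exp_add)
  hence "ee (- of_int (shift12 \<beta>) * \<tau> / 12) * CPsi2 \<beta> (ee \<tau>) = kappa \<beta> * (theta (1 - \<beta>) \<tau> / eta \<tau> ^ 2)"
    unfolding CPsi2_theta[OF assms] mult.assoc [symmetric] by simp
  finally show ?thesis .
qed

lemma laur_scale: "laur A \<Longrightarrow> laur (\<lambda>t. A t / 5)"
  using laur_mult[OF _ laur_const[of "1 / 5"], of A] by simp

text \<open>The order of quantifiers matters: A and B precede \<beta>. The shape alternates because
  for \<sigma> = (\<tau> + 24 k) / 5 the value of eta at \<sigma> is eta (5 \<tau>) times a function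
  of v, whereas at 5 \<sigma> it is eta \<tau>.\<close>

lemma Vser_form:
  "\<exists>A B. laur A \<and> laur B \<and> (\<forall>\<beta>\<in>{0, 1}. \<forall>\<tau>\<in>uhp. Vser \<beta> \<alpha> \<tau> = kappa \<beta> *
     (if even \<alpha> then (A (fn_t \<tau>) * theta (1 - \<beta>) \<tau> + WW \<tau> * B (fn_t \<tau>) * theta (1 - \<beta>) (5 * \<tau>)) / eta \<tau> ^ 2
      else (A (fn_t \<tau>) * theta (1 - \<beta>) (5 * \<tau>) + WW \<tau> * B (fn_t \<tau>) * theta (1 - \<beta>) \<tau>) / eta (5 * \<tau>) ^ 2))"
proof (induction \<alpha>)
  case 0
  show ?case
    by (intro exI[of _ "\<lambda>_. 1"] exI[of _ "\<lambda>_. 0"] conjI laur_const) (simp add: Vser_0)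
next
  case (Suc \<alpha>)
  then obtain A B where AB: "laur A" "laur B" and IH: "\<And>\<beta> \<tau>. \<beta> \<in> {0, 1} \<Longrightarrow> \<tau> \<in> uhp \<Longrightarrow> Vser \<beta> \<alpha> \<tau> = kappa \<beta> *
     (if even \<alpha> then (A (fn_t \<tau>) * theta (1 - \<beta>) \<tau> + WW \<tau> * B (fn_t \<tau>) * theta (1 - \<beta>) (5 * \<tau>)) / eta \<tau> ^ 2
      else (A (fn_t \<tau>) * theta (1 - \<beta>) (5 * \<tau>) + WW \<tau> * B (fn_t \<tau>) * theta (1 - \<beta>) \<tau>) / eta (5 * \<tau>) ^ 2)"
    by blast
  have V: "Vser \<beta> (Suc \<alpha>) \<tau> = (\<Sum>k<5. Vser \<beta> \<alpha> ((\<tau> + 24 * of_nat k) / 5)) / 5" if "\<tau> \<in> uhp" for \<beta> \<tau>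
    using Vser_step[OF that] by simp
  have \<sigma>: "(\<tau> + 24 * of_nat k) / 5 \<in> uhp" if "\<tau> \<in> uhp" for \<tau> k
    using uhp_shift[OF that] by simp
  have c: "1 - \<beta> < 2" for \<beta> :: nat by simp
  show ?case
  proof (cases "even \<alpha>")
    case True
    obtain A' B' where *: "laur A'" "laur B'"
      "\<And>c \<tau>. c < 2 \<Longrightarrow> \<tau> \<in> uhp \<Longrightarrow>
      (\<Sum>k<5. let \<sigma> = (\<tau> + 24 * of_nat k) / 5 in
         (A (fn_t \<sigma>) * theta c \<sigma> + WW \<sigma> * B (fn_t \<sigma>) * theta c (5 * \<sigma>)) / eta \<sigma> ^ 2) =
      (A' (fn_t \<tau>) * theta c (5 * \<tau>) + WW \<tau> * B' (fn_t \<tau>) * theta c \<tau>) / eta (5 * \<tau>) ^ 2"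
      by (rule step_even[OF AB]) (rule that)
    have "Vser \<beta> (Suc \<alpha>) \<tau> = kappa \<beta> * ((A' (fn_t \<tau>) / 5 * theta (1 - \<beta>) (5 * \<tau>) +
        WW \<tau> * (B' (fn_t \<tau>) / 5) * theta (1 - \<beta>) \<tau>) / eta (5 * \<tau>) ^ 2)" if \<beta>: "\<beta> \<in> {0, 1}" and \<tau>: "\<tau> \<in> uhp" for \<beta> \<tau>
    proof -
      have "(\<Sum>k<5. Vser \<beta> \<alpha> ((\<tau> + 24 * of_nat k) / 5)) = kappa \<beta> * (\<Sum>k<5. let \<sigma> = (\<tau> + 24 * of_nat k) / 5 in
         (A (fn_t \<sigma>) * theta (1 - \<beta>) \<sigma> + WW \<sigma> * B (fn_t \<sigma>) * theta (1 - \<beta>) (5 * \<sigma>)) / eta \<sigma> ^ 2)"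
        unfolding IH[OF \<beta> \<sigma>[OF \<tau>]] Let_def if_P[OF True] sum_distrib_left ..
      also note *(3)[OF c \<tau>]
      finally show ?thesis
        unfolding V[OF \<tau>] by (simp add: add_divide_distrib)
    qed
    thus ?thesis
      using True by (intro exI[of _ "\<lambda>t. A' t / 5"] exI[of _ "\<lambda>t. B' t / 5"] conjI laur_scale *(1,2)) auto
  next
    case False
    obtain A' B' where *: "laur A'" "laur B'"
      "\<And>c \<tau>. c < 2 \<Longrightarrow> \<tau> \<in> uhp \<Longrightarrow>
      (\<Sum>k<5. let \<sigma> = (\<tau> + 24 * of_nat k) / 5 in
         (A (fn_t \<sigma>) * theta c (5 * \<sigma>) + WW \<sigma> * B (fn_t \<sigma>) * theta c \<sigma>) / eta (5 * \<sigma>) ^ 2) =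
      (A' (fn_t \<tau>) * theta c \<tau> + WW \<tau> * B' (fn_t \<tau>) * theta c (5 * \<tau>)) / eta \<tau> ^ 2"
      by (rule step_odd[OF AB]) (rule that)
    have "Vser \<beta> (Suc \<alpha>) \<tau> = kappa \<beta> * ((A' (fn_t \<tau>) / 5 * theta (1 - \<beta>) \<tau> +
        WW \<tau> * (B' (fn_t \<tau>) / 5) * theta (1 - \<beta>) (5 * \<tau>)) / eta \<tau> ^ 2)" if \<beta>: "\<beta> \<in> {0, 1}" and \<tau>: "\<tau> \<in> uhp" for \<beta> \<tau>
    proof -
      have "(\<Sum>k<5. Vser \<beta> \<alpha> ((\<tau> + 24 * of_nat k) / 5)) = kappa \<beta> * (\<Sum>k<5. let \<sigma> = (\<tau> + 24 * of_nat k) / 5 in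
         (A (fn_t \<sigma>) * theta (1 - \<beta>) (5 * \<sigma>) + WW \<sigma> * B (fn_t \<sigma>) * theta (1 - \<beta>) \<sigma>) / eta (5 * \<sigma>) ^ 2)"
        unfolding IH[OF \<beta> \<sigma>[OF \<tau>]] Let_def if_not_P[OF False] sum_distrib_left ..
      also note *(3)[OF c \<tau>]
      finally show ?thesis
        unfolding V[OF \<tau>] by (simp add: add_divide_distrib)
    qed
    thus ?thesis
      using False by (intro exI[of _ "\<lambda>t. A' t / 5"] exI[of _ "\<lambda>t. B' t / 5"] conjI laur_scale *(1,2)) auto
  qed
qed

section \<open>From the sieved series to \<open>Lser\<close>\<close>

lemma index_set_eq:
  assumes "\<beta> \<in> {0, 1}"
  shows "{n. [3 * 2 ^ (\<beta> + 1) * int n = (- 1) ^ (\<beta> + 1)] (mod 5 ^ \<alpha>)} = index_set \<beta> \<alpha>"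
  using assms
proof (elim insertE emptyE)
  assume "\<beta> = 1"
  thus ?thesis by (simp add: index_set_def shift12_def cong_iff_dvd_diff)
next
  assume \<beta>: "\<beta> = 0"
  have "[6 * int n = - 1] (mod 5 ^ \<alpha>) \<longleftrightarrow> 5 ^ \<alpha> dvd 12 * int n + 2" for n
  proof -
    have "coprime (5 ^ \<alpha>) (2 :: int)" by simp
    hence "5 ^ \<alpha> dvd 2 * (6 * int n + 1) \<longleftrightarrow> 5 ^ \<alpha> dvd 6 * int n + 1"
      by (rule coprime_dvd_mult_right_iff)
    thus ?thesis by (simp add: cong_iff_dvd_diff algebra_simps)
  qed
  thus ?thesis by (simp add: \<beta> index_set_def shift12_def)
qed

text \<open>The sieve fixes n mod 5^\<alpha>, so the floor can be replaced by an exact quotient.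
  What remains is the exponent of the fractional power of q in theta / eta^2 at 5^(\<alpha> mod 2)
  \<tau>, which explains the factor q^(1 + 4 a) in the definition of L.\<close>

lemma index_floor:
  assumes \<beta>: "\<beta> \<in> {0, 1}" and \<alpha>: "\<alpha> \<ge> 1" and n: "n \<in> index_set \<beta> \<alpha>"
  shows "12 * 5 ^ \<alpha> * int (n div 5 ^ \<alpha> + \<beta>) = 12 * int n - shift12 \<beta> + shift12 \<beta> * 5 ^ (\<alpha> + \<alpha> mod 2)"
proof -
  define F :: int where "F = 5 ^ \<alpha>"
  define G :: int where "G = 5 ^ (\<alpha> + \<alpha> mod 2)"
  \<comment> \<open>The exponent is rounded up to an even number because 25 = 1 mod 24.\<close>
  have "even (\<alpha> + \<alpha> mod 2)" by presburger
  then obtain h where h: "\<alpha> + \<alpha> mod 2 = 2 * h" by (elim evenE)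
  have "[(5 ^ 2) ^ h = 1 ^ h] (mod (24::int))" by (intro cong_pow) (simp add: cong_def)
  hence "24 dvd G - 1" by (simp add: G_def h power_mult cong_iff_dvd_diff)
  then obtain g where g: "G = 24 * g + 1" by (auto elim!: dvdE simp: algebra_simps)
  have F5: "F \<ge> 5"
    using power_increasing[OF \<alpha>, of "5 :: int"] by (simp add: F_def)
  have "\<alpha> mod 2 = 0 \<or> \<alpha> mod 2 = 1" by linarith
  hence GF: "G = F \<or> G = 5 * F" by (auto simp: G_def F_def)
  \<comment> \<open>N is the residue of n mod F: F divides G, so 12 N is congruent to
    \<open>shift12 \<beta>\<close> mod F, and G <= 5 F places N between 0 and F.\<close>
  define N where "N = int \<beta> * F - 2 * shift12 \<beta> * g"
  have N: "0 \<le> N" "N < F"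
    using \<beta> g GF F5 by (auto simp: N_def shift12_def)
  have "F dvd 12 * int n - shift12 \<beta>" using n by (simp add: index_set_def F_def)
  moreover have "12 * N - shift12 \<beta> = F * (12 * int \<beta>) - shift12 \<beta> * G" by (simp add: N_def g algebra_simps)
  hence "F dvd 12 * N - shift12 \<beta>" using GF by auto
  ultimately have "F dvd (12 * int n - shift12 \<beta>) - (12 * N - shift12 \<beta>)" by (rule dvd_diff)
  hence "F dvd 12 * (int n - N)" by (simp add: algebra_simps)
  moreover have "coprime F 12"
  proof -
    have "coprime (5::int) 12"
    proof (rule coprimeI)
      fix c :: int assume "c dvd 5" "c dvd 12"
      hence "c dvd 5 * 5 - 12 * 2" by (intro dvd_diff dvd_mult2)
      thus "is_unit c" by simp
    qed
    thus ?thesis by (simp add: F_def)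
  qed
  ultimately have "F dvd int n - N" by (simp only: coprime_dvd_mult_right_iff)
  hence "int n mod F = N mod F" by (simp add: mod_eq_dvd_iff)
  hence "int n mod F = N" using N by simp
  moreover have "int n = F * (int n div F) + int n mod F" by simp
  ultimately have "int n = F * (int n div F) + N" by simp
  moreover have "int (n div 5 ^ \<alpha>) = int n div F" by (simp add: F_def zdiv_int)
  ultimately have "12 * F * (int (n div 5 ^ \<alpha>) + int \<beta>) = 12 * int n - 12 * N + 12 * F * int \<beta>"
    by (simp add: algebra_simps)
  also have "\<dots> = 12 * int n - shift12 \<beta> + shift12 \<beta> * G" by (simp add: N_def g algebra_simps)
  finally show ?thesis by (simp add: F_def G_def)
qed

lemma Lser_Vser:
  assumes \<beta>: "\<beta> \<in> {0, 1}" and \<alpha>: "\<alpha> \<ge> 1" and \<tau>: "\<tau> \<in> uhp"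
  shows "Lser \<beta> \<alpha> \<tau> = Vser \<beta> \<alpha> \<tau> / (kappa \<beta> * (theta (1 - \<beta>) (5 ^ (\<alpha> mod 2) * \<tau>) / eta (5 ^ (\<alpha> mod 2) * \<tau>) ^ 2))"
proof -
  define f :: nat where "f = 5 ^ (\<alpha> mod 2)"
  have f: "1 + 4 * (\<alpha> mod 2) = f"
  proof -
    have "\<alpha> mod 2 = 0 \<or> \<alpha> mod 2 = 1" by linarith
    thus ?thesis by (elim disjE) (simp_all add: f_def)
  qed
  have f\<tau>: "of_nat f * \<tau> \<in> uhp" by (rule uhp_mult[OF \<tau>]) (simp add: f_def)
  define E where "E = ee (of_int (shift12 \<beta>) * (of_nat f * \<tau>) / 12)"
  have tm: "nome \<tau> ^ (n div 5 ^ \<alpha> + \<beta>) = E * ee (of_int (12 * int n - shift12 \<beta>) * \<tau> / (12 * 5 ^ \<alpha>))"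
    if "n \<in> index_set \<beta> \<alpha>" for n
  proof -
    have "of_int (12 * 5 ^ \<alpha> * int (n div 5 ^ \<alpha> + \<beta>)) = (of_int (12 * int n - shift12 \<beta> + shift12 \<beta> * 5 ^ (\<alpha> + \<alpha> mod 2)) :: complex)"
      by (simp only: index_floor[OF \<beta> \<alpha> that])
    hence i: "12 * 5 ^ \<alpha> * of_nat (n div 5 ^ \<alpha> + \<beta>) =
        of_int (12 * int n - shift12 \<beta>) + of_int (shift12 \<beta>) * (5 ^ \<alpha> * of_nat f :: complex)"
      by (simp add: f_def power_add)
    have "X = (Y + e * (p * f)) / (12 * p)" if "12 * p * X = Y + e * (p * f)" "p \<noteq> 0" for X Y e p f :: complex
      using that by (simp add: field_simps)
    from this[OF i] have X: "of_nat (n div 5 ^ \<alpha> + \<beta>) = (of_int (12 * int n - shift12 \<beta>) + of_int (shift12 \<beta>) * (5 ^ \<alpha> * of_nat f)) / (12 * 5 ^ \<alpha> :: complex)"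
      by simp
    have "(Y + e * (p * f)) / (12 * p) * \<tau> = e * (f * \<tau>) / 12 + Y * \<tau> / (12 * p)" if "p \<noteq> 0" for Y e p f :: complex
      using that by (simp add: field_simps)
    hence "of_nat (n div 5 ^ \<alpha> + \<beta>) * \<tau> = of_int (shift12 \<beta>) * (of_nat f * \<tau>) / 12 + of_int (12 * int n - shift12 \<beta>) * \<tau> / (12 * 5 ^ \<alpha>)"
      unfolding X by simp
    thus ?thesis by (simp only: nome_eq_ee ee_power E_def ee_add)
  qed
  have "(\<Sum>\<^sub>\<infinity>n\<in>index_set \<beta> \<alpha>. cpsi2 \<beta> n * nome \<tau> ^ (n div 5 ^ \<alpha> + \<beta>)) = E * Vser \<beta> \<alpha> \<tau>"
    unfolding Vser_def infsum_cmult_right' [symmetric]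
    by (rule infsum_cong) (simp only: tm mult_ac)
  moreover have "CPsi2 \<beta> (nome \<tau> ^ f) = E * (kappa \<beta> * (theta (1 - \<beta>) (of_nat f * \<tau>) / eta (of_nat f * \<tau>) ^ 2))"
    using CPsi2_theta[OF f\<tau> \<beta>] by (simp add: nome_eq_ee ee_power E_def)
  ultimately have "Lser \<beta> \<alpha> \<tau> = 1 / (E * (kappa \<beta> * (theta (1 - \<beta>) (of_nat f * \<tau>) / eta (of_nat f * \<tau>) ^ 2))) * (E * Vser \<beta> \<alpha> \<tau>)"
    unfolding Lser_def f index_set_eq[OF \<beta>] if_P[OF \<tau>] by (simp only:)
  moreover have "E \<noteq> 0" by (simp add: E_def)
  ultimately show ?thesis by (simp add: f_def)
qed

lemma Lser_form:
  assumes "\<alpha> \<ge> 1"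
  obtains A B where "laur A" "laur B"
    "\<And>\<beta> \<tau>. \<beta> \<in> {0, 1} \<Longrightarrow> \<tau> \<in> uhp \<Longrightarrow> Lser \<beta> \<alpha> \<tau> = A (fn_t \<tau>) +
       B (fn_t \<tau>) * (if even \<alpha> then WW \<tau> * zz (1 - \<beta>) \<tau> else WW \<tau> / zz (1 - \<beta>) \<tau>)"
proof -
  obtain A B where AB: "laur A" "laur B" and V: "\<And>\<beta> \<tau>. \<beta> \<in> {0, 1} \<Longrightarrow> \<tau> \<in> uhp \<Longrightarrow> Vser \<beta> \<alpha> \<tau> = kappa \<beta> *
     (if even \<alpha> then (A (fn_t \<tau>) * theta (1 - \<beta>) \<tau> + WW \<tau> * B (fn_t \<tau>) * theta (1 - \<beta>) (5 * \<tau>)) / eta \<tau> ^ 2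
      else (A (fn_t \<tau>) * theta (1 - \<beta>) (5 * \<tau>) + WW \<tau> * B (fn_t \<tau>) * theta (1 - \<beta>) \<tau>) / eta (5 * \<tau>) ^ 2)"
    using Vser_form[of \<alpha>] by blast
  show ?thesis
  proof (rule that[OF AB])
    fix \<beta> :: nat and \<tau> assume \<beta>: "\<beta> \<in> {0, 1}" and \<tau>: "\<tau> \<in> uhp"
    have c: "1 - \<beta> < 2" by simp
    have nz: "theta (1 - \<beta>) \<tau> \<noteq> 0" "theta (1 - \<beta>) (5 * \<tau>) \<noteq> 0" "eta \<tau> \<noteq> 0" "eta (5 * \<tau>) \<noteq> 0" "kappa \<beta> \<noteq> 0"
      using \<tau> c by (simp_all add: theta_nonzero eta_nonzero kappa_nonzero)
    show "Lser \<beta> \<alpha> \<tau> = A (fn_t \<tau>) +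
       B (fn_t \<tau>) * (if even \<alpha> then WW \<tau> * zz (1 - \<beta>) \<tau> else WW \<tau> / zz (1 - \<beta>) \<tau>)"
    proof (cases "even \<alpha>")
      case True
      have m: "\<alpha> mod 2 = 0" using True by presburger
      have "k * ((a * u + W * b * w) / e ^ 2) / (k * (u / e ^ 2)) = a + b * (W * (w / u))"
        if "k \<noteq> 0" "u \<noteq> 0" "e \<noteq> 0" for k a u W b w e :: complex
        using that by (simp add: field_simps)
      thus ?thesis
        unfolding Lser_Vser[OF \<beta> assms \<tau>] V[OF \<beta> \<tau>] zz_def using True nz m by simp
    next
      case False
      have m: "\<alpha> mod 2 = 1" using False by presburger
      have "k * ((a * w + W * b * u) / e ^ 2) / (k * (w / e ^ 2)) = a + b * (W / (w / u))"
        if "k \<noteq> 0" "u \<noteq> 0" "e \<noteq> 0" "w \<noteq> 0" for k a u W b w e :: complex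
        using that by (simp add: field_simps)
      thus ?thesis
        unfolding Lser_Vser[OF \<beta> assms \<tau>] V[OF \<beta> \<tau>] zz_def using False nz m by simp
    qed
  qed
qed

section \<open>Independence over rational functions of \<open>t\<close>\<close>

lemma mero_eq_iff: "mero_eq f g \<longleftrightarrow> (\<forall>x\<in>uhp. \<forall>\<^sub>F \<tau> in at x. f \<tau> = g \<tau>)"
  unfolding mero_eq_def by (rule eventually_cosparse_open_eq[OF open_uhp])

lemma mero_eqI: "(\<And>\<tau>. \<tau> \<in> uhp \<Longrightarrow> f \<tau> = g \<tau>) \<Longrightarrow> mero_eq f g"
  unfolding mero_eq_iff
  by (intro ballI eventually_mono[OF eventually_at_in_open'[OF open_uhp]])

text \<open>Equality near a point carries over poles and limits, and for the normalised
  representatives these determine the value, which is 0 at a pole.\<close>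

lemma mero_uhp_eqI:
  assumes f: "f \<in> mero_uhp" and g: "g \<in> mero_uhp" and eq: "mero_eq f g"
  shows "f = g"
proof
  fix x
  show "f x = g x"
  proof (cases "x \<in> uhp")
    case False
    thus ?thesis using f g by (auto simp: mero_uhp_def)
  next
    case True
    have ev: "\<forall>\<^sub>F \<tau> in at x. f \<tau> = g \<tau>" using eq True by (auto simp: mero_eq_iff)
    have pole: "is_pole f x \<longleftrightarrow> is_pole g x"
      unfolding is_pole_def by (rule filterlim_cong[OF refl refl ev])
    have F: "(is_pole f x \<and> f x = 0) \<or> f \<midarrow>x\<rightarrow> f x" and G: "(is_pole g x \<and> g x = 0) \<or> g \<midarrow>x\<rightarrow> g x"
      using f g True by (auto simp: mero_uhp_def nicely_meromorphic_on_def)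
    show ?thesis
    proof (cases "is_pole f x")
      case True
      hence "\<not> f \<midarrow>x\<rightarrow> f x" "\<not> g \<midarrow>x\<rightarrow> g x"
        using pole not_tendsto_and_filterlim_at_infinity[of "at x"] unfolding is_pole_def by auto
      thus ?thesis using F G by auto
    next
      case False
      hence 1: "f \<midarrow>x\<rightarrow> f x" "g \<midarrow>x\<rightarrow> g x" using F G pole by auto
      have "f \<midarrow>x\<rightarrow> g x"
        using filterlim_cong[OF refl refl ev] 1(2) by blast
      thus ?thesis using 1(1) tendsto_unique by (metis at_neq_bot)
    qed
  qed
qed

text \<open>A finite range omitting 0 would stay away from 0, contradicting the limit.\<close>

lemma infinite_range_cusp:
  assumes "cusp_lim f 0" "\<And>\<tau>. \<tau> \<in> uhp \<Longrightarrow> f \<tau> \<noteq> 0"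
  shows "infinite (f ` uhp)"
proof
  assume fin: "finite (f ` uhp)"
  hence "open (- (f ` uhp))" by (simp add: finite_imp_closed open_Compl)
  moreover have "0 \<in> - (f ` uhp)" using assms(2) by force
  ultimately have "\<forall>\<^sub>F y::real in at_top. f (\<i> * of_real y) \<in> - (f ` uhp)"
    using assms(1) unfolding cusp_lim_def by (rule topological_tendstoD[rotated])
  hence "\<forall>\<^sub>F y::real in at_top. False"
    using eventually_gt_at_top[of 0] by eventually_elim (auto simp: uhp_iff)
  thus False by simp
qed

lemma infinite_range_x: "infinite (fn_x ` uhp)"
  by (rule infinite_range_cusp[OF cusp_lim_x fn_nonzero(2)])

lemma cusp_lim_t: "cusp_lim fn_t 0"
proof -
  have "cusp_lim (\<lambda>\<tau>. fn_x \<tau> * (1 + 4 * fn_x \<tau>) ^ 2 / (1 + 5 * fn_x \<tau>)) (0 * (1 + 4 * 0) ^ 2 / 1)"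
    by (intro cusp_lim_mult cusp_lim_divide cusp_lim_add cusp_lim_power cusp_lim_const cusp_lim_x cusp_lim_v) auto
  moreover have "fn_t \<tau> = fn_x \<tau> * (1 + 4 * fn_x \<tau>) ^ 2 / (1 + 5 * fn_x \<tau>)" if "\<tau> \<in> uhp" for \<tau>
    using t_eq_x[OF that] v_nonzero[OF that] by (simp add: nonzero_eq_divide_eq)
  ultimately show ?thesis
    using cusp_lim_cong[of fn_t "\<lambda>\<tau>. fn_x \<tau> * (1 + 4 * fn_x \<tau>) ^ 2 / (1 + 5 * fn_x \<tau>)" 0] by simp
qed

lemma infinite_range_t: "infinite (fn_t ` uhp)"
  by (rule infinite_range_cusp[OF cusp_lim_t fn_nonzero(1)])

lemma poly_eq_0_on_infinite:
  fixes P :: "complex poly"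
  assumes "infinite A" "\<And>x. x \<in> A \<Longrightarrow> poly P x = 0"
  shows "P = 0"
proof (rule ccontr)
  assume "P \<noteq> 0"
  hence "finite {x. poly P x = 0}" by (rule poly_roots_finite)
  moreover have "A \<subseteq> {x. poly P x = 0}" using assms(2) by auto
  ultimately show False using assms(1) finite_subset by blast
qed

lemma poly_t_nonzero_nearby:
  assumes "Q \<noteq> 0" "x \<in> uhp"
  shows "\<forall>\<^sub>F \<tau> in at x. poly Q (fn_t \<tau>) \<noteq> 0"
proof -
  have hol: "(\<lambda>\<tau>. poly Q (fn_t \<tau>)) holomorphic_on uhp"
    by (intro holomorphic_intros holomorphic_fn)
  have "\<exists>\<tau>\<in>uhp. poly Q (fn_t \<tau>) \<noteq> 0"
    using poly_eq_0_on_infinite[OF infinite_range_t, of Q] assms(1) by auto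
  then obtain \<beta> where \<beta>: "\<beta> \<in> uhp" "poly Q (fn_t \<beta>) \<noteq> 0" by blast
  from non_zero_neighbour_alt[OF hol open_uhp connected_uhp assms(2) \<beta>] show ?thesis
    by (rule eventually_mono) auto
qed

text \<open>The numerator of b (t) as a rational function of x, for t = x (1 + 4 x)^2 / (1 + 5 x)
  and common denominator (1 + 5 x)^N.\<close>

definition hat :: "nat \<Rightarrow> complex poly \<Rightarrow> complex poly" where
  "hat N b = (\<Sum>i\<le>N. smult (coeff b i) (([:0, 1:] * [:1, 4:] ^ 2) ^ i * [:1, 5:] ^ (N - i)))"

lemma poly_hat:
  assumes "degree b \<le> N" "t * (1 + 5 * x) = x * (1 + 4 * x) ^ 2"
  shows "poly (hat N b) x = (1 + 5 * x) ^ N * poly b t"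
proof -
  have "poly (hat N b) x = (\<Sum>i\<le>N. coeff b i * ((t * (1 + 5 * x)) ^ i * (1 + 5 * x) ^ (N - i)))"
    unfolding assms(2) by (simp add: hat_def poly_sum mult.commute)
  also have "\<dots> = (\<Sum>i\<le>N. (1 + 5 * x) ^ N * (coeff b i * t ^ i))"
  proof (rule sum.cong[OF refl])
    fix i assume "i \<in> {..N}"
    hence "(1 + 5 * x) ^ N = (1 + 5 * x) ^ i * (1 + 5 * x) ^ (N - i)" by (simp flip: power_add)
    thus "coeff b i * ((t * (1 + 5 * x)) ^ i * (1 + 5 * x) ^ (N - i)) = (1 + 5 * x) ^ N * (coeff b i * t ^ i)"
      by (simp only: power_mult_distrib mult_ac)
  qed
  also have "\<dots> = (1 + 5 * x) ^ N * (\<Sum>i\<le>N. coeff b i * t ^ i)"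
    by (simp only: sum_distrib_left)
  also have "(\<Sum>i\<le>N. coeff b i * t ^ i) = poly b t"
    unfolding poly_altdef
    by (rule sum.mono_neutral_right) (use assms(1) in \<open>auto intro: le_degree\<close>)
  finally show ?thesis .
qed

lemma hat_pCons_0: "hat (Suc N) (pCons 0 b) = ([:0, 1:] * [:1, 4:] ^ 2) * hat N b"
proof -
  have "hat (Suc N) (pCons 0 b) = (\<Sum>i\<le>N. smult (coeff b i) (([:0, 1:] * [:1, 4:] ^ 2) ^ Suc i * [:1, 5:] ^ (N - i)))"
    unfolding hat_def by (subst sum.atMost_Suc_shift) simp
  also have "\<dots> = ([:0, 1:] * [:1, 4:] ^ 2) * hat N b"
    unfolding hat_def sum_distrib_left by (intro sum.cong refl) (simp only: power_Suc mult_smult_right mult.assoc)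
  finally show ?thesis .
qed

lemma poly_hat_special:
  "poly (hat N b) 0 = coeff b 0" "poly (hat N b) (- (1 / 4)) = coeff b 0 * (- (1 / 4)) ^ N"
proof -
  have "poly (hat N b) 0 = (\<Sum>i\<le>N. if i = 0 then coeff b 0 else 0)"
    unfolding hat_def poly_sum by (intro sum.cong refl) (auto simp: power_0_left)
  thus "poly (hat N b) 0 = coeff b 0" by simp
  have "poly (hat N b) (- (1 / 4)) = (\<Sum>i\<le>N. if i = 0 then coeff b 0 * (- (1 / 4)) ^ N else 0)"
    unfolding hat_def poly_sum by (intro sum.cong refl) (auto simp: power_0_left)
  thus "poly (hat N b) (- (1 / 4)) = coeff b 0 * (- (1 / 4)) ^ N" by simp
qed

text \<open>\<open>(1 + 4 x)^2\<close> is not a rational function of \<open>t\<close>: it separates the points \<open>x = 0\<close> and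
  \<open>x = -1/4\<close> above \<open>t = 0\<close>.\<close>

lemma hat_independent:
  assumes "degree b \<le> N" "degree c \<le> N" "hat N b + [:1, 4:] ^ 2 * hat N c = 0"
  shows "b = 0 \<and> c = 0"
  using assms
proof (induction N arbitrary: b c)
  case (0 b c)
  have 1: "poly (hat 0 b + [:1, 4:] ^ 2 * hat 0 c) 0 = 0" "poly (hat 0 b + [:1, 4:] ^ 2 * hat 0 c) (- (1 / 4)) = 0"
    unfolding 0(3) by simp_all
  hence "coeff b 0 = 0" "coeff c 0 = 0" by (simp_all add: poly_hat_special)
  thus ?case using 0(1,2) by (metis degree_0_id le_zero_eq pCons_0_0)
next
  case (Suc N b c)
  have 1: "poly (hat (Suc N) b + [:1, 4:] ^ 2 * hat (Suc N) c) 0 = 0"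
    "poly (hat (Suc N) b + [:1, 4:] ^ 2 * hat (Suc N) c) (- (1 / 4)) = 0"
    unfolding Suc.prems(3) by simp_all
  \<comment> \<open>At x = -1/4 the factor (1 + 4 x)^2 removes c, which gives b first; x = 0 then
    gives c. Both polynomials are therefore divisible by t, and the induction strips one factor t
    from each.\<close>
  from 1(2) have b0: "coeff b 0 = 0" by (simp add: poly_hat_special)
  with 1(1) have c0: "coeff c 0 = 0" by (simp add: poly_hat_special)
  obtain b' c' where bc: "b = pCons 0 b'" "c = pCons 0 c'"
    using b0 c0 by (metis coeff_pCons_0 pCons_cases)
  have "([:0, 1:] * [:1, 4:] ^ 2) * (hat N b' + [:1, 4:] ^ 2 * hat N c') = 0"
    using Suc.prems(3) unfolding bc hat_pCons_0 by (simp only: distrib_left mult_ac)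
  moreover have "[:0, 1:] * [:1, 4:] ^ 2 \<noteq> (0 :: complex poly)" by simp
  ultimately have "hat N b' + [:1, 4:] ^ 2 * hat N c' = 0" by (simp only: mult_eq_0_iff simp_thms)
  moreover have "degree b' \<le> N" "degree c' \<le> N"
    using Suc.prems(1,2) unfolding bc by (auto simp: degree_pCons_eq_if split: if_splits)
  ultimately show ?case using Suc.IH[of b' c'] bc by simp
qed

lemma fn_p_xY:
  assumes \<tau>: "\<tau> \<in> uhp" and \<beta>: "\<beta> \<in> {0, 1}"
  defines "x \<equiv> fn_x \<tau>" and "t \<equiv> fn_t \<tau>" and "Y \<equiv> (if \<beta> = 1 then 1 else -1) * (8 * fn_y \<tau> + 1 + 6 * fn_x \<tau>)"
  shows "2 * (1 + 5 * x) ^ 2 * fn_p0 \<beta> \<tau> =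
      2 * (1 + 5 * x) ^ 2 * (1 + 70 * t + 625 * t ^ 2) - (1 + 12 * x + 40 * x ^ 2) * (1 + 8 * x + 20 * x ^ 2 + Y)"
    and "2 * (1 + 5 * x) ^ 2 * fn_p1 \<beta> \<tau> = (1 + 4 * x) ^ 2 * (1 + 12 * x + 40 * x ^ 2) * (1 + 8 * x + 20 * x ^ 2 - Y)"
    and "Y ^ 2 = (1 + 4 * x) * (1 + 8 * x + 20 * x ^ 2)"
proof -
  have tv: "t * (1 + 5 * x) = x * (1 + 4 * x) ^ 2"
    using t_eq_x[OF \<tau>] by (simp add: x_def t_def)
  note F = fn_p_formulas[OF tv refl, of "fn_y \<tau>"]
  show "2 * (1 + 5 * x) ^ 2 * fn_p0 \<beta> \<tau> =
      2 * (1 + 5 * x) ^ 2 * (1 + 70 * t + 625 * t ^ 2) - (1 + 12 * x + 40 * x ^ 2) * (1 + 8 * x + 20 * x ^ 2 + Y)"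
    "2 * (1 + 5 * x) ^ 2 * fn_p1 \<beta> \<tau> = (1 + 4 * x) ^ 2 * (1 + 12 * x + 40 * x ^ 2) * (1 + 8 * x + 20 * x ^ 2 - Y)"
    using \<beta> F unfolding fn_p0_def fn_p1_def Let_def x_def t_def Y_def by auto
  have "Y ^ 2 = (ss \<tau> * dd \<tau>) ^ 2"
    unfolding Y_def dd_ss[OF \<tau>] by (simp add: power_mult_distrib)
  thus "Y ^ 2 = (1 + 4 * x) * (1 + 8 * x + 20 * x ^ 2)"
    unfolding power_mult_distrib ss_square[OF \<tau>] dd_square[OF \<tau>] x_def .
qed

text \<open>Parity of degrees. Applied to the cubic Y^2, it says that Y, and with it y, is not
  rational in x.\<close>

lemma square_times_cubic_eq_0:
  fixes A B C :: "complex poly"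
  assumes "A ^ 2 = B ^ 2 * C" "odd (degree C)"
  shows "A = 0 \<and> B = 0"
proof (cases "B = 0")
  case True
  thus ?thesis using assms(1) by simp
next
  case False
  have C: "C \<noteq> 0" using assms(2) by auto
  hence "A \<noteq> 0" using assms(1) False by auto
  hence "2 * degree A = 2 * degree B + degree C"
    using arg_cong[OF assms(1), of degree] False C by (simp add: degree_mult_eq degree_power_eq)
  hence False using assms(2) by presburger
  thus ?thesis ..
qed

text \<open>In terms of x and Y the relation becomes P (x) = Y Q (x). Squaring and comparing degrees
  forces P = Q = 0; then Q = 0 yields b = c = 0 by \<open>hat_independent\<close>, and P = 0 yields
  d = 0.\<close>

lemma p_independent:
  fixes a b c :: "complex poly"
  assumes \<beta>: "\<beta> \<in> {0, 1}"
    and rel: "\<And>\<tau>. \<tau> \<in> uhp \<Longrightarrow> poly a (fn_t \<tau>) + poly b (fn_t \<tau>) * fn_p0 \<beta> \<tau> + poly c (fn_t \<tau>) * fn_p1 \<beta> \<tau> = 0"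
  shows "a = 0 \<and> b = 0 \<and> c = 0"
proof -
  \<comment> \<open>Absorbs the summand of p0 that is polynomial in t.\<close>
  define d where "d = a + b * [:1, 70, 625:]"
  define N where "N = max (degree d) (max (degree b) (degree c))"
  have deg: "degree d \<le> N" "degree b \<le> N" "degree c \<le> N" by (simp_all add: N_def)
  define K D U V :: "complex poly" where "K = [:1, 12, 40:]" and "D = [:1, 8, 20:]" and "U = [:1, 4:]" and "V = [:1, 5:]"
  define P where "P = 2 * V ^ 2 * hat N d + K * D * (U ^ 2 * hat N c - hat N b)"
  define Q where "Q = K * (hat N b + U ^ 2 * hat N c)"
  have "P ^ 2 - Q ^ 2 * (U * D) = 0"
  proof (rule poly_eq_0_on_infinite[OF infinite_range_x])
    fix x assume "x \<in> fn_x ` uhp"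
    then obtain \<tau> where \<tau>: "\<tau> \<in> uhp" and x: "x = fn_x \<tau>" by blast
    define t where "t = fn_t \<tau>"
    define Y where "Y = (if \<beta> = 1 then 1 else -1) * (8 * fn_y \<tau> + 1 + 6 * fn_x \<tau>)"
    have tv: "t * (1 + 5 * x) = x * (1 + 4 * x) ^ 2"
      using t_eq_x[OF \<tau>] by (simp add: x t_def)
    note h = poly_hat[OF deg(1) tv] poly_hat[OF deg(2) tv] poly_hat[OF deg(3) tv]
    note p = fn_p_xY[OF \<tau> \<beta>, folded x t_def Y_def]
    have ev: "poly K x = 1 + 12 * x + 40 * x ^ 2" "poly D x = 1 + 8 * x + 20 * x ^ 2" "poly U x = 1 + 4 * x" "poly V x = 1 + 5 * x"
      by (simp_all add: K_def D_def U_def V_def power2_eq_square algebra_simps)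
    have dt: "poly d t = poly a t + poly b t * (1 + 70 * t + 625 * t ^ 2)"
      by (simp add: d_def power2_eq_square algebra_simps)
    define va pb pc k e u where "va = (1 + 5 * x) ^ N" and "pb = poly b t" and "pc = poly c t"
      and "k = 1 + 12 * x + 40 * x ^ 2" and "e = 1 + 8 * x + 20 * x ^ 2" and "u = 1 + 4 * x"
    have "0 = va * (2 * (1 + 5 * x) ^ 2 * (poly a t + pb * fn_p0 \<beta> \<tau> + pc * fn_p1 \<beta> \<tau>))"
      using rel[OF \<tau>] by (simp add: t_def pb_def pc_def)
    also have "\<dots> = va * (2 * (1 + 5 * x) ^ 2 * poly a t + pb * (2 * (1 + 5 * x) ^ 2 * fn_p0 \<beta> \<tau>) + pc * (2 * (1 + 5 * x) ^ 2 * fn_p1 \<beta> \<tau>))"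
      by algebra
    also have "\<dots> = poly P x - Y * poly Q x"
      unfolding p(1,2) P_def Q_def poly_add poly_diff poly_mult poly_power h ev dt poly_numeral
        va_def [symmetric] pb_def [symmetric] pc_def [symmetric] k_def [symmetric] e_def [symmetric] u_def [symmetric]
      by algebra
    finally have "poly P x = Y * poly Q x" by simp
    thus "poly (P ^ 2 - Q ^ 2 * (U * D)) x = 0"
      by (simp only: poly_diff poly_mult poly_power ev power_mult_distrib p(3)) simp
  qed
  hence sq: "P ^ 2 = Q ^ 2 * (U * D)" by simp
  have "degree (U * D) = 3" by (simp add: U_def D_def degree_mult_eq)
  hence "P = 0" "Q = 0" using square_times_cubic_eq_0[OF sq] by auto
  moreover have "K \<noteq> 0" "V \<noteq> 0" by (simp_all add: K_def V_def)
  ultimately have bc: "b = 0" "c = 0"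
    using hat_independent[OF deg(2,3)] by (simp_all add: Q_def U_def)
  have "hat N 0 = 0" by (simp add: hat_def)
  hence "2 * V ^ 2 * hat N d = 0" using \<open>P = 0\<close> bc by (simp add: P_def)
  hence "hat N d = 0" using \<open>V \<noteq> 0\<close> by simp
  hence "d = 0" using hat_independent[OF deg(1), of 0] \<open>hat N 0 = 0\<close> by simp
  thus ?thesis using bc by (simp add: d_def)
qed

section \<open>Representations over the rational functions of t\<close>

lemma holomorphic_fn_p: "fn_p0 \<beta> holomorphic_on uhp" "fn_p1 \<beta> holomorphic_on uhp"
proof -
  show "fn_p0 \<beta> holomorphic_on uhp"
    unfolding fn_p0_def [abs_def] Let_def
    by (cases "\<beta> = 1"; simp only: simp_thms if_True if_False; intro holomorphic_intros holomorphic_fn)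
  show "fn_p1 \<beta> holomorphic_on uhp"
    unfolding fn_p1_def [abs_def] Let_def
    by (cases "\<beta> = 1"; simp only: simp_thms if_True if_False; intro holomorphic_intros holomorphic_fn)
qed

lemma laur_Ct:
  assumes "laur A"
  obtains F where "F \<in> Ct" "\<And>\<tau>. \<tau> \<in> uhp \<Longrightarrow> F \<tau> = A (fn_t \<tau>)"
proof -
  obtain P n where P: "\<And>t. t \<noteq> 0 \<Longrightarrow> A t = poly P t / t ^ n"
    using assms unfolding laur_def by blast
  show ?thesis
  proof (rule that)
    show "(\<lambda>\<tau>. poly P (fn_t \<tau>) / poly (monom 1 n) (fn_t \<tau>)) \<in> Ct"
      unfolding Ct_def mem_Collect_eq by (intro exI[of _ P] exI[of _ "monom 1 n"]) simp
    show "poly P (fn_t \<tau>) / poly (monom 1 n) (fn_t \<tau>) = A (fn_t \<tau>)" if "\<tau> \<in> uhp" for \<tau>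
      using P[OF fn_nonzero(1)[OF that]] by (simp add: poly_monom)
  qed
qed

text \<open>\<open>fn_p_theta\<close> is solved for W z and W / z: the first is (1 + 70 t + 625 t^2
  - p0) / t, the second p1 / t^2. So p0 occurs for even \<alpha> and p1 for odd \<alpha>.\<close>

lemma Lser_Ct_form:
  assumes "\<alpha> \<ge> 1"
  obtains A B C where "A \<in> Ct" "B \<in> Ct" "C \<in> Ct"
    "\<And>\<beta> \<tau>. \<beta> \<in> {0, 1} \<Longrightarrow> \<tau> \<in> uhp \<Longrightarrow> Lser \<beta> \<alpha> \<tau> = A \<tau> + B \<tau> * fn_p0 \<beta> \<tau> + C \<tau> * fn_p1 \<beta> \<tau>"
proof -
  obtain A B where AB: "laur A" "laur B" and L: "\<And>\<beta> \<tau>. \<beta> \<in> {0, 1} \<Longrightarrow> \<tau> \<in> uhp \<Longrightarrow> Lser \<beta> \<alpha> \<tau> = A (fn_t \<tau>) +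
       B (fn_t \<tau>) * (if even \<alpha> then WW \<tau> * zz (1 - \<beta>) \<tau> else WW \<tau> / zz (1 - \<beta>) \<tau>)"
    using Lser_form[OF assms] by blast
  define A' where "A' = (\<lambda>t. if even \<alpha> then A t + B t * ((1 + 70 * t + 625 * t ^ 2) * (1 / t)) else A t)"
  define B' where "B' = (\<lambda>t. if even \<alpha> then (-1) * (B t * (1 / t)) else 0)"
  define C' where "C' = (\<lambda>t. if even \<alpha> then 0 else B t * (1 / t) ^ 2)"
  have l: "laur (\<lambda>t. (1 / t) ^ 2)" "laur (\<lambda>t. 625 * t ^ 2)" "laur (\<lambda>t. 70 * t)"
    by (rule laur_power[OF laur_inverse] laur_mult[OF laur_const laur_power[OF laur_id]] laur_mult[OF laur_const laur_id])+
  have l2: "laur (\<lambda>t. (1 + 70 * t + 625 * t ^ 2) * (1 / t))"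
    by (rule laur_mult[OF laur_add[OF laur_add[OF laur_const l(3)] l(2)] laur_inverse])
  have "laur A'"
    unfolding A'_def by (cases "even \<alpha>"; simp only: if_True if_False; rule laur_add[OF AB(1) laur_mult[OF AB(2) l2]] AB(1))
  moreover have "laur B'"
    unfolding B'_def by (cases "even \<alpha>"; simp only: if_True if_False; rule laur_mult[OF laur_const laur_mult[OF AB(2) laur_inverse]] laur_const)
  moreover have "laur C'"
    unfolding C'_def by (cases "even \<alpha>"; simp only: if_True if_False; rule laur_mult[OF AB(2) l(1)] laur_const)
  ultimately obtain FA FB FC where F: "FA \<in> Ct" "FB \<in> Ct" "FC \<in> Ct"
    "\<And>\<tau>. \<tau> \<in> uhp \<Longrightarrow> FA \<tau> = A' (fn_t \<tau>)" "\<And>\<tau>. \<tau> \<in> uhp \<Longrightarrow> FB \<tau> = B' (fn_t \<tau>)" "\<And>\<tau>. \<tau> \<in> uhp \<Longrightarrow> FC \<tau> = C' (fn_t \<tau>)"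
    by (metis laur_Ct)
  show ?thesis
  proof (rule that[OF F(1-3)])
    fix \<beta> :: nat and \<tau> assume \<beta>: "\<beta> \<in> {0, 1}" and \<tau>: "\<tau> \<in> uhp"
    have t: "fn_t \<tau> \<noteq> 0" using fn_nonzero(1)[OF \<tau>] .
    hence ts: "fn_t \<tau> * (1 / fn_t \<tau>) = 1" by simp
    have 1: "a + b * W = a + b * (q * s) + (-1) * (b * s) * (q - t * W) + 0 * p"
      and 2: "a + b * W = a + 0 * p + b * s ^ 2 * (t ^ 2 * W)" if "t * s = 1" for a b q s t p W :: complex
      using that by algebra+
    show "Lser \<beta> \<alpha> \<tau> = FA \<tau> + FB \<tau> * fn_p0 \<beta> \<tau> + FC \<tau> * fn_p1 \<beta> \<tau>"
    proof (cases "even \<alpha>")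
      case True
      show ?thesis
        unfolding L[OF \<beta> \<tau>] F(4-6)[OF \<tau>] fn_p_theta[OF \<tau> \<beta>] A'_def B'_def C'_def if_P[OF True]
        by (rule 1[OF ts])
    next
      case False
      show ?thesis
        unfolding L[OF \<beta> \<tau>] F(4-6)[OF \<tau>] fn_p_theta[OF \<tau> \<beta>] A'_def B'_def C'_def if_not_P[OF False]
        by (rule 2[OF ts])
    qed
  qed
qed

lemma Lser_mero:
  assumes "\<alpha> \<ge> 1" "\<beta> \<in> {0, 1}"
  shows "Lser \<beta> \<alpha> \<in> mero_uhp"
proof -
  obtain A B where AB: "laur A" "laur B" and L: "\<And>\<beta> \<tau>. \<beta> \<in> {0, 1} \<Longrightarrow> \<tau> \<in> uhp \<Longrightarrow> Lser \<beta> \<alpha> \<tau> = A (fn_t \<tau>) +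
       B (fn_t \<tau>) * (if even \<alpha> then WW \<tau> * zz (1 - \<beta>) \<tau> else WW \<tau> / zz (1 - \<beta>) \<tau>)"
    using Lser_form[OF assms(1)] by blast
  have laur_hol: "(\<lambda>\<tau>. F (fn_t \<tau>)) holomorphic_on uhp" if F: "laur F" for F
  proof -
    obtain P n where P: "\<And>t. t \<noteq> 0 \<Longrightarrow> F t = poly P t / t ^ n"
      using F unfolding laur_def by blast
    have "(\<lambda>\<tau>. poly P (fn_t \<tau>) / fn_t \<tau> ^ n) holomorphic_on uhp"
      by (intro holomorphic_intros holomorphic_fn) (simp add: fn_nonzero)
    thus ?thesis
      by (rule holomorphic_transform) (simp add: P fn_nonzero)
  qed
  have W: "WW holomorphic_on uhp"
    by (rule holomorphic_transform[OF holomorphic_WWx]) (simp add: WW_eq_WWx)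
  have z: "zz (1 - \<beta>) holomorphic_on uhp" by (rule holomorphic_zz) simp
  have znz: "zz (1 - \<beta>) \<tau> \<noteq> 0" if "\<tau> \<in> uhp" for \<tau>
    by (rule zz_nonzero[OF that]) simp
  have 1: "(\<lambda>\<tau>. A (fn_t \<tau>) + B (fn_t \<tau>) * (WW \<tau> * zz (1 - \<beta>) \<tau>)) holomorphic_on uhp"
    by (intro holomorphic_intros laur_hol AB W z)
  have 2: "(\<lambda>\<tau>. A (fn_t \<tau>) + B (fn_t \<tau>) * (WW \<tau> / zz (1 - \<beta>) \<tau>)) holomorphic_on uhp"
    by (intro holomorphic_intros laur_hol AB W z znz)
  have "Lser \<beta> \<alpha> holomorphic_on uhp"
  proof (cases "even \<alpha>")
    case True
    show ?thesis by (rule holomorphic_transform[OF 1]) (simp add: L[OF assms(2)] True)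
  next
    case False
    show ?thesis by (rule holomorphic_transform[OF 2]) (simp add: L[OF assms(2)] False)
  qed
  hence "Lser \<beta> \<alpha> analytic_on uhp" by (simp add: analytic_on_open open_uhp)
  thus ?thesis
    by (auto simp: mero_uhp_def Lser_def analytic_on_imp_nicely_meromorphic_on)
qed

lemma CtE:
  assumes "A \<in> Ct"
  obtains P Q where "A = (\<lambda>\<tau>. poly P (fn_t \<tau>) / poly Q (fn_t \<tau>))" "Q \<noteq> 0"
  using assms unfolding Ct_def by blast

text \<open>Clearing denominators gives a relation F = 0 with coefficients polynomial in t. It holds
  near each point where the denominators do not vanish, and by continuity everywhere. The conclusion
  is local because quotients take the default value 0 at zeros of a denominator.\<close>

lemma Ct_representation_unique:
  assumes \<beta>: "\<beta> \<in> {0, 1}"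
    and Ct: "A \<in> Ct" "B \<in> Ct" "C \<in> Ct" "A' \<in> Ct" "B' \<in> Ct" "C' \<in> Ct"
    and eq: "mero_eq (\<lambda>\<tau>. A \<tau> + B \<tau> * fn_p0 \<beta> \<tau> + C \<tau> * fn_p1 \<beta> \<tau>) (\<lambda>\<tau>. A' \<tau> + B' \<tau> * fn_p0 \<beta> \<tau> + C' \<tau> * fn_p1 \<beta> \<tau>)"
    and x: "x \<in> uhp"
  shows "\<forall>\<^sub>F \<tau> in at x. A \<tau> = A' \<tau> \<and> B \<tau> = B' \<tau> \<and> C \<tau> = C' \<tau>"
proof -
  obtain P1 Q1 where e1: "A = (\<lambda>\<tau>. poly P1 (fn_t \<tau>) / poly Q1 (fn_t \<tau>))" and nz1: "Q1 \<noteq> 0"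
    using Ct(1) by (rule CtE)
  obtain P2 Q2 where e2: "B = (\<lambda>\<tau>. poly P2 (fn_t \<tau>) / poly Q2 (fn_t \<tau>))" and nz2: "Q2 \<noteq> 0"
    using Ct(2) by (rule CtE)
  obtain P3 Q3 where e3: "C = (\<lambda>\<tau>. poly P3 (fn_t \<tau>) / poly Q3 (fn_t \<tau>))" and nz3: "Q3 \<noteq> 0"
    using Ct(3) by (rule CtE)
  obtain R1 S1 where e4: "A' = (\<lambda>\<tau>. poly R1 (fn_t \<tau>) / poly S1 (fn_t \<tau>))" and nz4: "S1 \<noteq> 0"
    using Ct(4) by (rule CtE)
  obtain R2 S2 where e5: "B' = (\<lambda>\<tau>. poly R2 (fn_t \<tau>) / poly S2 (fn_t \<tau>))" and nz5: "S2 \<noteq> 0"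
    using Ct(5) by (rule CtE)
  obtain R3 S3 where e6: "C' = (\<lambda>\<tau>. poly R3 (fn_t \<tau>) / poly S3 (fn_t \<tau>))" and nz6: "S3 \<noteq> 0"
    using Ct(6) by (rule CtE)
  note nz = nz1 nz2 nz3 nz4 nz5 nz6 and AC = e1 e2 e3 and AC' = e4 e5 e6
  define a where "a = (P1 * S1 - R1 * Q1) * (Q2 * S2 * (Q3 * S3))"
  define b where "b = (P2 * S2 - R2 * Q2) * (Q1 * S1 * (Q3 * S3))"
  define c where "c = (P3 * S3 - R3 * Q3) * (Q1 * S1 * (Q2 * S2))"
  define F where "F = (\<lambda>\<tau>. poly a (fn_t \<tau>) + poly b (fn_t \<tau>) * fn_p0 \<beta> \<tau> + poly c (fn_t \<tau>) * fn_p1 \<beta> \<tau>)"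
  define G where "G = Q1 * Q2 * Q3 * S1 * S2 * S3"
  have G: "G \<noteq> 0" using nz by (simp add: G_def)
  have clear: "(p1 * s1 - r1 * q1) * (q2 * s2 * (q3 * s3)) + (p2 * s2 - r2 * q2) * (q1 * s1 * (q3 * s3)) * p
      + (p3 * s3 - r3 * q3) * (q1 * s1 * (q2 * s2)) * p' = 0"
    if "p1 / q1 + p2 / q2 * p + p3 / q3 * p' = r1 / s1 + r2 / s2 * p + r3 / s3 * p'"
      and nz: "q1 \<noteq> 0" "q2 \<noteq> 0" "q3 \<noteq> 0" "s1 \<noteq> 0" "s2 \<noteq> 0" "s3 \<noteq> 0"
    for p1 q1 p2 q2 p3 q3 r1 s1 r2 s2 r3 s3 p p' :: complex
  proof -
    define g1 g2 g3 h1 h2 h3 where "g1 = p1 / q1" and "g2 = p2 / q2" and "g3 = p3 / q3"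
      and "h1 = r1 / s1" and "h2 = r2 / s2" and "h3 = r3 / s3"
    have e: "p1 = g1 * q1" "p2 = g2 * q2" "p3 = g3 * q3" "r1 = h1 * s1" "r2 = h2 * s2" "r3 = h3 * s3"
      using nz by (simp_all add: g1_def g2_def g3_def h1_def h2_def h3_def)
    have "g1 + g2 * p + g3 * p' = h1 + h2 * p + h3 * p'"
      using that(1) by (simp add: g1_def g2_def g3_def h1_def h2_def h3_def)
    thus ?thesis unfolding e by algebra
  qed
  have "F \<tau> = 0" if \<tau>: "\<tau> \<in> uhp" for \<tau>
  proof -
    have "\<forall>\<^sub>F \<sigma> in at \<tau>. A \<sigma> + B \<sigma> * fn_p0 \<beta> \<sigma> + C \<sigma> * fn_p1 \<beta> \<sigma> = A' \<sigma> + B' \<sigma> * fn_p0 \<beta> \<sigma> + C' \<sigma> * fn_p1 \<beta> \<sigma>"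
      using eq \<tau> by (auto simp: mero_eq_iff)
    hence "\<forall>\<^sub>F \<sigma> in at \<tau>. F \<sigma> = 0"
      using poly_t_nonzero_nearby[OF G \<tau>]
    proof eventually_elim
      case (elim \<sigma>)
      from elim(2) have "poly Q1 (fn_t \<sigma>) \<noteq> 0" "poly Q2 (fn_t \<sigma>) \<noteq> 0" "poly Q3 (fn_t \<sigma>) \<noteq> 0"
        "poly S1 (fn_t \<sigma>) \<noteq> 0" "poly S2 (fn_t \<sigma>) \<noteq> 0" "poly S3 (fn_t \<sigma>) \<noteq> 0"
        by (auto simp: G_def)
      from clear[OF elim(1)[unfolded AC AC'] this] show ?case
        unfolding F_def a_def b_def c_def poly_mult poly_diff .
    qed
    hence "F \<midarrow>\<tau>\<rightarrow> 0" by (rule tendsto_eventually)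
    moreover have "F holomorphic_on uhp"
      unfolding F_def by (intro holomorphic_intros holomorphic_fn holomorphic_fn_p)
    hence "F \<midarrow>\<tau>\<rightarrow> F \<tau>"
      using \<tau> open_uhp by (metis holomorphic_on_imp_continuous_on continuous_on_eq_continuous_at isContD)
    ultimately show ?thesis using tendsto_unique[OF at_neq_bot] by blast
  qed
  hence "a = 0 \<and> b = 0 \<and> c = 0"
    unfolding F_def by (intro p_independent[OF \<beta>])
  hence eqs: "P1 * S1 = R1 * Q1" "P2 * S2 = R2 * Q2" "P3 * S3 = R3 * Q3"
    using nz by (simp_all add: a_def b_def c_def)
  show ?thesis
    using poly_t_nonzero_nearby[OF G x]
  proof eventually_elim
    case (elim \<sigma>)
    hence nz: "poly Q1 (fn_t \<sigma>) \<noteq> 0" "poly Q2 (fn_t \<sigma>) \<noteq> 0" "poly Q3 (fn_t \<sigma>) \<noteq> 0"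
      "poly S1 (fn_t \<sigma>) \<noteq> 0" "poly S2 (fn_t \<sigma>) \<noteq> 0" "poly S3 (fn_t \<sigma>) \<noteq> 0"
      by (auto simp: G_def)
    have "poly (P1 * S1) (fn_t \<sigma>) = poly (R1 * Q1) (fn_t \<sigma>)" "poly (P2 * S2) (fn_t \<sigma>) = poly (R2 * Q2) (fn_t \<sigma>)"
      "poly (P3 * S3) (fn_t \<sigma>) = poly (R3 * Q3) (fn_t \<sigma>)"
      by (simp_all only: eqs)
    thus ?case using nz unfolding AC AC' poly_mult by (simp add: frac_eq_eq)
  qed
qed

theorem theorem3p1:
  fixes \<alpha> \<beta> :: nat
  assumes "\<alpha> \<ge> 1" and "\<beta> \<in> {0, 1}"
  shows "Lser \<beta> \<alpha> \<in> Rspace \<beta> \<and> sigma_map \<beta> (Lser \<beta> \<alpha>) = Lser (1 - \<beta>) \<alpha>"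
proof -
  obtain A B C where Ct: "A \<in> Ct" "B \<in> Ct" "C \<in> Ct"
    and L: "\<And>\<beta> \<tau>. \<beta> \<in> {0, 1} \<Longrightarrow> \<tau> \<in> uhp \<Longrightarrow> Lser \<beta> \<alpha> \<tau> = A \<tau> + B \<tau> * fn_p0 \<beta> \<tau> + C \<tau> * fn_p1 \<beta> \<tau>"
    using Lser_Ct_form[OF assms(1)] by blast
  have \<beta>': "1 - \<beta> \<in> {0, 1}" by auto
  have rep: "mero_eq (Lser \<beta> \<alpha>) (\<lambda>\<tau>. A \<tau> + B \<tau> * fn_p0 \<beta> \<tau> + C \<tau> * fn_p1 \<beta> \<tau>)" if "\<beta> \<in> {0, 1}" for \<beta>
    by (rule mero_eqI) (rule L[OF that])
  have "Lser \<beta> \<alpha> \<in> Rspace \<beta>"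
    unfolding Rspace_def using Lser_mero[OF assms] rep[OF assms(2)] Ct by blast
  moreover have "sigma_map \<beta> (Lser \<beta> \<alpha>) = Lser (1 - \<beta>) \<alpha>"
    unfolding sigma_map_def
  proof (rule the_equality)
    \<comment> \<open>The same A, B, C represent the functions for \<beta> and for 1 -
      \<beta>.\<close>
    show "Lser (1 - \<beta>) \<alpha> \<in> mero_uhp \<and> (\<exists>A\<in>Ct. \<exists>B\<in>Ct. \<exists>C\<in>Ct.
       mero_eq (Lser \<beta> \<alpha>) (\<lambda>\<tau>. A \<tau> + B \<tau> * fn_p0 \<beta> \<tau> + C \<tau> * fn_p1 \<beta> \<tau>) \<and>
       mero_eq (Lser (1 - \<beta>) \<alpha>) (\<lambda>\<tau>. A \<tau> + B \<tau> * fn_p0 (1 - \<beta>) \<tau> + C \<tau> * fn_p1 (1 - \<beta>) \<tau>))"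
      using Lser_mero[OF assms(1) \<beta>'] rep[OF assms(2)] rep[OF \<beta>'] Ct by blast
  next
    fix g
    assume "g \<in> mero_uhp \<and> (\<exists>A\<in>Ct. \<exists>B\<in>Ct. \<exists>C\<in>Ct.
       mero_eq (Lser \<beta> \<alpha>) (\<lambda>\<tau>. A \<tau> + B \<tau> * fn_p0 \<beta> \<tau> + C \<tau> * fn_p1 \<beta> \<tau>) \<and>
       mero_eq g (\<lambda>\<tau>. A \<tau> + B \<tau> * fn_p0 (1 - \<beta>) \<tau> + C \<tau> * fn_p1 (1 - \<beta>) \<tau>))"
    then obtain A' B' C' where g: "g \<in> mero_uhp" and Ct': "A' \<in> Ct" "B' \<in> Ct" "C' \<in> Ct"
      and 1: "mero_eq (Lser \<beta> \<alpha>) (\<lambda>\<tau>. A' \<tau> + B' \<tau> * fn_p0 \<beta> \<tau> + C' \<tau> * fn_p1 \<beta> \<tau>)"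
      and 2: "mero_eq g (\<lambda>\<tau>. A' \<tau> + B' \<tau> * fn_p0 (1 - \<beta>) \<tau> + C' \<tau> * fn_p1 (1 - \<beta>) \<tau>)"
      by blast
    \<comment> \<open>Any other candidate g comes from a second representation of the same
      \<open>Lser \<beta> \<alpha>\<close>; its coefficients agree with A, B, C near every point, so
      g agrees with \<open>Lser (1 - \<beta>) \<alpha>\<close> there.\<close>
    have 3: "mero_eq (\<lambda>\<tau>. A' \<tau> + B' \<tau> * fn_p0 \<beta> \<tau> + C' \<tau> * fn_p1 \<beta> \<tau>) (\<lambda>\<tau>. A \<tau> + B \<tau> * fn_p0 \<beta> \<tau> + C \<tau> * fn_p1 \<beta> \<tau>)"
      unfolding mero_eq_iff
    proof
      fix x assume x: "x \<in> uhp"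
      from 1 x rep[OF assms(2)] have "\<forall>\<^sub>F \<tau> in at x. Lser \<beta> \<alpha> \<tau> = A' \<tau> + B' \<tau> * fn_p0 \<beta> \<tau> + C' \<tau> * fn_p1 \<beta> \<tau>"
        "\<forall>\<^sub>F \<tau> in at x. Lser \<beta> \<alpha> \<tau> = A \<tau> + B \<tau> * fn_p0 \<beta> \<tau> + C \<tau> * fn_p1 \<beta> \<tau>"
        unfolding mero_eq_iff by blast+
      thus "\<forall>\<^sub>F \<tau> in at x. A' \<tau> + B' \<tau> * fn_p0 \<beta> \<tau> + C' \<tau> * fn_p1 \<beta> \<tau> = A \<tau> + B \<tau> * fn_p0 \<beta> \<tau> + C \<tau> * fn_p1 \<beta> \<tau>"
        by eventually_elim simp
    qed
    have "mero_eq g (Lser (1 - \<beta>) \<alpha>)"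
      unfolding mero_eq_iff
    proof
      fix x assume x: "x \<in> uhp"
      from 2 x rep[OF \<beta>'] have "\<forall>\<^sub>F \<tau> in at x. g \<tau> = A' \<tau> + B' \<tau> * fn_p0 (1 - \<beta>) \<tau> + C' \<tau> * fn_p1 (1 - \<beta>) \<tau>"
        "\<forall>\<^sub>F \<tau> in at x. Lser (1 - \<beta>) \<alpha> \<tau> = A \<tau> + B \<tau> * fn_p0 (1 - \<beta>) \<tau> + C \<tau> * fn_p1 (1 - \<beta>) \<tau>"
        unfolding mero_eq_iff by blast+
      with Ct_representation_unique[OF assms(2) Ct' Ct 3 x]
      show "\<forall>\<^sub>F \<tau> in at x. g \<tau> = Lser (1 - \<beta>) \<alpha> \<tau>"
        by eventually_elim simp
    qed
    thus "g = Lser (1 - \<beta>) \<alpha>"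
      by (rule mero_uhp_eqI[OF g Lser_mero[OF assms(1) \<beta>']])
  qed
  ultimately show ?thesis ..
qed

end
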